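(* Let $\pmb k$ be an algebraically closed field and let $B,d,n,g_1,\dots,g_n,\Psi,\mathcal C,\varphi$ be as in the context. Let $p_1,\dots,p_z$ be the singularities of $\mathcal C$. For each singular point $p_j$, let $m_j$ be the multiplicity of $\mathcal C$ at $p_j$ and $s_j$ be the number of branches of $\mathcal C$ at $p_j$. Then the following statements hold: (1) The polynomial $\gcd I_1(p_j\varphi)$ in $\pmb k[x,y]$ has degree equal to $m_j$ and has $s_j$ pairwise non-associated linear factors. (2) The polynomials $\gcd I_1(p_i\varphi)$ and $\gcd I_1(p_j\varphi)$ are relatively prime for $i\ne j$.
   Context: Setting: $B=\pmb k[x,y]$ is the standard graded polynomial ring, $g_1,\dots,g_n$ are homogeneous forms of degree $d$ in $B$, $I=(g_1,\dots,g_n)B$, $\Psi:\mathbb P^1\to\mathbb P^{n-1}$ is the morphism $[g_1:\dots:g_n]$, and $\mathcal C$ is the image of $\Psi$. Assume: (a) $I$ is minimally generated by $g_1,\dots,g_n$; (b) $I$ has height two; (c) $\Psi:\mathbb P^1\to\mathcal C$ is a birational morphism. Let $\varphi$ be a homogeneous Hilbert-Burch matrix for $[g_1,\dots,g_n]$: an $n\times(n-1)$ matrix such that $0\to\bigoplus_{i=1}^{n-1}B(-d_i-d)\xrightarrow{\varphi}B(-d)^n\xrightarrow{[g_1,\dots,g_n]}I\to0$ is a homogeneous resolution of $I$, with $d_1\le\dots\le d_{n-1}$. A point $p=[a_1:\dots:a_n]\in\mathbb P^{n-1}$ is also viewed as a row vector $[a_1,\dots,a_n]$; $I_1(p\varphi)$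 is the ideal of $B$ generated by the entries of the row vector $p\varphi$, and $\gcd I_1(p\varphi)$ is the greatest common divisor of these entries. The multiplicity of $\mathcal C$ at $p$ is the multiplicity of the local ring $\mathcal O_{\mathcal C,p}$, and the number of branches of $\mathcal C$ at $p$ is the number of minimal prime ideals of the completion $\widehat{\mathcal O_{\mathcal C,p}}$. *)

theory Defs
  imports
    Complex_Main
    "HOL-Library.Extended_Nat"
    "HOL-Library.Poly_Mapping"
    "HOL-Algebra.Ideal_Product"
    "HOL-Algebra.QuotRing"
    "HOL-Algebra.Ring_Divisibility"
    "HOL-Algebra.Algebraic_Closure_Type"
    "Jordan_Normal_Form.Matrix"
begin

section \<open>Commutative algebra\<close>

definition chain_of :: "('a set \<Rightarrow> bool) \<Rightarrow> (nat \<Rightarrow> 'a set) \<Rightarrow> nat \<Rightarrow> bool" where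
  "chain_of Q c m \<longleftrightarrow> (\<forall>i\<le>m. Q (c i)) \<and> (\<forall>i<m. c i \<subset> c (Suc i))"

definition prime_height :: "('a, 'b) ring_scheme \<Rightarrow> 'a set \<Rightarrow> enat" where
  "prime_height R P = Sup {enat m | m. \<exists>c. chain_of (\<lambda>J. primeideal J R) c m \<and> c m = P}"

definition height :: "('a, 'b) ring_scheme \<Rightarrow> 'a set \<Rightarrow> enat" where
  "height R I = Inf {prime_height R P | P. primeideal P R \<and> I \<subseteq> P}"

definition krull_dim :: "('a, 'b) ring_scheme \<Rightarrow> enat" where
  "krull_dim R = Sup {enat m | m. \<exists>c. chain_of (\<lambda>J. primeideal J R) c m}"

text \<open>The length of a ring as a module over itself. For an ideal \<open>I\<close> of \<open>R\<close>, the
  \<open>R\<close>-submodules of \<open>R Quot I\<close> are its ideals, so that \<open>ring_length (R Quot I)\<close> is the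
  length of the \<open>R\<close>-module \<open>R/I\<close>.\<close>

definition ring_length :: "('a, 'b) ring_scheme \<Rightarrow> enat" where
  "ring_length R = Sup {enat m | m. \<exists>c. chain_of (\<lambda>J. ideal J R) c m}"

definition local_ring :: "('a, 'b) ring_scheme \<Rightarrow> bool" where
  "local_ring R \<longleftrightarrow> cring R \<and> (\<exists>!M. maximalideal M R)"

definition the_maximal_ideal :: "('a, 'b) ring_scheme \<Rightarrow> 'a set" where
  "the_maximal_ideal R = (THE M. maximalideal M R)"

definition max_power :: "('a, 'b) ring_scheme \<Rightarrow> nat \<Rightarrow> 'a set" where
  "max_power R k = the_maximal_ideal R [^]\<^bsub>ideals_set R\<^esub> k"

definition regular_local_ring :: "('a, 'b) ring_scheme \<Rightarrow> bool" where
  "regular_local_ring R \<longleftrightarrow> noetherian_ring R \<and> local_ring R \<and>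
     (\<exists>S \<subseteq> carrier R. finite S \<and> enat (card S) = krull_dim R \<and> Idl\<^bsub>R\<^esub> S = the_maximal_ideal R)"

text \<open>The (Hilbert--Samuel) multiplicity of a Noetherian local ring \<open>R\<close> with maximal ideal
  \<open>\<mm>\<close> and dimension \<open>D\<close>: the limit of \<open>D! * length(R/\<mm>^k) / k^D\<close>.\<close>

definition local_multiplicity :: "('a, 'b) ring_scheme \<Rightarrow> real" where
  "local_multiplicity R =
     lim (\<lambda>k. fact (the_enat (krull_dim R)) *
              real (the_enat (ring_length (R Quot max_power R k))) /
              real k ^ the_enat (krull_dim R))"

text \<open>The completion of a local ring, as the inverse limit of the rings \<open>R/\<mm>^k\<close>. The
  canonical map from \<open>R/\<mm>^(k+1)\<close> to \<open>R/\<mm>^k\<close> sends a coset to the unique coset of \<open>\<mm>^k\<close>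
  containing it.\<close>

definition completion :: "('a, 'b) ring_scheme \<Rightarrow> (nat \<Rightarrow> 'a set) ring" where
  "completion R =
     \<lparr> carrier = {f. \<forall>k. f k \<in> carrier (R Quot max_power R k) \<and> f (Suc k) \<subseteq> f k},
       monoid.mult = (\<lambda>f h k. f k \<otimes>\<^bsub>R Quot max_power R k\<^esub> h k),
       one = (\<lambda>k. \<one>\<^bsub>R Quot max_power R k\<^esub>),
       zero = (\<lambda>k. \<zero>\<^bsub>R Quot max_power R k\<^esub>),
       add = (\<lambda>f h k. f k \<oplus>\<^bsub>R Quot max_power R k\<^esub> h k) \<rparr>"

definition minimal_primes :: "('a, 'b) ring_scheme \<Rightarrow> 'a set set" where
  "minimal_primes R =
     {P. primeideal P R \<and> (\<forall>Q. primeideal Q R \<and> Q \<subseteq> P \<longrightarrow> Q = P)}"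


section \<open>Binary forms\<close>

text \<open>The ring \<open>B = k[x,y]\<close> is rendered as \<open>k[x][y]\<close>, that is, as the type \<open>'k poly poly\<close>:
  the coefficient of \<open>x^i y^j\<close> in \<open>f\<close> is \<open>coeff (coeff f j) i\<close>.\<close>

definition bform :: "nat \<Rightarrow> 'k::zero poly poly \<Rightarrow> bool" where
  "bform e f \<longleftrightarrow> (\<forall>i j. Polynomial.coeff (Polynomial.coeff f j) i \<noteq> 0 \<longrightarrow> i + j = e)"

definition total_degree :: "'k::zero poly poly \<Rightarrow> nat" where
  "total_degree f = Max (insert 0 {i + j | i j. Polynomial.coeff (Polynomial.coeff f j) i \<noteq> 0})"

definition beval :: "'k::comm_semiring_1 poly poly \<Rightarrow> 'k vec \<Rightarrow> 'k" where
  "beval f q = poly (poly f [:q $ 1:]) (q $ 0)"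

definition is_gcd_of :: "'r::comm_monoid_mult \<Rightarrow> 'r set \<Rightarrow> bool" where
  "is_gcd_of h S \<longleftrightarrow> (\<forall>s\<in>S. h dvd s) \<and> (\<forall>e. (\<forall>s\<in>S. e dvd s) \<longrightarrow> e dvd h)"

text \<open>A greatest common divisor is only determined up to a unit; one is chosen.\<close>

definition gcd_of :: "'r::comm_monoid_mult set \<Rightarrow> 'r" where
  "gcd_of S = (SOME h. is_gcd_of h S)"

definition associated_rel :: "('r::comm_monoid_mult \<times> 'r) set" where
  "associated_rel = {(a, b). a dvd b \<and> b dvd a}"

definition linear_factors :: "'k::field poly poly \<Rightarrow> 'k poly poly set" where
  "linear_factors h = {l. total_degree l = 1 \<and> l dvd h}"


section \<open>Projective space\<close>

text \<open>A point of projective space is the set of all its homogeneous coordinate vectors.\<close>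

definition proj_point :: "'k::field vec \<Rightarrow> 'k vec set" where
  "proj_point v = {c \<cdot>\<^sub>v v | c. c \<noteq> 0}"

text \<open>The space with \<open>n\<close> homogeneous coordinates, of dimension \<open>n - 1\<close>.\<close>

definition proj_space :: "nat \<Rightarrow> 'k::field vec set set" where
  "proj_space n = {proj_point v | v. v \<in> carrier_vec n \<and> v \<noteq> 0\<^sub>v n}"

text \<open>The polynomial ring in the variables \<open>T\<^sub>i\<close>, indexed by \<open>i < n\<close>.\<close>

type_synonym 'k mpoly = "(nat \<Rightarrow>\<^sub>0 nat) \<Rightarrow>\<^sub>0 'k"

definition mform :: "nat \<Rightarrow> nat \<Rightarrow> 'k::zero mpoly \<Rightarrow> bool" where
  "mform n e F \<longleftrightarrow> (\<forall>m \<in> Poly_Mapping.keys F. Poly_Mapping.keys m \<subseteq> {..<n} \<and>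
     (\<Sum>i\<in>Poly_Mapping.keys m. Poly_Mapping.lookup m i) = e)"

definition meval :: "'k::comm_semiring_1 mpoly \<Rightarrow> 'k vec \<Rightarrow> 'k" where
  "meval F v = (\<Sum>m\<in>Poly_Mapping.keys F. Poly_Mapping.lookup F m *
     (\<Prod>i\<in>Poly_Mapping.keys m. (v $ i) ^ Poly_Mapping.lookup m i))"

definition vanishes_on :: "'k::comm_semiring_1 mpoly \<Rightarrow> 'k vec set set \<Rightarrow> bool" where
  "vanishes_on F C \<longleftrightarrow> (\<forall>q\<in>C. \<forall>v\<in>q. meval F v = 0)"

definition nonzero_at :: "'k::comm_semiring_1 mpoly \<Rightarrow> 'k vec set \<Rightarrow> bool" where
  "nonzero_at F p \<longleftrightarrow> (\<forall>v\<in>p. meval F v \<noteq> 0)"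

text \<open>The local ring at \<open>p\<close> of a projective variety \<open>C\<close> (with its reduced structure): the
  homogeneous localization of \<open>k[T]/I(C)\<close> at the prime ideal of \<open>p\<close>. A fraction \<open>F/G\<close> is
  represented by the pair \<open>(F, G)\<close> of forms of the same degree with \<open>G(p) \<noteq> 0\<close>; two fractions
  are identified if some form \<open>H\<close> with \<open>H(p) \<noteq> 0\<close> multiplies \<open>FG' - F'G\<close> into \<open>I(C)\<close>.\<close>

definition fracs_at :: "nat \<Rightarrow> 'k::field vec set \<Rightarrow> ('k mpoly \<times> 'k mpoly) set" where
  "fracs_at n p = {(F, G). (\<exists>e. mform n e F \<and> mform n e G) \<and> nonzero_at G p}"

definition frac_rel ::
  "nat \<Rightarrow> 'k::field vec set set \<Rightarrow> 'k vec set \<Rightarrow> (('k mpoly \<times> 'k mpoly) \<times> ('k mpoly \<times> 'k mpoly)) set"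
where
  "frac_rel n C p = {((F, G), (F', G')).
     (F, G) \<in> fracs_at n p \<and> (F', G') \<in> fracs_at n p \<and>
     (\<exists>H. (\<exists>e. mform n e H) \<and> nonzero_at H p \<and> vanishes_on (H * (F * G' - F' * G)) C)}"

definition stalk :: "nat \<Rightarrow> 'k::field vec set set \<Rightarrow> 'k vec set \<Rightarrow> ('k mpoly \<times> 'k mpoly) set ring" where
  "stalk n C p =
     \<lparr> carrier = fracs_at n p // frac_rel n C p,
       monoid.mult = (\<lambda>U V. \<Union>(F, G)\<in>U. \<Union>(F', G')\<in>V.
                 frac_rel n C p `` {(F * F', G * G')}),
       one = frac_rel n C p `` {(1, 1)},
       zero = frac_rel n C p `` {(0, 1)},
       add = (\<lambda>U V. \<Union>(F, G)\<in>U. \<Union>(F', G')\<in>V.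
                 frac_rel n C p `` {(F * G' + F' * G, G * G')}) \<rparr>"

definition singularities :: "nat \<Rightarrow> 'k::field vec set set \<Rightarrow> 'k vec set set" where
  "singularities n C = {p \<in> C. \<not> regular_local_ring (stalk n C p)}"

definition curve_multiplicity :: "nat \<Rightarrow> 'k::field vec set set \<Rightarrow> 'k vec set \<Rightarrow> real" where
  "curve_multiplicity n C p = local_multiplicity (stalk n C p)"

definition branches ::
  "nat \<Rightarrow> 'k::field vec set set \<Rightarrow> 'k vec set \<Rightarrow> (nat \<Rightarrow> ('k mpoly \<times> 'k mpoly) set set) set set"
where
  "branches n C p = minimal_primes (completion (stalk n C p))"


section \<open>Parametrized rational curves\<close>

text \<open>\<open>Psi g q\<close> is the point \<open>[g\<^sub>1(q) : \<dots> : g\<^sub>n(q)]\<close>. For forms \<open>g\<^sub>i\<close> of the same degree without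
  common zero, the vectors \<open>g(v)\<close>, for \<open>v\<in>q\<close>, are all proportional, so that the union
  is one projective point.\<close>

definition Psi :: "'k::field poly poly vec \<Rightarrow> 'k vec set \<Rightarrow> 'k vec set" where
  "Psi g q = (\<Union>v\<in>q. proj_point (map_vec (\<lambda>f. beval f v) g))"

definition curve :: "'k::field poly poly vec \<Rightarrow> 'k vec set set" where
  "curve g = Psi g ` proj_space 2"

text \<open>\<open>Psi g\<close> is birational onto the irreducible curve \<open>curve g\<close> if it has an inverse rational
  map, that is, a pair of forms \<open>F\<^sub>0, F\<^sub>1\<close> of the same degree, not both vanishing identically on
  the curve, such that \<open>[F\<^sub>0 : F\<^sub>1]\<close> inverts \<open>Psi g\<close> in both directions wherever it is defined.\<close>

definition birational_onto_curve :: "'k::field poly poly vec \<Rightarrow> bool" where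
  "birational_onto_curve g \<longleftrightarrow>
     (\<exists>e F0 F1. mform (dim_vec g) e F0 \<and> mform (dim_vec g) e F1 \<and>
        \<not> (vanishes_on F0 (curve g) \<and> vanishes_on F1 (curve g)) \<and>
        (\<forall>q\<in>proj_space 2. \<forall>v\<in>Psi g q. (meval F0 v, meval F1 v) \<noteq> (0, 0) \<longrightarrow>
           proj_point (vec_of_list [meval F0 v, meval F1 v]) = q) \<and>
        (\<forall>p\<in>curve g. \<forall>v\<in>p. (meval F0 v, meval F1 v) \<noteq> (0, 0) \<longrightarrow>
           Psi g (proj_point (vec_of_list [meval F0 v, meval F1 v])) = p))"

definition gen_ideal :: "'r::comm_ring_1 vec \<Rightarrow> nat set \<Rightarrow> 'r set" where
  "gen_ideal g J = Idl\<^bsub>ring_of_type_algebra\<^esub> {g $ i | i. i \<in> J}"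

definition minimally_generates :: "'r::comm_ring_1 vec \<Rightarrow> bool" where
  "minimally_generates g \<longleftrightarrow>
     (\<forall>J. J \<subset> {..<dim_vec g} \<longrightarrow> gen_ideal g J \<noteq> gen_ideal g {..<dim_vec g})"

text \<open>Exactness of the homogeneous sequence
  \<open>0 \<rightarrow> \<Oplus> B(-\<delta>\<^sub>j-d) \<rightarrow> B(-d)^n \<rightarrow> I \<rightarrow> 0\<close>, where the first map is \<open>\<phi>\<close>, the second one is
  \<open>g\<close> and \<open>I\<close> is the ideal generated by the entries of \<open>g\<close> (so that exactness at \<open>I\<close> is
  automatic). That \<open>\<phi>\<close> preserves the grading means that its \<open>j\<close>-th column consists of forms of
  degree \<open>\<delta>\<^sub>j\<close>.\<close>

definition hilbert_burch :: "'k::field poly poly vec \<Rightarrow> (nat \<Rightarrow> nat) \<Rightarrow> 'k poly poly mat \<Rightarrow> bool" where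
  "hilbert_burch g \<delta> \<phi> \<longleftrightarrow> (let n = dim_vec g in
     \<phi> \<in> carrier_mat n (n - 1) \<and>
     (\<forall>i<n. \<forall>j<n - 1. bform (\<delta> j) (\<phi> $$ (i, j))) \<and>
     mono_on {..<n - 1} \<delta> \<and>
     inj_on (\<lambda>w. \<phi> *\<^sub>v w) (carrier_vec (n - 1)) \<and>
     (\<lambda>w. \<phi> *\<^sub>v w) ` carrier_vec (n - 1) = {u \<in> carrier_vec n. g \<bullet> u = 0})"

text \<open>The entries of the row vector \<open>p\<phi>\<close>, which generate \<open>I\<^sub>1(p\<phi>)\<close>.\<close>

definition row_entries :: "'k::field vec \<Rightarrow> 'k poly poly mat \<Rightarrow> 'k poly poly set" where
  "row_entries v \<phi> = {map_vec (\<lambda>c. [:[:c:]:]) v \<bullet> col \<phi> j | j. j < dim_col \<phi>}"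

definition gcd_I1 :: "'k::field vec \<Rightarrow> 'k poly poly mat \<Rightarrow> 'k poly poly" where
  "gcd_I1 v \<phi> = gcd_of (row_entries v \<phi>)"

end

theory Submission
  imports Defs "Jordan_Normal_Form.Char_Poly" "HOL-Computational_Algebra.Polynomial_Factorial"
begin

text \<open>
  The forms \<open>gcd I\<^sub>1(p\<phi>)\<close> can be described without \<open>\<phi>\<close>. Let \<open>h\<close> be the greatest common
  divisor of the minors \<open>p\<^sub>i g\<^sub>j - p\<^sub>j g\<^sub>i\<close> of the matrix with rows \<open>p\<close> and \<open>g\<close>. The Koszul
  syzygies \<open>g\<^sub>j e\<^sub>i - g\<^sub>i e\<^sub>j\<close> of \<open>g\<close> are combinations of the columns of \<open>\<phi>\<close>, so that each minor
  is a combination of the entries of \<open>p\<phi>\<close>. Conversely, \<open>(p \<cdot> u) g\<^sub>l = \<Sum>\<^sub>k (p\<^sub>k g\<^sub>l - p\<^sub>l g\<^sub>k) u\<^sub>k\<close>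
  for a syzygy \<open>u\<close>, and since an ideal of height two has no common zero, a form that divides
  all \<open>(p \<cdot> u) g\<^sub>l\<close> divides \<open>p \<cdot> u\<close>. Hence \<open>h = gcd I\<^sub>1(p\<phi>)\<close>
  (\<open>common_divisors_minors\<close>, \<open>gcd_I1_minors\<close>). A point \<open>w\<close> of the projective line is a common zero
  of the minors if and only if \<open>g(w)\<close> is proportional to \<open>p\<close>, so the zeros of \<open>h\<close> are the fibre
  \<open>T\<close> over \<open>p\<close> (\<open>gcd_minors\<close>). This gives the coprimality: a common factor for two points
  would have a zero that is mapped to both. It also shows that, up to constants, \<open>h\<close> has as many linear
  factors as \<open>T\<close> has points.

  For the multiplicity and the branches, let \<open>t\<close> be a coordinate on the projective line whose
  point at infinity is not in \<open>T\<close>. Pulling back fractions along the parametrization embeds the local ring \<open>R\<close> of the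
  curve at \<open>p\<close> into \<open>k(t)\<close>, and each point of \<open>T\<close> measures the elements of \<open>R\<close> by their order of
  vanishing. Three facts link \<open>R\<close> with these orders. A form that vanishes at \<open>p\<close> pulls back to a
  multiple of \<open>h\<close>, so at each \<open>\<tau>\<close> all nonunits have at least the order \<open>e\<^sub>\<tau>\<close> of \<open>h\<close>
  (\<open>dehom_h_dvd\<close>). A general linear form through \<open>p\<close> attains all these minimal orders
  simultaneously (\<open>reduction_form\<close>). Finally, birationality expresses \<open>t\<close> as a fraction on the
  curve, which provides a constant \<open>C\<close> such that \<open>R\<close> contains every rational function of order at
  least \<open>C\<close> at all points of \<open>T\<close> (\<open>conductor_exists\<close>).

  The rest is algebra of rings with such a family of orders (locale \<open>valued_local_ring\<close>). For a
  vector \<open>\<alpha>\<close> of exponents let \<open>V \<alpha>\<close> be the ideal of elements of order at least \<open>\<alpha>\<^sub>\<tau>\<close> at every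
  \<open>\<tau>\<close>. Then \<open>V (k e + C) \<subseteq> \<mm>^k \<subseteq> V (k e)\<close>, and the length between two such ideals is the total
  difference of exponents, up to a bounded error caused by exponents below \<open>C\<close>. Hence \<open>R/\<mm>^k\<close>
  has length \<open>k \<Sum>\<^sub>\<tau> e\<^sub>\<tau> + O(1)\<close>, and the multiplicity is \<open>\<Sum>\<^sub>\<tau> e\<^sub>\<tau> = deg h\<close>
  (\<open>multiplicity_eq\<close>). In the completion, the sequences whose order at \<open>\<tau>\<close> tends to infinity form
  a prime ideal; these primes are pairwise incomparable and their intersection is zero, so they
  are the minimal primes, and there are as many branches as points in \<open>T\<close> (\<open>branches_count\<close>).
\<close>

(* The names of the polynomial operations on types are used throughout; they coincide with
   those of the algebraic structures with explicit carriers. *)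
hide_const (open) Module.smult Polynomials.degree UnivPoly.coeff UnivPoly.monom Coset.order
no_notation fps_nth (infixl \<open>$\<close> 75)

section \<open>Local rings with finitely many valuations\<close>

text \<open>The model is the local ring of a curve at a point; \<open>T\<close> is the set of points of the
  normalization above it and \<open>w \<tau>\<close> the order of vanishing at \<open>\<tau>\<close>. The element \<open>x\<close> generates a
  reduction of the maximal ideal: at every \<open>\<tau>\<close> it has the smallest order that a nonunit can
  have. Instead of the normalization itself, the axioms state what \<open>R\<close> inherits from it:
  \<open>residue\<close> says that the normalization has the same residue fields as \<open>R\<close>, \<open>conductor\<close> that a
  fraction \<open>r/s\<close> of order at least \<open>C\<close> everywhere lies in \<open>R\<close>, \<open>exact\<close> that orders of at
  least \<open>C\<close> can be prescribed, and \<open>separate\<close> that the idempotents of the completed normalization are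
  limits in \<open>R\<close>, up to a common factor.\<close>

locale valued_local_ring = cring R for R (structure) +
  fixes T :: "'t set" and w :: "'t \<Rightarrow> 'a \<Rightarrow> enat" and e :: "'t \<Rightarrow> nat" and C :: nat and x :: 'a
  assumes finite_T: "finite T" and T_nonempty: "T \<noteq> {}"
    and e_pos: "\<tau> \<in> T \<Longrightarrow> 0 < e \<tau>"
    and w_mult: "\<lbrakk>\<tau> \<in> T; r \<in> carrier R; s \<in> carrier R\<rbrakk> \<Longrightarrow> w \<tau> (r \<otimes> s) = w \<tau> r + w \<tau> s"
    and w_add: "\<lbrakk>\<tau> \<in> T; r \<in> carrier R; s \<in> carrier R\<rbrakk> \<Longrightarrow> min (w \<tau> r) (w \<tau> s) \<le> w \<tau> (r \<oplus> s)"
    and w_inf: "\<lbrakk>\<tau> \<in> T; r \<in> carrier R\<rbrakk> \<Longrightarrow> w \<tau> r = \<infinity> \<longleftrightarrow> r = \<zero>"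
    and w_unit: "\<lbrakk>\<tau> \<in> T; r \<in> carrier R; w \<tau> r = 0\<rbrakk> \<Longrightarrow> r \<in> Units R"
    and w_nonunit: "\<lbrakk>\<tau> \<in> T; r \<in> carrier R; r \<notin> Units R\<rbrakk> \<Longrightarrow> enat (e \<tau>) \<le> w \<tau> r"
    and x_carrier: "x \<in> carrier R" and w_x: "\<tau> \<in> T \<Longrightarrow> w \<tau> x = enat (e \<tau>)"
    and residue: "\<lbrakk>\<tau> \<in> T; r \<in> carrier R; s \<in> carrier R; w \<tau> r = enat n; w \<tau> s = enat n\<rbrakk>
      \<Longrightarrow> \<exists>c\<in>carrier R. enat n < w \<tau> (r \<ominus> c \<otimes> s)"
    and conductor: "\<lbrakk>r \<in> carrier R; s \<in> carrier R; s \<noteq> \<zero>; \<And>\<tau>. \<tau> \<in> T \<Longrightarrow> w \<tau> s + enat C \<le> w \<tau> r\<rbrakk>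
      \<Longrightarrow> \<exists>u\<in>carrier R. r = u \<otimes> s"
    and exact: "(\<And>\<tau>. \<tau> \<in> T \<Longrightarrow> C \<le> \<alpha> \<tau>) \<Longrightarrow> \<exists>r\<in>carrier R. \<forall>\<tau>\<in>T. w \<tau> r = enat (\<alpha> \<tau>)"
    and separate: "\<tau> \<in> T \<Longrightarrow> \<exists>y\<in>carrier R. y \<noteq> \<zero> \<and> (\<forall>N. \<exists>r\<in>carrier R.
      enat N \<le> w \<tau> (r \<ominus> y) \<and> (\<forall>\<tau>'\<in>T - {\<tau>}. enat N \<le> w \<tau>' r))"
begin

definition V :: "('t \<Rightarrow> nat) \<Rightarrow> 'a set" where
  "V \<alpha> = {r \<in> carrier R. \<forall>\<tau>\<in>T. enat (\<alpha> \<tau>) \<le> w \<tau> r}"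

abbreviation M :: "'a set" where "M \<equiv> carrier R - Units R"

lemma zero_not_one: "\<zero> \<noteq> \<one>"
proof
  assume "\<zero> = \<one>"
  then have "x = \<zero>" using x_carrier by (metis l_null l_one)
  with w_x T_nonempty w_inf x_carrier show False by (metis enat.distinct(1) ex_in_conv)
qed

lemma w_zero: "\<tau> \<in> T \<Longrightarrow> w \<tau> \<zero> = \<infinity>" using w_inf by simp

lemma w_one: assumes "\<tau> \<in> T" shows "w \<tau> \<one> = 0"
proof -
  have "w \<tau> \<one> = w \<tau> \<one> + w \<tau> \<one>" using w_mult[OF assms, of \<one> \<one>] by simp
  moreover have "w \<tau> \<one> \<noteq> \<infinity>" using w_inf[OF assms, of \<one>] zero_not_one by auto
  ultimately show ?thesis by (cases "w \<tau> \<one>") (auto simp: zero_enat_def)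
qed

lemma w_uminus: assumes "\<tau> \<in> T" "r \<in> carrier R" shows "w \<tau> (\<ominus> r) = w \<tau> r"
proof -
  have "(\<ominus> \<one>) \<otimes> (\<ominus> \<one>) = \<one>" by algebra
  then have "w \<tau> (\<ominus> \<one>) + w \<tau> (\<ominus> \<one>) = 0" using w_mult[OF assms(1), of "\<ominus> \<one>" "\<ominus> \<one>"] w_one assms by simp
  then have "w \<tau> (\<ominus> \<one>) = 0" by simp
  moreover have "\<ominus> r = (\<ominus> \<one>) \<otimes> r" using assms by algebra
  ultimately show ?thesis using w_mult[OF assms(1), of "\<ominus> \<one>" r] assms by simp
qed

lemma w_minus: "\<lbrakk>\<tau> \<in> T; r \<in> carrier R; s \<in> carrier R\<rbrakk> \<Longrightarrow> min (w \<tau> r) (w \<tau> s) \<le> w \<tau> (r \<ominus> s)"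
  using w_add[of \<tau> r "\<ominus> s"] w_uminus[of \<tau> s] by (simp add: a_minus_def)

lemma w_add_ge:
  "\<lbrakk>\<tau> \<in> T; r \<in> carrier R; s \<in> carrier R; N \<le> w \<tau> r; N \<le> w \<tau> s\<rbrakk> \<Longrightarrow> N \<le> w \<tau> (r \<oplus> s)"
  using w_add[of \<tau> r s] by (simp add: min_def split: if_splits)

lemma w_minus_ge:
  "\<lbrakk>\<tau> \<in> T; r \<in> carrier R; s \<in> carrier R; N \<le> w \<tau> r; N \<le> w \<tau> s\<rbrakk> \<Longrightarrow> N \<le> w \<tau> (r \<ominus> s)"
  using w_minus[of \<tau> r s] by (simp add: min_def split: if_splits)

lemma w_stable:
  assumes "\<tau> \<in> T" "r \<in> carrier R" "s \<in> carrier R" "w \<tau> s < w \<tau> (r \<ominus> s)"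
  shows "w \<tau> r = w \<tau> s"
proof (rule antisym)
  have "r = (r \<ominus> s) \<oplus> s" using assms by algebra
  then have "min (w \<tau> (r \<ominus> s)) (w \<tau> s) \<le> w \<tau> r" using w_add[of \<tau> "r \<ominus> s" s] assms by simp
  then show "w \<tau> s \<le> w \<tau> r" using assms(4) by (auto simp: min_def split: if_splits)
  have "s = r \<ominus> (r \<ominus> s)" using assms by algebra
  then have "min (w \<tau> r) (w \<tau> (r \<ominus> s)) \<le> w \<tau> s" using w_minus[of \<tau> r "r \<ominus> s"] assms by simp
  then show "w \<tau> r \<le> w \<tau> s" using assms(4) by (auto simp: min_def split: if_splits)
qed

lemma w_pow: "\<lbrakk>\<tau> \<in> T; r \<in> carrier R\<rbrakk> \<Longrightarrow> w \<tau> (r [^] (k::nat)) = of_nat k * w \<tau> r"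
proof (induction k)
  case (Suc k)
  then show ?case using w_mult[of \<tau> "r [^] k" r]
    by (simp add: algebra_simps)
qed (simp add: w_one)

lemma V_ideal: "ideal (V \<alpha>) R"
proof (rule idealI)
  show "subgroup (V \<alpha>) (add_monoid R)"
  proof (rule subgroup.intro)
    fix r s assume "r \<in> V \<alpha>" "s \<in> V \<alpha>"
    then show "r \<otimes>\<^bsub>add_monoid R\<^esub> s \<in> V \<alpha>"
      unfolding V_def by (auto intro: w_add_ge)
  next
    fix r assume r: "r \<in> V \<alpha>"
    then have "r \<in> carrier R" unfolding V_def by simp
    then show "inv\<^bsub>add_monoid R\<^esub> r \<in> V \<alpha>"
      using r w_uminus[of _ r] unfolding V_def a_inv_def[symmetric] by auto
  qed (auto simp: V_def w_zero)
next
  fix a y assume a: "a \<in> V \<alpha>" and y: "y \<in> carrier R"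
  show ya: "y \<otimes> a \<in> V \<alpha>"
    using a y unfolding V_def by (simp add: w_mult add_increasing)
  have "a \<in> carrier R" using a by (simp add: V_def)
  then show "a \<otimes> y \<in> V \<alpha>" using ya y by (simp add: m_comm)
qed (rule ring_axioms)

lemma V_0: "V (\<lambda>_. 0) = carrier R" by (simp add: V_def enat_0)

lemma M_eq: "\<tau> \<in> T \<Longrightarrow> r \<in> M \<longleftrightarrow> r \<in> carrier R \<and> w \<tau> r \<noteq> 0"
proof -
  assume t: "\<tau> \<in> T"
  have "w \<tau> r = 0" if "r \<in> Units R"
  proof -
    from that obtain u where "u \<in> carrier R" "r \<in> carrier R" "u \<otimes> r = \<one>" unfolding Units_def by auto
    then have "w \<tau> u + w \<tau> r = 0" using w_mult[OF t, of u r] w_one[OF t] by simp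
    then show ?thesis by simp
  qed
  then show ?thesis using w_unit[OF t] Units_closed by auto
qed

text \<open>The maximal ideal is cut out by orders alone: units have order \<open>0\<close> everywhere, nonunits at
  least the order \<open>e \<tau> > 0\<close>.\<close>

lemma M_V: "M = V e"
proof -
  obtain \<tau> where t: "\<tau> \<in> T" using T_nonempty by auto
  show ?thesis
  proof (intro equalityI subsetI)
    fix r assume r: "r \<in> V e"
    then have "enat (e \<tau>) \<le> w \<tau> r" using t unfolding V_def by auto
    then have "w \<tau> r \<noteq> 0" using e_pos[OF t] by (auto simp: zero_enat_def)
    then show "r \<in> M" using M_eq[OF t] r by (auto simp: V_def)
  qed (auto simp: V_def w_nonunit)
qed

lemma M_ideal: "ideal M R" using V_ideal M_V by simp

lemma ideal_subset_M: assumes "ideal J R" "J \<noteq> carrier R" shows "J \<subseteq> M"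
proof -
  interpret J: ideal J R by fact
  have "r \<notin> Units R" if "r \<in> J" for r
  proof
    assume "r \<in> Units R"
    then obtain u where "u \<in> carrier R" "u \<otimes> r = \<one>" unfolding Units_def by auto
    then have "\<one> \<in> J" using J.I_l_closed[OF that] by metis
    then show False using J.one_imp_carrier assms by simp
  qed
  then show ?thesis using J.Icarr by auto
qed

lemma M_maximal: "maximalideal M R"
proof (rule maximalidealI[OF M_ideal])
  show "carrier R \<noteq> M" by (metis DiffD2 Units_one_closed one_closed)
  fix J assume "ideal J R" "M \<subseteq> J" "J \<subseteq> carrier R"
  then show "J = M \<or> J = carrier R" using ideal_subset_M[of J] by auto
qed

lemma the_maximal: "the_maximal_ideal R = M"
  unfolding the_maximal_ideal_def
proof (rule the_equality, rule M_maximal)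
  fix J assume J: "maximalideal J R"
  interpret J: maximalideal J R by fact
  have "J \<subseteq> M" using ideal_subset_M[OF J.is_ideal] J.I_notcarr by metis
  then show "J = M" using J.I_maximal[OF M_ideal] M_maximal unfolding maximalideal_def maximalideal_axioms_def by blast
qed

abbreviation I :: "nat \<Rightarrow> 'a set" where "I k \<equiv> max_power R k"

lemma I_0: "I 0 = carrier R" by (simp add: max_power_def ideals_set_def)
lemma I_Suc: "I (Suc k) = I k \<cdot> M" unfolding max_power_def the_maximal by (simp add: ideals_set_def)

lemma I_ideal: "ideal (I k) R"
  by (induction k) (auto simp: I_0 I_Suc oneideal intro: ideal_prod_is_ideal M_ideal)

lemma I_subset_V: "I k \<subseteq> V (\<lambda>\<tau>. k * e \<tau>)"
proof (induction k)
  case 0 then show ?case by (simp add: I_0 V_0)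
next
  case (Suc k)
  show ?case
  proof
    fix r assume "r \<in> I (Suc k)"
    then have "r \<in> I k \<cdot> M" by (simp add: I_Suc)
    then show "r \<in> V (\<lambda>\<tau>. Suc k * e \<tau>)"
    proof (induction r rule: ideal_prod.induct)
      case (prod i j)
      have ij: "i \<in> V (\<lambda>\<tau>. k * e \<tau>)" "j \<in> V e" using prod Suc M_V by auto
      have "enat (Suc k * e \<tau>) \<le> w \<tau> (i \<otimes> j)" if "\<tau> \<in> T" for \<tau>
      proof -
        have "enat (Suc k * e \<tau>) = enat (k * e \<tau>) + enat (e \<tau>)" by simp
        also have "\<dots> \<le> w \<tau> i + w \<tau> j" using ij that unfolding V_def by (intro add_mono) auto
        finally show ?thesis using w_mult[OF that] ij unfolding V_def by simp
      qed
      then show ?case using ij unfolding V_def by simp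
    next
      case (sum s1 s2)
      then show ?case using additive_subgroup.a_closed[OF ideal.axioms(1)[OF V_ideal]] by blast
    qed
  qed
qed

lemma x_M: "x \<in> M"
proof -
  obtain \<tau> where t: "\<tau> \<in> T" using T_nonempty by auto
  have "w \<tau> x \<noteq> 0" using w_x[OF t] e_pos[OF t] by (simp add: enat_0_iff)
  then show ?thesis unfolding M_eq[OF t] using x_carrier by simp
qed

lemma x_pow_I: "x [^] k \<in> I k"
proof (induction k)
  case (Suc k)
  with x_M have "x [^] k \<otimes> x \<in> I k \<cdot> M" by (intro ideal_prod.prod)
  then show ?case by (simp add: I_Suc)
qed (simp add: I_0)

lemma x_pow_nonzero: "x [^] (k::nat) \<noteq> \<zero>"
proof -
  obtain \<tau> where t: "\<tau> \<in> T" using T_nonempty by auto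
  have "w \<tau> (x [^] k) = enat (k * e \<tau>)" using w_pow[OF t x_carrier] w_x[OF t] by (simp add: of_nat_eq_enat)
  then show ?thesis using w_zero[OF t] by auto
qed

text \<open>Dividing by \<open>x^k\<close> lowers the order at every \<open>\<tau>\<close> by exactly \<open>k * e \<tau>\<close>; what is left has order at
  least \<open>C\<close> and lies in \<open>R\<close> by \<open>conductor\<close>. With \<open>I_subset_V\<close> this traps the powers of the
  maximal ideal between ideals given by orders that are a bounded distance apart.\<close>

lemma V_subset_I: "V (\<lambda>\<tau>. k * e \<tau> + C) \<subseteq> I k"
proof
  fix r assume r: "r \<in> V (\<lambda>\<tau>. k * e \<tau> + C)"
  have "\<exists>u\<in>carrier R. r = u \<otimes> x [^] k"
  proof (rule conductor)
    show "r \<in> carrier R" using r by (simp add: V_def)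
    fix \<tau> assume t: "\<tau> \<in> T"
    have "w \<tau> (x [^] k) = enat (k * e \<tau>)" using w_pow[OF t x_carrier] w_x[OF t] by (simp add: of_nat_eq_enat)
    then show "w \<tau> (x [^] k) + enat C \<le> w \<tau> r" using r t by (auto simp: V_def)
  qed (auto simp: x_carrier x_pow_nonzero)
  then obtain u where "u \<in> carrier R" "r = u \<otimes> x [^] k" by auto
  then show "r \<in> I k" using ideal.I_l_closed[OF I_ideal x_pow_I] by simp
qed

lemma integral: assumes "r \<in> carrier R" "s \<in> carrier R" "r \<otimes> s = \<zero>" shows "r = \<zero> \<or> s = \<zero>"
proof -
  obtain \<tau> where t: "\<tau> \<in> T" using T_nonempty by auto
  have "w \<tau> r + w \<tau> s = \<infinity>" using w_mult[OF t] assms w_zero[OF t] by metis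
  then show ?thesis using w_inf[OF t] assms by (auto simp: plus_eq_infty_iff_enat)
qed

lemma zero_prime: "primeideal {\<zero>} R"
proof (rule primeidealI)
  show "carrier R \<noteq> {\<zero>}" using zero_not_one one_closed by (metis singletonD)
qed (use zeroideal is_cring integral in auto)

lemma M_prime: "primeideal M R" by (rule maximalideal_prime[OF M_maximal])

lemma prime_pow:
  assumes "primeideal P R" "y \<in> carrier R" "y [^] (k::nat) \<in> P" shows "y \<in> P"
  using assms(3)
proof (induction k)
  case 0
  interpret P: primeideal P R by fact
  show ?case using 0 P.one_imp_carrier P.I_notcarr by simp
next
  case (Suc k)
  interpret P: primeideal P R by fact
  show ?case using Suc P.I_prime[of "y [^] k" y] assms by auto
qed

text \<open>A nonzero prime ideal contains some \<open>r \<noteq> 0\<close>, and a high power of any nonunit exceeds the orders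
  of \<open>r\<close> by \<open>C\<close>, so that it is a multiple of \<open>r\<close>.\<close>

lemma prime_cases: assumes "primeideal P R" shows "P = {\<zero>} \<or> P = M"
proof (cases "P \<subseteq> {\<zero>}")
  case True
  interpret P: primeideal P R by fact
  show ?thesis using True P.zero_closed by auto
next
  case False
  interpret P: primeideal P R by fact
  obtain r where r: "r \<in> P" "r \<noteq> \<zero>" using False by auto
  have rc: "r \<in> carrier R" using r P.Icarr by auto
  have PM: "P \<subseteq> M" using ideal_subset_M[OF P.is_ideal] P.I_notcarr by metis
  have "M \<subseteq> P"
  proof
    fix y assume y: "y \<in> M"
    define N where "N = (\<Sum>\<tau>\<in>T. the_enat (w \<tau> r)) + C"
    have "\<exists>u\<in>carrier R. y [^] N = u \<otimes> r"
    proof (rule conductor)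
      fix \<tau> assume t: "\<tau> \<in> T"
      obtain n where n: "w \<tau> r = enat n" using w_inf[OF t rc] r by auto
      have "the_enat (w \<tau> r) \<le> (\<Sum>\<tau>\<in>T. the_enat (w \<tau> r))" using finite_T t by (intro member_le_sum) auto
      then have "w \<tau> r + enat C \<le> enat N" using n by (simp add: N_def)
      also have "\<dots> \<le> of_nat N * w \<tau> y"
      proof -
        have "w \<tau> y \<noteq> 0" using y M_eq[OF t] by auto
        then have "1 \<le> w \<tau> y" by (simp add: ileI1 one_eSuc zero_less_iff_neq_zero)
        then have "of_nat N * 1 \<le> of_nat N * w \<tau> y" by (intro mult_left_mono) auto
        then show ?thesis by (simp add: of_nat_eq_enat)
      qed
      finally show "w \<tau> r + enat C \<le> w \<tau> (y [^] N)" using w_pow[OF t] y by simp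
    qed (use y rc r in auto)
    then obtain u where "u \<in> carrier R" "y [^] N = u \<otimes> r" by auto
    then have yN: "y [^] N \<in> P" using P.I_l_closed[OF r(1)] by simp
    show "y \<in> P" by (rule prime_pow[OF assms _ yN]) (use y in simp)
  qed
  then show ?thesis using PM by auto
qed

lemma krull_dim_eq: "krull_dim R = 1"
proof -
  have le: "m \<le> 1" if ch: "chain_of (\<lambda>J. primeideal J R) c m" for c m
  proof (rule ccontr)
    assume "\<not> m \<le> 1"
    then have m: "2 \<le> m" by simp
    have s: "c 0 \<subset> c 1" "c 1 \<subset> c 2" using ch m unfolding chain_of_def by (auto simp: numeral_2_eq_2)
    have "primeideal (c i) R" if "i \<le> 2" for i using ch m that unfolding chain_of_def by auto
    then have p: "c 0 = {\<zero>} \<or> c 0 = M" "c 1 = {\<zero>} \<or> c 1 = M" "c 2 = {\<zero>} \<or> c 2 = M"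
      using prime_cases by auto
    show False using s p by auto
  qed
  have x0: "x \<noteq> \<zero>" using x_pow_nonzero[of 1] x_carrier by simp
  obtain \<tau> where t: "\<tau> \<in> T" using T_nonempty by auto
  have "x \<in> M" by (rule x_M)
  moreover have "\<zero> \<in> M" unfolding M_eq[OF t] using w_zero[OF t] by simp
  ultimately have ps: "{\<zero>} \<subset> M" using x0 by auto
  have "chain_of (\<lambda>J. primeideal J R) (\<lambda>i. if i = 0 then {\<zero>} else M) 1"
    unfolding chain_of_def using zero_prime M_prime ps by simp
  then have "enat 1 \<in> {enat m | m. \<exists>c. chain_of (\<lambda>J. primeideal J R) c m}" by auto
  moreover have "\<And>y. y \<in> {enat m | m. \<exists>c. chain_of (\<lambda>J. primeideal J R) c m} \<Longrightarrow> y \<le> enat 1"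
    using le by auto
  ultimately show ?thesis unfolding krull_dim_def one_enat_def
    by (intro antisym Sup_least Sup_upper)
qed

subsection \<open>Length and multiplicity\<close>

text \<open>This is the step in inductions on the total distance between two vectors of exponents.\<close>

lemma exponent_step:
  fixes \<alpha> \<beta> :: "'t \<Rightarrow> nat"
  assumes D: "Suc D = (\<Sum>\<tau>\<in>T. \<beta> \<tau> - \<alpha> \<tau>)"
  obtains \<tau> where "\<tau> \<in> T" "\<alpha> \<tau> < \<beta> \<tau>" "D = (\<Sum>\<kappa>\<in>T. \<beta> \<kappa> - (\<alpha>(\<tau> := Suc (\<alpha> \<tau>))) \<kappa>)"
proof -
  have "(\<Sum>\<tau>\<in>T. \<beta> \<tau> - \<alpha> \<tau>) \<noteq> 0" using D by simp
  then have "\<exists>\<tau>\<in>T. \<beta> \<tau> - \<alpha> \<tau> \<noteq> 0" by (rule contrapos_np) (auto intro: sum.neutral)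
  then obtain \<tau> where t: "\<tau> \<in> T" and lt: "\<alpha> \<tau> < \<beta> \<tau>" by auto
  define \<alpha>' where "\<alpha>' = \<alpha>(\<tau> := Suc (\<alpha> \<tau>))"
  have "(\<Sum>\<kappa>\<in>T - {\<tau>}. \<beta> \<kappa> - \<alpha>' \<kappa>) = (\<Sum>\<kappa>\<in>T - {\<tau>}. \<beta> \<kappa> - \<alpha> \<kappa>)"
    by (intro sum.cong) (auto simp: \<alpha>'_def)
  then have "D = (\<Sum>\<kappa>\<in>T. \<beta> \<kappa> - \<alpha>' \<kappa>)"
    using D lt t finite_T by (simp add: sum.remove[of T \<tau>] \<alpha>'_def)
  then show thesis using that t lt unfolding \<alpha>'_def by blast
qed

lemma V_antimono: "(\<And>\<tau>. \<tau> \<in> T \<Longrightarrow> \<alpha> \<tau> \<le> \<beta> \<tau>) \<Longrightarrow> V \<beta> \<subseteq> V \<alpha>"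
  unfolding V_def using order_trans enat_ord_simps(1) by blast

text \<open>The rank function \<open>\<mu>\<close> bounds the length of chains between \<open>V \<beta>\<close> and \<open>V \<alpha>\<close> by the total
  difference of exponents. If a single exponent \<open>\<alpha> \<tau>\<close> is raised by one, giving \<open>\<alpha>'\<close>, then an
  ideal \<open>J\<close> is determined by its intersection with \<open>V \<alpha>'\<close> among the larger ideals that are, like
  \<open>J\<close>, not contained in \<open>V \<alpha>'\<close>: by \<open>residue\<close>, any element of order \<open>\<alpha> \<tau>\<close> at \<open>\<tau>\<close> differs from a
  multiple of one such element of \<open>J\<close> by an element of \<open>V \<alpha>'\<close>. So one exponent contributes
  at most one step to a chain.\<close>

lemma chain_rank:
  assumes "\<And>\<tau>. \<tau> \<in> T \<Longrightarrow> \<alpha> \<tau> \<le> \<beta> \<tau>"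
  shows "\<exists>\<mu>. \<forall>J. ideal J R \<and> V \<beta> \<subseteq> J \<longrightarrow> (\<mu> J \<le> (\<Sum>\<tau>\<in>T. \<beta> \<tau> - \<alpha> \<tau>) \<and>
    (\<forall>J'. ideal J' R \<and> J \<subset> J' \<and> J' \<subseteq> V \<alpha> \<longrightarrow> \<mu> J < \<mu> J'))"
  using assms
proof (induction "\<Sum>\<tau>\<in>T. \<beta> \<tau> - \<alpha> \<tau>" arbitrary: \<alpha>)
  case 0
  then have "\<And>\<tau>. \<tau> \<in> T \<Longrightarrow> \<alpha> \<tau> = \<beta> \<tau>" using finite_T by (auto simp: sum_eq_0_iff intro: antisym)
  then have "V \<alpha> = V \<beta>" unfolding V_def by auto
  then show ?case by (intro exI[of _ "\<lambda>_. 0"]) auto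
next
  case (Suc D)
  obtain \<tau> where t: "\<tau> \<in> T" and lt: "\<alpha> \<tau> < \<beta> \<tau>"
    and D: "D = (\<Sum>\<kappa>\<in>T. \<beta> \<kappa> - (\<alpha>(\<tau> := Suc (\<alpha> \<tau>))) \<kappa>)"
    using exponent_step[OF Suc(2)] by metis
  define \<alpha>' where "\<alpha>' = \<alpha>(\<tau> := Suc (\<alpha> \<tau>))"
  note D = D[folded \<alpha>'_def]
  have le: "\<And>\<tau>. \<tau> \<in> T \<Longrightarrow> \<alpha>' \<tau> \<le> \<beta> \<tau>" using Suc(3) lt by (auto simp: \<alpha>'_def)
  have sub: "V \<beta> \<subseteq> V \<alpha>'" using le by (rule V_antimono)
  have "\<exists>\<mu>. \<forall>J. ideal J R \<and> V \<beta> \<subseteq> J \<longrightarrow> (\<mu> J \<le> (\<Sum>\<tau>\<in>T. \<beta> \<tau> - \<alpha>' \<tau>) \<and>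
    (\<forall>J'. ideal J' R \<and> J \<subset> J' \<and> J' \<subseteq> V \<alpha>' \<longrightarrow> \<mu> J < \<mu> J'))"
    by (rule Suc(1)[OF D]) (rule le)
  then obtain \<mu> where \<mu>0: "\<forall>J. ideal J R \<and> V \<beta> \<subseteq> J \<longrightarrow> (\<mu> J \<le> D \<and>
    (\<forall>J'. ideal J' R \<and> J \<subset> J' \<and> J' \<subseteq> V \<alpha>' \<longrightarrow> \<mu> J < \<mu> J'))"
    unfolding D[symmetric] by blast
  have \<mu>: "\<And>J. ideal J R \<Longrightarrow> V \<beta> \<subseteq> J \<Longrightarrow> \<mu> J \<le> D"
    "\<And>J J'. ideal J R \<Longrightarrow> V \<beta> \<subseteq> J \<Longrightarrow> ideal J' R \<Longrightarrow> J \<subset> J' \<Longrightarrow> J' \<subseteq> V \<alpha>' \<Longrightarrow> \<mu> J < \<mu> J'"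
    using \<mu>0 by blast+
  \<comment> \<open>An ideal not contained in \<open>V \<alpha>'\<close> gets one more than its intersection with it.\<close>
  define \<nu> where "\<nu> J = \<mu> (J \<inter> V \<alpha>') + (if J \<subseteq> V \<alpha>' then 0 else 1)" for J
  have idl: "ideal (J \<inter> V \<alpha>') R" if "ideal J R" for J using i_intersect[OF that V_ideal] .
  have "\<nu> J \<le> Suc D" if "ideal J R" "V \<beta> \<subseteq> J" for J
    using \<mu>(1)[OF idl[OF that(1)]] that sub by (auto simp: \<nu>_def)
  moreover have "\<nu> J < \<nu> J'" if J: "ideal J R" "V \<beta> \<subseteq> J" and J': "ideal J' R" "J \<subset> J'" "J' \<subseteq> V \<alpha>" for J J'
  proof -
    have mono: "\<mu> (J \<inter> V \<alpha>') \<le> \<mu> (J' \<inter> V \<alpha>')"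
    proof (cases "J \<inter> V \<alpha>' = J' \<inter> V \<alpha>'")
      case False
      then have "J \<inter> V \<alpha>' \<subset> J' \<inter> V \<alpha>'" using J' by auto
      then show ?thesis using \<mu>(2)[OF idl[OF J(1)] _ idl[OF J'(1)]] J sub by fastforce
    qed simp
    show ?thesis
    proof (cases "J \<subseteq> V \<alpha>'")
      case True
      show ?thesis
      proof (cases "J' \<subseteq> V \<alpha>'")
        case T': True
        then have "J \<inter> V \<alpha>' = J" "J' \<inter> V \<alpha>' = J'" using True by auto
        then show ?thesis using \<mu>(2)[OF J J'(1,2) T'] T' True by (simp add: \<nu>_def)
      qed (use mono True in \<open>simp add: \<nu>_def\<close>)
    next
      case False
      then have F': "\<not> J' \<subseteq> V \<alpha>'" using J' by auto
      interpret J: ideal J R by fact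
      interpret J': ideal J' R by fact
      have jump: "w \<tau> r = enat (\<alpha> \<tau>)" if rJ: "r \<in> J'" "r \<notin> V \<alpha>'" for r
      proof -
        have r: "r \<in> carrier R" "\<And>\<kappa>. \<kappa> \<in> T \<Longrightarrow> enat (\<alpha> \<kappa>) \<le> w \<kappa> r" using rJ J' by (auto simp: V_def)
        then obtain \<kappa> where s: "\<kappa> \<in> T" "\<not> enat (\<alpha>' \<kappa>) \<le> w \<kappa> r" using rJ unfolding V_def by auto
        then have [simp]: "\<kappa> = \<tau>" using r(2)[of \<kappa>] unfolding \<alpha>'_def by (auto split: if_splits)
        have "\<not> enat (Suc (\<alpha> \<tau>)) \<le> w \<tau> r" "enat (\<alpha> \<tau>) \<le> w \<tau> r" using s r(2)[OF t] by (simp_all add: \<alpha>'_def)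
        then show ?thesis by (cases "w \<tau> r") auto
      qed
      obtain s where s: "s \<in> J" "s \<notin> V \<alpha>'" using False by auto
      have ws: "w \<tau> s = enat (\<alpha> \<tau>)" using jump s J' by auto
      have "J \<inter> V \<alpha>' \<noteq> J' \<inter> V \<alpha>'"
      proof
        assume eq: "J \<inter> V \<alpha>' = J' \<inter> V \<alpha>'"
        have "r \<in> J" if r: "r \<in> J'" for r
        proof (cases "r \<in> V \<alpha>'")
          case True then show ?thesis using eq r by auto
        next
          case False
          have wr: "w \<tau> r = enat (\<alpha> \<tau>)" using jump r False by auto
          have carr: "r \<in> carrier R" "s \<in> carrier R" using r s J.Icarr J'.Icarr by auto
          obtain c where c: "c \<in> carrier R" "enat (\<alpha> \<tau>) < w \<tau> (r \<ominus> c \<otimes> s)"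
            using residue[OF t carr wr ws] by auto
          have cs: "c \<otimes> s \<in> J" using s c J.I_l_closed by auto
          have d: "r \<ominus> c \<otimes> s \<in> J'" unfolding a_minus_def using r cs J' J'.a_inv_closed by (auto intro: J'.a_closed)
          have "r \<ominus> c \<otimes> s \<in> V \<alpha>'"
          proof (rule ccontr)
            assume "\<not> ?thesis" from jump[OF d this] c show False by simp
          qed
          then have "r \<ominus> c \<otimes> s \<in> J" using eq d by auto
          then have "(r \<ominus> c \<otimes> s) \<oplus> c \<otimes> s \<in> J" using cs J.a_closed by auto
          moreover have "(r \<ominus> c \<otimes> s) \<oplus> c \<otimes> s = r" using carr c by algebra
          ultimately show ?thesis by simp
        qed
        then show False using J' by auto
      qed
      then have "J \<inter> V \<alpha>' \<subset> J' \<inter> V \<alpha>'" using J' by auto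
      then have "\<mu> (J \<inter> V \<alpha>') < \<mu> (J' \<inter> V \<alpha>')" using \<mu>(2)[OF idl[OF J(1)] _ idl[OF J'(1)]] J sub by simp
      then show ?thesis using False F' by (simp add: \<nu>_def)
    qed
  qed
  ultimately show ?case using Suc(2) by (intro exI[of _ \<nu>]) auto
qed

lemma chain_length_le:
  assumes "\<And>\<tau>. \<tau> \<in> T \<Longrightarrow> \<alpha> \<tau> \<le> \<beta> \<tau>" and ch: "chain_of (\<lambda>J. ideal J R) c m"
    and "V \<beta> \<subseteq> c 0" "c m \<subseteq> V \<alpha>"
  shows "m \<le> (\<Sum>\<tau>\<in>T. \<beta> \<tau> - \<alpha> \<tau>)"
proof -
  have "\<exists>\<mu>. \<forall>J. ideal J R \<and> V \<beta> \<subseteq> J \<longrightarrow> (\<mu> J \<le> (\<Sum>\<tau>\<in>T. \<beta> \<tau> - \<alpha> \<tau>) \<and>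
    (\<forall>J'. ideal J' R \<and> J \<subset> J' \<and> J' \<subseteq> V \<alpha> \<longrightarrow> \<mu> J < \<mu> J'))"
    by (rule chain_rank) (rule assms(1))
  then obtain \<mu> where \<mu>0: "\<forall>J. ideal J R \<and> V \<beta> \<subseteq> J \<longrightarrow> (\<mu> J \<le> (\<Sum>\<tau>\<in>T. \<beta> \<tau> - \<alpha> \<tau>) \<and>
    (\<forall>J'. ideal J' R \<and> J \<subset> J' \<and> J' \<subseteq> V \<alpha> \<longrightarrow> \<mu> J < \<mu> J'))"
    by blast
  have \<mu>: "\<And>J. ideal J R \<Longrightarrow> V \<beta> \<subseteq> J \<Longrightarrow> \<mu> J \<le> (\<Sum>\<tau>\<in>T. \<beta> \<tau> - \<alpha> \<tau>)"
    "\<And>J J'. ideal J R \<Longrightarrow> V \<beta> \<subseteq> J \<Longrightarrow> ideal J' R \<Longrightarrow> J \<subset> J' \<Longrightarrow> J' \<subseteq> V \<alpha> \<Longrightarrow> \<mu> J < \<mu> J'"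
    using \<mu>0 by blast+
  have idl: "ideal (c i) R" if "i \<le> m" for i using ch that by (auto simp: chain_of_def)
  have str: "c i \<subset> c (Suc i)" if "i < m" for i using ch that by (auto simp: chain_of_def)
  have lo: "c 0 \<subseteq> c i" if "i \<le> m" for i using that
  proof (induction i)
    case (Suc i) then show ?case using str[of i] by auto
  qed simp
  have hi: "c (m - i) \<subseteq> c m" if "i \<le> m" for i using that
  proof (induction i)
    case (Suc i)
    then have "c (m - Suc i) \<subset> c (Suc (m - Suc i))" using str by auto
    moreover have "Suc (m - Suc i) = m - i" using Suc by auto
    ultimately show ?case using Suc by auto
  qed simp
  have hi': "c i \<subseteq> V \<alpha>" if "i \<le> m" for i using hi[of "m - i"] that assms(4) by auto
  have "i \<le> \<mu> (c i)" if "i \<le> m" for i using that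
  proof (induction i)
    case (Suc i)
    have "\<mu> (c i) < \<mu> (c (Suc i))"
      using \<mu>(2)[OF idl _ idl str hi'] Suc lo[of i] assms(3) by auto
    then show ?case using Suc by auto
  qed simp
  then have "m \<le> \<mu> (c m)" by simp
  also have "\<dots> \<le> (\<Sum>\<tau>\<in>T. \<beta> \<tau> - \<alpha> \<tau>)" using \<mu>(1)[OF idl] lo[of m] assms(3) by auto
  finally show ?thesis .
qed

text \<open>Beyond \<open>C\<close> every vector of exponents is attained by an element, so that the ideals \<open>V\<close> grow
  strictly whenever one exponent is lowered, and the bound of \<open>chain_length_le\<close> is reached.\<close>

lemma chain_exists:
  assumes "\<And>\<tau>. \<tau> \<in> T \<Longrightarrow> C \<le> \<alpha> \<tau> \<and> \<alpha> \<tau> \<le> \<beta> \<tau>"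
  shows "\<exists>c. chain_of (\<lambda>J. ideal J R) c (\<Sum>\<tau>\<in>T. \<beta> \<tau> - \<alpha> \<tau>) \<and> c 0 = V \<beta> \<and> c (\<Sum>\<tau>\<in>T. \<beta> \<tau> - \<alpha> \<tau>) = V \<alpha>"
  using assms
proof (induction "\<Sum>\<tau>\<in>T. \<beta> \<tau> - \<alpha> \<tau>" arbitrary: \<alpha>)
  case 0
  then have "\<And>\<tau>. \<tau> \<in> T \<Longrightarrow> \<alpha> \<tau> = \<beta> \<tau>" using finite_T by (auto simp: sum_eq_0_iff intro: antisym)
  then have "V \<alpha> = V \<beta>" unfolding V_def by auto
  then show ?case using 0(1) V_ideal by (intro exI[of _ "\<lambda>_. V \<alpha>"]) (auto simp: chain_of_def)
next
  case (Suc D)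
  obtain \<tau> where t: "\<tau> \<in> T" and lt: "\<alpha> \<tau> < \<beta> \<tau>"
    and D: "D = (\<Sum>\<kappa>\<in>T. \<beta> \<kappa> - (\<alpha>(\<tau> := Suc (\<alpha> \<tau>))) \<kappa>)"
    using exponent_step[OF Suc(2)] by metis
  define \<alpha>' where "\<alpha>' = \<alpha>(\<tau> := Suc (\<alpha> \<tau>))"
  note D = D[folded \<alpha>'_def]
  have le: "\<And>\<tau>. \<tau> \<in> T \<Longrightarrow> C \<le> \<alpha>' \<tau> \<and> \<alpha>' \<tau> \<le> \<beta> \<tau>" using Suc(3) lt by (auto simp: \<alpha>'_def intro: le_SucI)
  have "\<exists>c. chain_of (\<lambda>J. ideal J R) c (\<Sum>\<tau>\<in>T. \<beta> \<tau> - \<alpha>' \<tau>) \<and> c 0 = V \<beta> \<and>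
      c (\<Sum>\<tau>\<in>T. \<beta> \<tau> - \<alpha>' \<tau>) = V \<alpha>'"
    by (rule Suc(1)[OF D]) (rule le)
  then obtain c where c: "chain_of (\<lambda>J. ideal J R) c D" "c 0 = V \<beta>" "c D = V \<alpha>'"
    unfolding D[symmetric] by blast
  obtain r where r: "r \<in> carrier R" "\<And>\<tau>. \<tau> \<in> T \<Longrightarrow> w \<tau> r = enat (\<alpha> \<tau>)" using exact[of \<alpha>] Suc(3) by auto
  have "r \<in> V \<alpha>" "r \<notin> V \<alpha>'" using r t by (auto simp: V_def \<alpha>'_def)
  moreover have "V \<alpha>' \<subseteq> V \<alpha>" by (rule V_antimono) (simp add: \<alpha>'_def)
  ultimately have str: "V \<alpha>' \<subset> V \<alpha>" by auto
  show ?case unfolding Suc(2)[symmetric]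
    using c str V_ideal by (intro exI[of _ "c(Suc D := V \<alpha>)"]) (auto simp: chain_of_def le_Suc_eq less_Suc_eq)
qed

lemma quot_length_le:
  assumes I: "ideal J R" and bound: "\<And>c m. chain_of (\<lambda>K. ideal K R) c m \<Longrightarrow> J \<subseteq> c 0 \<Longrightarrow> m \<le> n"
  shows "ring_length (R Quot J) \<le> enat n"
  unfolding ring_length_def
proof (rule Sup_least, clarify)
  fix c m assume ch: "chain_of (\<lambda>K. ideal K (R Quot J)) c m"
  note bij = quot_ideal_correspondence[OF I]
  have K: "\<exists>L. ideal L R \<and> J \<subseteq> L \<and> c i = (+>) J ` L \<and> \<Union>(c i) = L" if "i \<le> m" for i
  proof -
    have "c i \<in> {K. ideal K (R Quot J)}" using ch that by (auto simp: chain_of_def)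
    then obtain L where L: "ideal L R" "J \<subseteq> L" "c i = (+>) J ` L"
      using bij unfolding bij_betw_def by blast
    then have "\<Union>(c i) = L" using ideal_incl_iff[OF I L(1)] by simp
    then show ?thesis using L by auto
  qed
  have "chain_of (\<lambda>K. ideal K R) (\<lambda>i. \<Union>(c i)) m"
    unfolding chain_of_def
  proof (intro conjI allI impI)
    fix i assume i: "i < m"
    obtain L L' where L: "c i = (+>) J ` L" "\<Union>(c i) = L" "c (Suc i) = (+>) J ` L'" "\<Union>(c (Suc i)) = L'"
      using K[of i] K[of "Suc i"] i by auto
    have "c i \<subset> c (Suc i)" using ch i by (auto simp: chain_of_def)
    then have "\<Union>(c i) \<subseteq> \<Union>(c (Suc i))" "\<Union>(c i) \<noteq> \<Union>(c (Suc i))" using L by (blast, metis psubset_eq)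
    then show "\<Union>(c i) \<subset> \<Union>(c (Suc i))" by auto
  qed (use K in blast)
  then have "m \<le> n" by (rule bound) (use K[of 0] in auto)
  then show "enat m \<le> enat n" by simp
qed

lemma quot_length_ge:
  assumes I: "ideal J R" and ch: "chain_of (\<lambda>K. ideal K R) c n" and sub: "J \<subseteq> c 0"
  shows "enat n \<le> ring_length (R Quot J)"
proof -
  have idl: "ideal (c i) R" if "i \<le> n" for i using ch that by (auto simp: chain_of_def)
  have J: "J \<subseteq> c i" if "i \<le> n" for i using that
  proof (induction i)
    case (Suc i)
    have "c i \<subset> c (Suc i)" using ch Suc(2) by (simp add: chain_of_def)
    then show ?case using Suc by auto
  qed (use sub in simp)
  have U: "\<Union>((+>) J ` c i) = c i" if "i \<le> n" for i using ideal_incl_iff[OF I idl[OF that]] J[OF that] by simp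
  have "chain_of (\<lambda>K. ideal K (R Quot J)) (\<lambda>i. (+>) J ` c i) n"
    unfolding chain_of_def
  proof (intro conjI allI impI)
    fix i assume i: "i < n"
    have "c i \<subset> c (Suc i)" using ch i by (auto simp: chain_of_def)
    moreover have "(+>) J ` c i \<noteq> (+>) J ` c (Suc i)" using U[of i] U[of "Suc i"] i calculation by (metis Suc_leI less_imp_le psubset_eq)
    ultimately show "(+>) J ` c i \<subset> (+>) J ` c (Suc i)" by blast
  qed (use ring_ideal_imp_quot_ideal[OF I idl] in auto)
  then show ?thesis unfolding ring_length_def by (intro Sup_upper) auto
qed

lemma length_upper: "ring_length (R Quot I k) \<le> enat (k * sum e T + C * card T)"
proof (rule quot_length_le[OF I_ideal])
  fix c m assume ch: "chain_of (\<lambda>K. ideal K R) c m" and sub: "I k \<subseteq> c 0"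
  have "m \<le> (\<Sum>\<tau>\<in>T. (k * e \<tau> + C) - 0)"
  proof (rule chain_length_le[OF _ ch, where \<alpha> = "\<lambda>_. 0"])
    show "V (\<lambda>\<tau>. k * e \<tau> + C) \<subseteq> c 0" using V_subset_I sub by auto
    have idl: "ideal (c m) R" using ch by (simp add: chain_of_def)
    show "c m \<subseteq> V (\<lambda>_. 0)" unfolding V_0 by (intro subsetI) (rule ideal.Icarr[OF idl])
  qed simp
  then show "m \<le> k * sum e T + C * card T" by (simp add: sum.distrib sum_distrib_left mult.commute)
qed

text \<open>The chain stops at \<open>V C\<close> because below \<open>C\<close> some exponents may be skipped.\<close>

lemma length_lower: assumes "C \<le> k" shows "enat (k * sum e T - C * card T) \<le> ring_length (R Quot I k)"
proof -
  have Ck: "C \<le> k * e \<tau>" if "\<tau> \<in> T" for \<tau>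
    using assms e_pos[OF that] by (cases "e \<tau>") auto
  obtain c where c: "chain_of (\<lambda>J. ideal J R) c (\<Sum>\<tau>\<in>T. k * e \<tau> - C)" "c 0 = V (\<lambda>\<tau>. k * e \<tau>)"
    using chain_exists[of "\<lambda>_. C" "\<lambda>\<tau>. k * e \<tau>"] Ck by auto
  have "enat (\<Sum>\<tau>\<in>T. k * e \<tau> - C) \<le> ring_length (R Quot I k)"
    by (rule quot_length_ge[OF I_ideal c(1)]) (use c I_subset_V in simp)
  moreover have "(\<Sum>\<tau>\<in>T. k * e \<tau> - C) = (\<Sum>\<tau>\<in>T. k * e \<tau>) - (\<Sum>\<tau>\<in>T. C)"
    using Ck by (intro sum_subtractf_nat) auto
  then have "(\<Sum>\<tau>\<in>T. k * e \<tau> - C) = k * sum e T - C * card T"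
    by (simp add: sum_distrib_left mult.commute)
  ultimately show ?thesis by simp
qed

lemma multiplicity_eq: "local_multiplicity R = real (sum e T)"
proof -
  define len where "len k = the_enat (ring_length (R Quot I k))" for k
  define E where "E = sum e T"
  define K where "K = C * card T"
  have up: "len k \<le> k * E + K" for k
    using length_upper[of k] unfolding len_def E_def K_def by (cases "ring_length (R Quot I k)") auto
  have lo: "k * E - K \<le> len k" if "C \<le> k" for k
    using length_lower[OF that] length_upper[of k] unfolding len_def E_def K_def
    by (cases "ring_length (R Quot I k)") auto
  have "(\<lambda>k. real (len k) / real k) \<longlonglongrightarrow> real E"
  proof (rule tendsto_sandwich)
    have inv: "(\<lambda>k. real K * (1 / real k)) \<longlonglongrightarrow> real K * 0"
      by (intro tendsto_intros lim_1_over_n)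
    show "(\<lambda>k. real E - real K * (1 / real k)) \<longlonglongrightarrow> real E"
      using tendsto_diff[OF tendsto_const inv, of "real E"] by simp
    show "(\<lambda>k. real E + real K * (1 / real k)) \<longlonglongrightarrow> real E"
      using tendsto_add[OF tendsto_const inv, of "real E"] by simp
    show "\<forall>\<^sub>F k in sequentially. real E - real K * (1 / real k) \<le> real (len k) / real k"
      using eventually_ge_at_top[of "max C 1"]
    proof eventually_elim
      case (elim k)
      have "real k * real E - real K \<le> real (k * E - K)"
        unfolding of_nat_mult[symmetric] by linarith
      also have "\<dots> \<le> real (len k)" using lo[of k] elim by simp
      finally have "(real k * real E - real K) / real k \<le> real (len k) / real k" by (rule divide_right_mono) simp
      moreover have "(real k * real E - real K) / real k = real E - real K * (1 / real k)"
        using elim by (simp add: diff_divide_distrib)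
      ultimately show ?case by simp
    qed
    show "\<forall>\<^sub>F k in sequentially. real (len k) / real k \<le> real E + real K * (1 / real k)"
      using eventually_ge_at_top[of "max C 1"]
    proof eventually_elim
      case (elim k)
      have "real (len k) \<le> real (k * E + K)" using up[of k] by (simp only: of_nat_le_iff)
      then have "real (len k) / real k \<le> real (k * E + K) / real k" by (rule divide_right_mono) simp
      moreover have "real (k * E + K) / real k = real E + real K * (1 / real k)"
        using elim by (simp add: add_divide_distrib)
      ultimately show ?case by simp
    qed
  qed
  then have "lim (\<lambda>k. real (len k) / real k) = real E" by (rule limI)
  moreover have "the_enat 1 = 1" by (simp add: one_enat_def)
  ultimately show ?thesis unfolding local_multiplicity_def krull_dim_eq
    by (simp add: len_def E_def)
qed

subsection \<open>Minimal primes of the completion\<close>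

text \<open>Elements of the completion are handled through coherent sequences of representatives: \<open>r k\<close>
  represents the component modulo the \<open>k\<close>-th power of the maximal ideal.\<close>

definition coh :: "(nat \<Rightarrow> 'a) \<Rightarrow> bool" where
  "coh r \<longleftrightarrow> (\<forall>k. r k \<in> carrier R \<and> r (Suc k) \<ominus> r k \<in> I k)"

definition cls :: "(nat \<Rightarrow> 'a) \<Rightarrow> nat \<Rightarrow> 'a set" where
  "cls r = (\<lambda>k. I k +> r k)"

abbreviation Rc where "Rc \<equiv> completion R"

lemma coh_carrier: "coh r \<Longrightarrow> r k \<in> carrier R" by (simp add: coh_def)

lemma I_mono: "j \<le> k \<Longrightarrow> I k \<subseteq> I j"
proof (induction k rule: dec_induct)
  case (step n)
  have "I (Suc n) \<subseteq> I n" using ideal_prod_inter[OF I_ideal M_ideal] by (auto simp: I_Suc)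
  then show ?case using step by auto
qed simp

lemma ideal_minus: "ideal J R \<Longrightarrow> a \<in> J \<Longrightarrow> b \<in> J \<Longrightarrow> a \<ominus> b \<in> J"
  unfolding a_minus_def
  by (metis additive_subgroup.a_closed additive_subgroup.a_inv_closed ideal.axioms(1))

lemma ideal_plus: "ideal J R \<Longrightarrow> a \<in> J \<Longrightarrow> b \<in> J \<Longrightarrow> a \<oplus> b \<in> J"
  by (metis additive_subgroup.a_closed ideal.axioms(1))

lemma coh_diff: assumes "coh r" "k \<le> j" shows "r j \<ominus> r k \<in> I k"
  using assms(2)
proof (induction j rule: dec_induct)
  case base
  have "r k \<ominus> r k = \<zero>" using coh_carrier[OF assms(1)] by (simp add: r_right_minus_eq)
  then show ?case using additive_subgroup.zero_closed[OF ideal.axioms(1)[OF I_ideal]] by simp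
next
  case (step n)
  have "r (Suc n) \<ominus> r n \<in> I k" using assms(1) I_mono[OF step(1)] by (auto simp: coh_def)
  moreover have "r (Suc n) \<ominus> r k = (r (Suc n) \<ominus> r n) \<oplus> (r n \<ominus> r k)"
    using coh_carrier[OF assms(1), of "Suc n"] coh_carrier[OF assms(1), of n] coh_carrier[OF assms(1), of k] by algebra
  ultimately show ?case using step.IH ideal_plus[OF I_ideal] by simp
qed

lemma rcos_eq_iff:
  assumes "ideal J R" "a \<in> carrier R" "b \<in> carrier R"
  shows "(J +> a = J +> b) \<longleftrightarrow> a \<ominus> b \<in> J"
  by (rule quotient_eq_iff_same_a_r_cos[OF assms, symmetric])

lemma cls_eq_iff: "coh r \<Longrightarrow> coh s \<Longrightarrow> cls r = cls s \<longleftrightarrow> (\<forall>k. r k \<ominus> s k \<in> I k)"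
  unfolding cls_def fun_eq_iff by (simp only: rcos_eq_iff[OF I_ideal coh_carrier coh_carrier])

lemma carrier_Rc: "carrier Rc = cls ` Collect coh"
proof (intro equalityI subsetI)
  fix f assume f: "f \<in> carrier Rc"
  have "\<exists>a\<in>carrier R. f k = I k +> a" for k
    using f by (auto simp: completion_def FactRing_def A_RCOSETS_def')
  then obtain r where r: "\<And>k. r k \<in> carrier R" "\<And>k. f k = I k +> r k" by metis
  have "r (Suc k) \<ominus> r k \<in> I k" for k
  proof -
    have "r (Suc k) \<in> f (Suc k)" using r abelian_subgroup.a_rcos_self[OF abelian_subgroupI3[OF ideal.axioms(1)[OF I_ideal] is_abelian_group]] by simp
    then have "r (Suc k) \<in> I k +> r k" using f r(2) by (auto simp: completion_def)
    then obtain i where "i \<in> I k" "r (Suc k) = i \<oplus> r k" by (auto simp: a_r_coset_def')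
    moreover then have "r (Suc k) \<ominus> r k = i" using r(1) ideal.Icarr[OF I_ideal] by algebra
    ultimately show ?thesis by simp
  qed
  then have "coh r" "f = cls r" using r by (auto simp: coh_def cls_def)
  then show "f \<in> cls ` Collect coh" by auto
next
  fix f assume "f \<in> cls ` Collect coh"
  then obtain r where r: "coh r" "f = cls r" by auto
  have "I (Suc k) +> r (Suc k) \<subseteq> I k +> r k" for k
  proof
    fix y assume "y \<in> I (Suc k) +> r (Suc k)"
    then obtain i where i: "i \<in> I (Suc k)" "y = i \<oplus> r (Suc k)" by (auto simp: a_r_coset_def')
    have ik: "i \<in> I k" using i(1) I_mono[of k "Suc k"] by auto
    have "i \<oplus> (r (Suc k) \<ominus> r k) \<in> I k" using ik r(1) ideal_plus[OF I_ideal] by (auto simp: coh_def)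
    moreover have "y = (i \<oplus> (r (Suc k) \<ominus> r k)) \<oplus> r k"
      using i(2) ideal.Icarr[OF I_ideal ik] coh_carrier[OF r(1), of k] coh_carrier[OF r(1), of "Suc k"] by algebra
    ultimately show "y \<in> I k +> r k" by (auto simp: a_r_coset_def')
  qed
  then show "f \<in> carrier Rc" using r coh_carrier[OF r(1)]
    by (auto simp: completion_def FactRing_def A_RCOSETS_def' cls_def)
qed

lemma carrier_RcE:
  assumes "f \<in> carrier Rc" obtains r where "coh r" "f = cls r"
  using assms carrier_Rc by auto

lemma coh_mult: assumes "coh r" "coh s" shows "coh (\<lambda>k. r k \<otimes> s k)"
  unfolding coh_def
proof (intro allI conjI)
  fix k
  note c = coh_carrier[OF assms(1), of k] coh_carrier[OF assms(1), of "Suc k"]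
    coh_carrier[OF assms(2), of k] coh_carrier[OF assms(2), of "Suc k"]
  show "r k \<otimes> s k \<in> carrier R" using c by simp
  have "r (Suc k) \<otimes> s (Suc k) \<ominus> r k \<otimes> s k = r (Suc k) \<otimes> (s (Suc k) \<ominus> s k) \<oplus> s k \<otimes> (r (Suc k) \<ominus> r k)"
    using c by algebra
  moreover have "r (Suc k) \<otimes> (s (Suc k) \<ominus> s k) \<in> I k" "s k \<otimes> (r (Suc k) \<ominus> r k) \<in> I k"
    using assms c ideal.I_l_closed[OF I_ideal] by (auto simp: coh_def)
  ultimately show "r (Suc k) \<otimes> s (Suc k) \<ominus> r k \<otimes> s k \<in> I k" using ideal_plus[OF I_ideal] by simp
qed

lemma coh_add: assumes "coh r" "coh s" shows "coh (\<lambda>k. r k \<oplus> s k)"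
  unfolding coh_def
proof (intro allI conjI)
  fix k
  note c = coh_carrier[OF assms(1), of k] coh_carrier[OF assms(1), of "Suc k"]
    coh_carrier[OF assms(2), of k] coh_carrier[OF assms(2), of "Suc k"]
  show "r k \<oplus> s k \<in> carrier R" using c by simp
  have "(r (Suc k) \<oplus> s (Suc k)) \<ominus> (r k \<oplus> s k) = (s (Suc k) \<ominus> s k) \<oplus> (r (Suc k) \<ominus> r k)"
    using c by algebra
  then show "(r (Suc k) \<oplus> s (Suc k)) \<ominus> (r k \<oplus> s k) \<in> I k"
    using assms ideal_plus[OF I_ideal] by (auto simp: coh_def)
qed

lemma coh_const: "a \<in> carrier R \<Longrightarrow> coh (\<lambda>_. a)"
  using additive_subgroup.zero_closed[OF ideal.axioms(1)[OF I_ideal]]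
  by (simp add: coh_def a_minus_def r_neg)

lemma coh_uminus: assumes "coh r" shows "coh (\<lambda>k. \<ominus> r k)"
proof -
  have "coh (\<lambda>k. (\<ominus> \<one>) \<otimes> r k)" using coh_mult[OF coh_const assms] by simp
  moreover have "(\<lambda>k. (\<ominus> \<one>) \<otimes> r k) = (\<lambda>k. \<ominus> r k)" using coh_carrier[OF assms] by (auto simp: l_minus)
  ultimately show ?thesis by simp
qed

lemma cls_mult: "coh r \<Longrightarrow> coh s \<Longrightarrow> cls r \<otimes>\<^bsub>Rc\<^esub> cls s = cls (\<lambda>k. r k \<otimes> s k)"
  using ideal.rcoset_mult_add[OF I_ideal] coh_carrier
  by (auto simp: completion_def FactRing_def cls_def)

lemma cls_add: "coh r \<Longrightarrow> coh s \<Longrightarrow> cls r \<oplus>\<^bsub>Rc\<^esub> cls s = cls (\<lambda>k. r k \<oplus> s k)"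
  using ideal.a_rcos_sum[OF I_ideal] coh_carrier
  by (auto simp: completion_def FactRing_def cls_def)

lemma cls_one: "\<one>\<^bsub>Rc\<^esub> = cls (\<lambda>_. \<one>)"
  by (simp add: completion_def FactRing_def cls_def)

lemma cls_zero: "\<zero>\<^bsub>Rc\<^esub> = cls (\<lambda>_. \<zero>)"
  using a_rcos_zero[OF I_ideal] additive_subgroup.zero_closed[OF ideal.axioms(1)[OF I_ideal]]
  by (auto simp: completion_def FactRing_def cls_def)

lemma Rc_cring: "cring Rc"
proof (rule cringI)
  have A: "\<exists>r. coh r \<and> f = cls r" if "f \<in> carrier Rc" for f using that carrier_Rc by auto
  note cl = coh_mult coh_add coh_const coh_uminus
  show "abelian_group Rc"
  proof (rule abelian_groupI)
    fix f assume "f \<in> carrier Rc"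
    then obtain r where r: "coh r" "f = cls r" using A by auto
    have "cls (\<lambda>k. \<ominus> r k) \<oplus>\<^bsub>Rc\<^esub> f = \<zero>\<^bsub>Rc\<^esub>"
      using r coh_carrier[OF r(1)] by (simp add: cls_add cl cls_zero l_neg)
    then show "\<exists>g\<in>carrier Rc. g \<oplus>\<^bsub>Rc\<^esub> f = \<zero>\<^bsub>Rc\<^esub>" using cl(4)[OF r(1)] by (auto simp: carrier_Rc)
    show "\<zero>\<^bsub>Rc\<^esub> \<oplus>\<^bsub>Rc\<^esub> f = f" using r coh_carrier[OF r(1)] by (simp add: cls_add cl cls_zero)
  next
    fix f g h assume "f \<in> carrier Rc" "g \<in> carrier Rc" "h \<in> carrier Rc"
    then obtain r s t where r: "coh r" "f = cls r" "coh s" "g = cls s" "coh t" "h = cls t" using A[of f] A[of g] A[of h] by blast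
    note c = coh_carrier[OF r(1)] coh_carrier[OF r(3)] coh_carrier[OF r(5)]
    show "f \<oplus>\<^bsub>Rc\<^esub> g \<oplus>\<^bsub>Rc\<^esub> h = f \<oplus>\<^bsub>Rc\<^esub> (g \<oplus>\<^bsub>Rc\<^esub> h)"
      using r c by (simp add: cls_add cl a_assoc)
  next
    fix f g assume "f \<in> carrier Rc" "g \<in> carrier Rc"
    then obtain r s where r: "coh r" "f = cls r" "coh s" "g = cls s" using A[of f] A[of g] by blast
    note c = coh_carrier[OF r(1)] coh_carrier[OF r(3)]
    show "f \<oplus>\<^bsub>Rc\<^esub> g \<in> carrier Rc" using r cl by (auto simp: cls_add carrier_Rc)
    show "f \<oplus>\<^bsub>Rc\<^esub> g = g \<oplus>\<^bsub>Rc\<^esub> f" using r c by (simp add: cls_add cl a_comm)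
  qed (use cl in \<open>auto simp: cls_zero carrier_Rc\<close>)
  show "Group.comm_monoid Rc"
  proof (rule comm_monoidI)
    fix f assume "f \<in> carrier Rc"
    then obtain r where r: "coh r" "f = cls r" using A by auto
    show "\<one>\<^bsub>Rc\<^esub> \<otimes>\<^bsub>Rc\<^esub> f = f" using r coh_carrier[OF r(1)] by (simp add: cls_mult cl cls_one)
  next
    fix f g h assume "f \<in> carrier Rc" "g \<in> carrier Rc" "h \<in> carrier Rc"
    then obtain r s t where r: "coh r" "f = cls r" "coh s" "g = cls s" "coh t" "h = cls t" using A[of f] A[of g] A[of h] by blast
    note c = coh_carrier[OF r(1)] coh_carrier[OF r(3)] coh_carrier[OF r(5)]
    show "f \<otimes>\<^bsub>Rc\<^esub> g \<otimes>\<^bsub>Rc\<^esub> h = f \<otimes>\<^bsub>Rc\<^esub> (g \<otimes>\<^bsub>Rc\<^esub> h)"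
      using r c by (simp add: cls_mult cl m_assoc)
  next
    fix f g assume "f \<in> carrier Rc" "g \<in> carrier Rc"
    then obtain r s where r: "coh r" "f = cls r" "coh s" "g = cls s" using A[of f] A[of g] by blast
    note c = coh_carrier[OF r(1)] coh_carrier[OF r(3)]
    show "f \<otimes>\<^bsub>Rc\<^esub> g \<in> carrier Rc" using r cl by (auto simp: cls_mult carrier_Rc)
    show "f \<otimes>\<^bsub>Rc\<^esub> g = g \<otimes>\<^bsub>Rc\<^esub> f" using r c by (simp add: cls_mult cl m_comm)
  qed (use cl in \<open>auto simp: cls_one carrier_Rc\<close>)
next
  fix f g h assume "f \<in> carrier Rc" "g \<in> carrier Rc" "h \<in> carrier Rc"
  then obtain r s t where r: "coh r" "f = cls r" "coh s" "g = cls s" "coh t" "h = cls t"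
    by (elim carrier_RcE)
  note c = coh_carrier[OF r(1)] coh_carrier[OF r(3)] coh_carrier[OF r(5)]
  show "(f \<oplus>\<^bsub>Rc\<^esub> g) \<otimes>\<^bsub>Rc\<^esub> h = f \<otimes>\<^bsub>Rc\<^esub> h \<oplus>\<^bsub>Rc\<^esub> g \<otimes>\<^bsub>Rc\<^esub> h"
    using r c by (simp add: cls_mult cls_add coh_mult coh_add l_distr)
qed

text \<open>\<open>P {\<tau>}\<close> is the kernel of the map from the completion of \<open>R\<close> to the completion of the valuation
  ring at \<open>\<tau>\<close>. The index \<open>k\<close> serves as the precision and as the bound on the order at once: as
  elements of \<open>I k\<close> have order at least \<open>k * e \<tau> \<ge> k\<close>, the condition does not depend on the
  representatives (\<open>cls_P_iff\<close>).\<close>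

definition P :: "'t set \<Rightarrow> (nat \<Rightarrow> 'a set) set" where
  "P A = {cls r | r. coh r \<and> (\<forall>\<tau>\<in>A. \<forall>k. enat k \<le> w \<tau> (r k))}"

lemma w_I: assumes "\<tau> \<in> T" "r \<in> I k" shows "enat k \<le> w \<tau> r"
proof -
  have "enat (k * e \<tau>) \<le> w \<tau> r" using assms I_subset_V by (auto simp: V_def)
  moreover have "k \<le> k * e \<tau>" using e_pos[OF assms(1)] by simp
  ultimately show ?thesis by (meson enat_ord_simps(1) order_trans)
qed

lemma cls_P_iff: assumes "A \<subseteq> T" "coh r" shows "cls r \<in> P A \<longleftrightarrow> (\<forall>\<tau>\<in>A. \<forall>k. enat k \<le> w \<tau> (r k))"
proof
  assume "cls r \<in> P A"
  then obtain s where s: "coh s" "cls r = cls s" "\<And>\<tau> k. \<tau> \<in> A \<Longrightarrow> enat k \<le> w \<tau> (s k)" by (auto simp: P_def)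
  show "\<forall>\<tau>\<in>A. \<forall>k. enat k \<le> w \<tau> (r k)"
  proof (intro ballI allI)
    fix \<tau> k assume t: "\<tau> \<in> A"
    have tT: "\<tau> \<in> T" using t assms by auto
    have "r k \<ominus> s k \<in> I k" using cls_eq_iff[OF assms(2) s(1)] s(2) by auto
    then have "enat k \<le> w \<tau> (r k \<ominus> s k)" using w_I[OF tT] by auto
    moreover have "r k = (r k \<ominus> s k) \<oplus> s k" using coh_carrier[OF assms(2), of k] coh_carrier[OF s(1), of k] by algebra
    ultimately show "enat k \<le> w \<tau> (r k)"
      using w_add_ge[OF tT, of "r k \<ominus> s k" "s k" "enat k"] s(3)[OF t, of k] coh_carrier[OF assms(2), of k] coh_carrier[OF s(1), of k]
      by simp
  qed
qed (use assms in \<open>auto simp: P_def\<close>)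

lemma P_ideal: assumes "A \<subseteq> T" shows "ideal (P A) Rc"
proof -
  interpret Rc: cring Rc by (rule Rc_cring)
  have sub: "P A \<subseteq> carrier Rc" by (auto simp: P_def carrier_Rc)
  have l: "f \<otimes>\<^bsub>Rc\<^esub> g \<in> P A" if g: "g \<in> P A" and f: "f \<in> carrier Rc" for f g
  proof -
    obtain r s where r: "coh r" "f = cls r" "coh s" "g = cls s"
      using f subsetD[OF sub g] by (elim carrier_RcE)
    have "\<forall>\<tau>\<in>A. \<forall>k. enat k \<le> w \<tau> (r k \<otimes> s k)"
    proof (intro ballI allI)
      fix \<tau> k assume t: "\<tau> \<in> A"
      then have "w \<tau> (r k \<otimes> s k) = w \<tau> (r k) + w \<tau> (s k)"
        using assms by (intro w_mult coh_carrier r) auto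
      moreover have "enat k \<le> w \<tau> (s k)" using g cls_P_iff[OF assms r(3)] r t by auto
      ultimately show "enat k \<le> w \<tau> (r k \<otimes> s k)" by (simp add: add_increasing)
    qed
    then show ?thesis using r cls_P_iff[OF assms coh_mult[OF r(1,3)]] by (simp add: cls_mult)
  qed
  show ?thesis
  proof (rule idealI[OF Rc.ring_axioms])
    show "subgroup (P A) (add_monoid Rc)"
    proof (rule Rc.add.subgroupI)
      show "P A \<noteq> {}" using cls_P_iff[OF assms coh_const[of \<zero>]] w_zero assms by (auto simp: subset_iff)
    next
      fix f assume f: "f \<in> P A"
      then have fc: "f \<in> carrier Rc" using sub by auto
      have "\<ominus>\<^bsub>Rc\<^esub> f = (\<ominus>\<^bsub>Rc\<^esub> \<one>\<^bsub>Rc\<^esub>) \<otimes>\<^bsub>Rc\<^esub> f" using fc by (simp add: Rc.l_minus)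
      then show "\<ominus>\<^bsub>Rc\<^esub> f \<in> P A" using l[OF f] by simp
    next
      fix f g assume f: "f \<in> P A" and g: "g \<in> P A"
      obtain r s where r: "coh r" "f = cls r" "coh s" "g = cls s"
        using subsetD[OF sub f] subsetD[OF sub g] by (elim carrier_RcE)
      have "\<forall>\<tau>\<in>A. \<forall>k. enat k \<le> w \<tau> (r k \<oplus> s k)"
      proof (intro ballI allI)
        fix \<tau> k assume t: "\<tau> \<in> A"
        have "enat k \<le> w \<tau> (r k)" "enat k \<le> w \<tau> (s k)"
          using f g cls_P_iff[OF assms r(1)] cls_P_iff[OF assms r(3)] r t by auto
        then show "enat k \<le> w \<tau> (r k \<oplus> s k)"
          using t assms coh_carrier[OF r(1)] coh_carrier[OF r(3)] by (intro w_add_ge) auto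
      qed
      then show "f \<oplus>\<^bsub>Rc\<^esub> g \<in> P A" using r cls_P_iff[OF assms coh_add[OF r(1,3)]] by (simp add: cls_add)
    qed (use sub in auto)
  next
    fix a y assume "a \<in> P A" "y \<in> carrier Rc"
    then show "y \<otimes>\<^bsub>Rc\<^esub> a \<in> P A" "a \<otimes>\<^bsub>Rc\<^esub> y \<in> P A" using l sub by (auto simp: Rc.m_comm subset_iff)
  qed
qed

text \<open>Once \<open>r k\<close> has order less than \<open>k\<close>, the later terms differ from it only by elements of larger
  order. This limit order is additive on products, which makes \<open>P {\<tau>}\<close> prime.\<close>

lemma eventually_order:
  assumes t: "\<tau> \<in> T" and r: "coh r" and n: "cls r \<notin> P {\<tau>}"
  obtains a k where "\<And>j. k \<le> j \<Longrightarrow> w \<tau> (r j) = enat a"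
proof -
  obtain k where k: "w \<tau> (r k) < enat k" using n cls_P_iff[of "{\<tau>}", OF _ r] t by (auto simp: not_le)
  then obtain a where a: "w \<tau> (r k) = enat a" by (cases "w \<tau> (r k)") auto
  have "w \<tau> (r j) = enat a" if "k \<le> j" for j
  proof -
    have "enat k \<le> w \<tau> (r j \<ominus> r k)" using w_I[OF t coh_diff[OF r that]] .
    then have "w \<tau> (r k) < w \<tau> (r j \<ominus> r k)" using k by auto
    then show ?thesis using w_stable[OF t coh_carrier[OF r, of j] coh_carrier[OF r, of k]] a by simp
  qed
  then show thesis using that by blast
qed

lemma P_prime: assumes t: "\<tau> \<in> T" shows "primeideal (P {\<tau>}) Rc"
proof (rule primeidealI[OF P_ideal Rc_cring])
  have "cls (\<lambda>_. \<one>) \<notin> P {\<tau>}"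
    using cls_P_iff[of "{\<tau>}", OF _ coh_const[OF one_closed]] t w_one[OF t] by (auto simp: zero_enat_def intro!: exI[of _ 1])
  moreover have "cls (\<lambda>_. \<one>) \<in> carrier Rc" using coh_const[OF one_closed] by (auto simp: carrier_Rc)
  ultimately show "carrier Rc \<noteq> P {\<tau>}" by auto
next
  fix f g assume "f \<in> carrier Rc" "g \<in> carrier Rc" and fg: "f \<otimes>\<^bsub>Rc\<^esub> g \<in> P {\<tau>}"
  then obtain r s where r: "coh r" "f = cls r" "coh s" "g = cls s"
    by (elim carrier_RcE)
  show "f \<in> P {\<tau>} \<or> g \<in> P {\<tau>}"
  proof (rule ccontr)
    assume "\<not> ?thesis"
    then obtain a k b l where a: "\<And>j. k \<le> j \<Longrightarrow> w \<tau> (r j) = enat a" and b: "\<And>j. l \<le> j \<Longrightarrow> w \<tau> (s j) = enat b"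
      using eventually_order[OF t r(1)] eventually_order[OF t r(3)] r by metis
    define j where "j = k + l + a + b + 1"
    have "w \<tau> (r j \<otimes> s j) = enat (a + b)" using a[of j] b[of j] w_mult[OF t] coh_carrier r by (simp add: j_def)
    moreover have "enat j \<le> w \<tau> (r j \<otimes> s j)"
      using fg cls_P_iff[of "{\<tau>}", OF _ coh_mult[OF r(1,3)]] t r by (simp add: cls_mult)
    ultimately show False by (simp add: j_def)
  qed
qed (use t in auto)

lemma large_order_in_I: assumes "r \<in> carrier R" "\<And>\<tau>. \<tau> \<in> T \<Longrightarrow> enat (k * sum e T + C) \<le> w \<tau> r" shows "r \<in> I k"
proof -
  have "r \<in> V (\<lambda>\<tau>. k * e \<tau> + C)" unfolding V_def
  proof (clarsimp simp: assms(1))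
    fix \<tau> assume t: "\<tau> \<in> T"
    have "e \<tau> \<le> sum e T" using t finite_T by (simp add: member_le_sum)
    then have "enat (k * e \<tau> + C) \<le> enat (k * sum e T + C)" by simp
    then show "enat (k * e \<tau> + C) \<le> w \<tau> r" using assms(2)[OF t] by (rule order_trans)
  qed
  then show ?thesis using V_subset_I by auto
qed

text \<open>An element of large order at all \<open>\<tau>\<close> lies in a high power of the maximal ideal, so a sequence
  whose orders all tend to infinity represents zero.\<close>

lemma P_T_zero: "P T = {\<zero>\<^bsub>Rc\<^esub>}"
proof -
  have "cls r = \<zero>\<^bsub>Rc\<^esub>" if r: "coh r" "\<forall>\<tau>\<in>T. \<forall>k. enat k \<le> w \<tau> (r k)" for r
  proof -
    have "r k \<in> I k" for k
    proof -
      define j where "j = k + (k * sum e T + C)"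
      have "r j \<in> I k"
      proof (rule large_order_in_I[OF coh_carrier[OF r(1)]])
        fix \<tau> assume "\<tau> \<in> T"
        then have "enat j \<le> w \<tau> (r j)" using r by auto
        then show "enat (k * sum e T + C) \<le> w \<tau> (r j)" by (rule order_trans[rotated]) (simp add: j_def)
      qed
      moreover have "r j \<ominus> r k \<in> I k" by (rule coh_diff[OF r(1)]) (simp add: j_def)
      moreover have "r k = r j \<ominus> (r j \<ominus> r k)" using coh_carrier[OF r(1), of j] coh_carrier[OF r(1), of k] by algebra
      ultimately show ?thesis using ideal_minus[OF I_ideal] by metis
    qed
    then have "cls r = cls (\<lambda>_. \<zero>)" using cls_eq_iff[OF r(1) coh_const[OF zero_closed]] coh_carrier[OF r(1)]
      by (simp add: a_minus_def)
    then show ?thesis by (simp add: cls_zero)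
  qed
  moreover have "\<zero>\<^bsub>Rc\<^esub> \<in> P T" using cls_P_iff[OF subset_refl coh_const[OF zero_closed]] w_zero by (simp add: cls_zero)
  ultimately show ?thesis by (auto simp: P_def)
qed

text \<open>The product of all the ideals \<open>P {\<tau>}\<close> is contained in \<open>P T\<close>, which is zero.\<close>

lemma prime_contains_P:
  assumes Q: "primeideal Q Rc"
  shows "\<exists>\<tau>\<in>T. P {\<tau>} \<subseteq> Q"
proof -
  interpret Q: primeideal Q Rc by fact
  have "P A \<subseteq> Q \<Longrightarrow> \<exists>\<tau>\<in>A. P {\<tau>} \<subseteq> Q" if "finite A" "A \<noteq> {}" "A \<subseteq> T" for A
    using that
  proof (induction A rule: finite_ne_induct)
    case (insert \<tau> A)
    show ?case
    proof (cases "P {\<tau>} \<subseteq> Q")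
      case False
      then obtain f where f: "f \<in> P {\<tau>}" "f \<notin> Q" by auto
      have "P A \<subseteq> Q"
      proof
        fix g assume g: "g \<in> P A"
        obtain r s where r: "coh r" "f = cls r" "\<forall>k. enat k \<le> w \<tau> (r k)" "coh s" "g = cls s" "\<forall>\<kappa>\<in>A. \<forall>k. enat k \<le> w \<kappa> (s k)"
          using f g by (auto simp: P_def)
        have "enat k \<le> w \<kappa> (r k \<otimes> s k)" if "\<kappa> \<in> insert \<tau> A" for \<kappa> k
        proof -
          have "w \<kappa> (r k \<otimes> s k) = w \<kappa> (r k) + w \<kappa> (s k)"
            using w_mult[of \<kappa>] that insert coh_carrier r by auto
          moreover have "enat k \<le> w \<kappa> (r k) \<or> enat k \<le> w \<kappa> (s k)" using that r by auto
          ultimately show ?thesis by (auto simp: add_increasing add_increasing2)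
        qed
        then have "f \<otimes>\<^bsub>Rc\<^esub> g \<in> P (insert \<tau> A)" using coh_mult[OF r(1,4)] r by (auto simp: cls_mult P_def)
        then have "f \<otimes>\<^bsub>Rc\<^esub> g \<in> Q" using insert by auto
        then show "g \<in> Q" using Q.I_prime[of f g] f r by (auto simp: carrier_Rc)
      qed
      then show ?thesis using insert by auto
    qed auto
  qed simp
  from this[OF finite_T T_nonempty subset_refl] show ?thesis using P_T_zero Q.zero_closed by auto
qed

text \<open>The elements provided by \<open>separate\<close> converge to an element of the completion that equals \<open>y \<noteq> 0\<close>
  at \<open>\<tau>\<close> and vanishes at all other points.\<close>

lemma P_incomparable: assumes "\<kappa> \<in> T" "\<tau> \<in> T" "\<kappa> \<noteq> \<tau>" shows "\<not> P {\<kappa>} \<subseteq> P {\<tau>}"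
proof -
  obtain y where y: "y \<in> carrier R" "y \<noteq> \<zero>" and approx: "\<And>N. \<exists>r\<in>carrier R.
      enat N \<le> w \<tau> (r \<ominus> y) \<and> (\<forall>\<tau>'\<in>T - {\<tau>}. enat N \<le> w \<tau>' r)" using separate[OF assms(2)] by auto
  obtain \<rho> where \<rho>: "\<And>N. \<rho> N \<in> carrier R" "\<And>N. enat N \<le> w \<tau> (\<rho> N \<ominus> y)" "\<And>N \<tau>'. \<tau>' \<in> T - {\<tau>} \<Longrightarrow> enat N \<le> w \<tau>' (\<rho> N)"
    using approx by metis
  \<comment> \<open>The first two summands force the differences into \<open>I k\<close>, the last makes the orders at \<open>\<kappa>\<close> exceed \<open>k\<close>.\<close>
  define N where "N k = k * sum e T + C + k" for k
  define s where "s k = \<rho> (N k)" for k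
  have sc: "s k \<in> carrier R" for k using \<rho> by (simp add: s_def)
  have "s (Suc k) \<ominus> s k \<in> I k" for k
  proof (rule large_order_in_I)
    fix \<tau>' assume t: "\<tau>' \<in> T"
    have le: "enat (N k) \<le> enat (N (Suc k))" by (simp add: N_def)
    have "enat (N k) \<le> w \<tau>' (s (Suc k) \<ominus> s k)"
    proof (cases "\<tau>' = \<tau>")
      case True
      have "s (Suc k) \<ominus> s k = (s (Suc k) \<ominus> y) \<ominus> (s k \<ominus> y)" using sc[of k] sc[of "Suc k"] y by algebra
      moreover have "enat (N k) \<le> w \<tau> (s (Suc k) \<ominus> y)" "enat (N k) \<le> w \<tau> (s k \<ominus> y)"
        unfolding s_def by (rule order_trans[OF le \<rho>(2)], rule \<rho>(2))
      ultimately show ?thesis using True w_minus_ge[OF assms(2), of "s (Suc k) \<ominus> y" "s k \<ominus> y" "enat (N k)"] sc y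
        by simp
    next
      case False
      then have t': "\<tau>' \<in> T - {\<tau>}" using t by simp
      have "enat (N k) \<le> w \<tau>' (s (Suc k))" "enat (N k) \<le> w \<tau>' (s k)"
        unfolding s_def by (rule order_trans[OF le \<rho>(3)[OF t']], rule \<rho>(3)[OF t'])
      then show ?thesis using w_minus_ge[OF t sc sc] by simp
    qed
    then show "enat (k * sum e T + C) \<le> w \<tau>' (s (Suc k) \<ominus> s k)" by (rule order_trans[rotated]) (simp add: N_def)
  qed (simp add: sc)
  then have coh: "coh s" using sc by (simp add: coh_def)
  have "enat k \<le> w \<kappa> (s k)" for k
  proof -
    have "enat k \<le> enat (N k)" by (simp add: N_def)
    also have "\<dots> \<le> w \<kappa> (s k)" using \<rho>(3)[of \<kappa> "N k"] assms unfolding s_def by simp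
    finally show ?thesis .
  qed
  then have "cls s \<in> P {\<kappa>}" using coh by (auto simp: P_def)
  moreover have "cls s \<notin> P {\<tau>}"
  proof
    assume "cls s \<in> P {\<tau>}"
    then have le: "enat k \<le> w \<tau> (s k)" for k using cls_P_iff[of "{\<tau>}", OF _ coh] assms by auto
    obtain n where n: "w \<tau> y = enat n" using w_inf[OF assms(2) y(1)] y(2) by auto
    have "enat (Suc n) \<le> w \<tau> (s (Suc n) \<ominus> y)"
      using \<rho>(2)[of "N (Suc n)"] unfolding s_def by (rule order_trans[rotated]) (simp add: N_def)
    then have "w \<tau> y < w \<tau> (s (Suc n) \<ominus> y)" using n by (simp add: Suc_ile_eq)
    then have "w \<tau> (s (Suc n)) = enat n" using w_stable[OF assms(2) sc y(1)] n by simp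
    then show False using le[of "Suc n"] by simp
  qed
  ultimately show ?thesis by auto
qed

lemma minimal_primes_eq: "minimal_primes Rc = (\<lambda>\<tau>. P {\<tau>}) ` T"
proof (intro equalityI subsetI)
  fix Q assume Q: "Q \<in> minimal_primes Rc"
  then have Qp: "primeideal Q Rc" by (simp add: minimal_primes_def)
  from prime_contains_P[OF this] obtain \<tau> where t: "\<tau> \<in> T" "P {\<tau>} \<subseteq> Q" by blast
  then have "P {\<tau>} = Q" using Q P_prime by (auto simp: minimal_primes_def)
  then show "Q \<in> (\<lambda>\<tau>. P {\<tau>}) ` T" using t by auto
next
  fix Q assume "Q \<in> (\<lambda>\<tau>. P {\<tau>}) ` T"
  then obtain \<tau> where t: "\<tau> \<in> T" "Q = P {\<tau>}" by auto
  have "Q' = Q" if Q': "primeideal Q' Rc" "Q' \<subseteq> Q" for Q'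
  proof -
    obtain \<kappa> where s: "\<kappa> \<in> T" "P {\<kappa>} \<subseteq> Q'" using prime_contains_P[OF Q'(1)] by blast
    then have "\<kappa> = \<tau>" using P_incomparable[OF s(1) t(1)] Q' t by auto
    then show ?thesis using s Q' t by auto
  qed
  then show "Q \<in> minimal_primes Rc" using t P_prime by (auto simp: minimal_primes_def)
qed

lemma branches_count: "finite (minimal_primes Rc)" "card (minimal_primes Rc) = card T"
proof -
  have "inj_on (\<lambda>\<tau>. P {\<tau>}) T"
  proof (rule inj_onI)
    fix \<kappa> \<tau> assume "\<kappa> \<in> T" "\<tau> \<in> T" "P {\<kappa>} = P {\<tau>}"
    then show "\<kappa> = \<tau>" using P_incomparable[of \<kappa> \<tau>] by auto
  qed
  then show "card (minimal_primes Rc) = card T" by (simp add: minimal_primes_eq card_image)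
qed (simp add: minimal_primes_eq finite_T)

end

section \<open>Binary forms\<close>

lemma infinite_alg_closed: "infinite (UNIV :: 'k::alg_closed_field set)"
proof
  assume fin: "finite (UNIV :: 'k set)"
  define p :: "'k poly" where "p = (\<Prod>a\<in>UNIV. [:- a, 1:])"
  have dp: "degree p = card (UNIV :: 'k set)"
    unfolding p_def by (subst degree_prod_eq_sum_degree) auto
  moreover have "card (UNIV :: 'k set) > 0" using fin by (simp add: card_gt_0_iff)
  ultimately have "degree (p + 1) = card (UNIV :: 'k set)" by (simp add: degree_add_eq_left)
  then obtain x where "poly (p + 1) x = 0" using alg_closed_imp_poly_has_root[of "p + 1"] \<open>card UNIV > 0\<close> by auto
  moreover have "poly p x = 0" unfolding p_def poly_prod using fin by (auto simp: prod_zero_iff)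
  ultimately show False by simp
qed

lemma poly_eq_0_cofinite:
  fixes p :: "'k::alg_closed_field poly"
  assumes "finite A" "\<And>t. t \<notin> A \<Longrightarrow> poly p t = 0" shows "p = 0"
proof (rule ccontr)
  assume "p \<noteq> 0"
  then have "finite {t. poly p t = 0}" by (rule poly_roots_finite)
  moreover have "UNIV \<subseteq> A \<union> {t. poly p t = 0}" using assms by auto
  ultimately show False using infinite_alg_closed assms(1) by (metis finite_Un finite_subset)
qed

lemma poly_eqI_pointwise:
  fixes p q :: "'k::alg_closed_field poly"
  assumes "\<And>t. poly p t = poly q t" shows "p = q"
  using poly_eq_0_cofinite[of "{}" "p - q"] assms by simp

lemma beval_simps [simp]:
  "beval (f + g) v = beval f v + beval g v" "beval (f * g) v = beval f v * beval g v"
  "beval (0 :: 'k::comm_semiring_1 poly poly) v = 0" "beval (1 :: 'k poly poly) v = 1" "beval [:[:c:]:] v = c"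
  by (simp_all add: beval_def)

lemma beval_ring_simps [simp]:
  fixes f g :: "'k::comm_ring_1 poly poly"
  shows "beval (f - g) v = beval f v - beval g v" "beval (- f) v = - beval f v"
  by (simp_all add: beval_def)

lemma beval_sum [simp]: "beval (\<Sum>i\<in>A. F i) v = (\<Sum>i\<in>A. beval (F i) v)"
  by (induction A rule: infinite_finite_induct) auto

lemma beval_monom: "beval (monom (monom c i) j) v = c * (v $ 0) ^ i * (v $ 1) ^ j"
  by (simp add: beval_def poly_monom)

abbreviation bcoeff :: "'k::zero poly poly \<Rightarrow> nat \<Rightarrow> nat \<Rightarrow> 'k" where
  "bcoeff f i j \<equiv> poly.coeff (poly.coeff f j) i"

lemma bform_coeff_0: "bform e f \<Longrightarrow> i + j \<noteq> e \<Longrightarrow> bcoeff f i j = 0"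
  unfolding bform_def by blast

lemma bform_decomp:
  assumes "bform e f"
  shows "f = (\<Sum>j\<le>e. monom (monom (bcoeff f (e - j) j) (e - j)) j)"
proof (rule poly_eqI, rule poly_eqI)
  fix n i
  have "bcoeff (\<Sum>j\<le>e. monom (monom (bcoeff f (e - j) j) (e - j)) j) i n =
     (\<Sum>j\<le>e. if j = n then (if e - j = i then bcoeff f (e - j) j else 0) else 0)"
    by (simp add: coeff_sum if_distrib[of "\<lambda>p. poly.coeff p i"] cong: if_cong)
  also have "\<dots> = (if n \<le> e \<and> e - n = i then bcoeff f (e - n) n else 0)" by (simp add: sum.delta)
  also have "\<dots> = bcoeff f i n"
  proof (cases "bcoeff f i n = 0")
    case False
    then have "i + n = e" using assms unfolding bform_def by blast
    then show ?thesis by auto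
  qed auto
  finally show "bcoeff f i n = bcoeff (\<Sum>j\<le>e. monom (monom (bcoeff f (e - j) j) (e - j)) j) i n" ..
qed

lemma beval_bform:
  assumes "bform e f"
  shows "beval f v = (\<Sum>j\<le>e. bcoeff f (e - j) j * (v $ 0) ^ (e - j) * (v $ 1) ^ j)"
  by (subst bform_decomp[OF assms]) (simp add: beval_monom)

lemma beval_scale:
  assumes "bform e f" "dim_vec v = 2"
  shows "beval f (c \<cdot>\<^sub>v v) = c ^ e * beval f v"
proof -
  have "bcoeff f (e - j) j * (c * v $ 0) ^ (e - j) * (c * v $ 1) ^ j =
      c ^ e * (bcoeff f (e - j) j * (v $ 0) ^ (e - j) * (v $ 1) ^ j)" if "j \<le> e" for j
  proof -
    have "c ^ e = c ^ (e - j) * c ^ j" using that by (simp add: power_add[symmetric])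
    then show ?thesis by (simp add: power_mult_distrib mult_ac)
  qed
  then show ?thesis using assms by (simp add: beval_bform[OF assms(1)] sum_distrib_left)
qed

text \<open>This is the substitution \<open>x \<mapsto> s\<close>, \<open>y \<mapsto> y s\<close> from \<open>k[x,y]\<close> to \<open>k[y][s]\<close>. The coefficient of
  \<open>s^m\<close> encodes the homogeneous part of degree \<open>m\<close>, so forms become monomials in \<open>s\<close>. As a factor of
  a monomial is a monomial, divisors of forms are forms.\<close>

definition grading :: "'k::field poly poly \<Rightarrow> 'k poly poly" where
  "grading f = poly (map_poly (map_poly (\<lambda>z. [:z:])) f) (monom [:0, 1:] 1)"

lemma lift_hom: "comm_ring_hom (\<lambda>z :: 'k::field. [:z:])"
  by unfold_locales (auto simp: one_pCons)

lemma grading_hom: "comm_ring_hom (grading :: 'k::field poly poly \<Rightarrow> _)"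
proof -
  interpret a: comm_ring_hom "\<lambda>z :: 'k. [:z:]" by (rule lift_hom)
  interpret b: map_poly_comm_ring_hom "\<lambda>z :: 'k. [:z:]" ..
  interpret c: map_poly_comm_ring_hom "map_poly (\<lambda>z :: 'k. [:z:])" ..
  show ?thesis by unfold_locales (auto simp: grading_def hom_distribs)
qed

lemma grading_mult: "grading (f * g) = grading f * grading (g :: 'k::field poly poly)"
proof -
  interpret comm_ring_hom "grading :: 'k poly poly \<Rightarrow> _" by (rule grading_hom)
  show ?thesis by (rule hom_mult)
qed

lemma coeff_grading: "poly.coeff (poly.coeff (grading f) m) j = (if j \<le> m then bcoeff f (m - j) j else (0 :: 'k::field))"
proof -
  have pw: "monom [:0, 1 :: 'k:] 1 ^ n = monom (monom 1 n) n" for n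
    by (simp add: monom_power x_as_monom x_pow_n)
  define g where "g = map_poly (map_poly (\<lambda>z. [:z:])) f"
  have cg: "poly.coeff g n = map_poly (\<lambda>z. [:z:]) (poly.coeff f n)" for n by (simp add: g_def coeff_map_poly)
  have "grading f = (\<Sum>n\<le>degree g. poly.coeff g n * monom (monom 1 n) n)"
    by (simp only: grading_def g_def[symmetric] poly_altdef pw)
  also have "\<dots> = (\<Sum>n\<le>degree f. poly.coeff g n * monom (monom 1 n) n)"
    by (rule sum.mono_neutral_left) (auto simp: g_def degree_map_poly_le coeff_eq_0 intro: order_trans[OF _ degree_map_poly_le])
  finally have "grading f = (\<Sum>n\<le>degree f. map_poly (\<lambda>z. [:z:]) (poly.coeff f n) * monom (monom 1 n) n)"
    by (simp only: cg)
  then have "poly.coeff (poly.coeff (grading f) m) j =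
     (\<Sum>n\<le>degree f. poly.coeff (poly.coeff (map_poly (\<lambda>z. [:z:]) (poly.coeff f n) * monom (monom 1 n) n) m) j)"
    by (simp add: coeff_sum)
  also have "\<dots> = (\<Sum>n\<le>degree f. if n = j then (if n \<le> m then bcoeff f (m - n) n else 0) else 0)"
  proof (rule sum.cong)
    fix n
    show "poly.coeff (poly.coeff (map_poly (\<lambda>z. [:z:]) (poly.coeff f n) * monom (monom 1 n) n) m) j =
       (if n = j then (if n \<le> m then bcoeff f (m - n) n else 0) else 0)"
      by (subst mult.commute) (auto simp: coeff_monom_mult coeff_map_poly coeff_pCons split: nat.splits)
  qed simp
  also have "\<dots> = (if j \<le> m then bcoeff f (m - j) j else 0)"
    by (auto simp: sum.delta coeff_eq_0)
  finally show ?thesis .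
qed

lemma grading_eq_0: "grading f = 0 \<longleftrightarrow> (f :: 'k::field poly poly) = 0"
proof
  assume "grading f = 0"
  then have "bcoeff f i j = 0" for i j using coeff_grading[of f "i + j" j] by simp
  then show "f = 0" by (intro poly_eqI) simp
qed (simp add: grading_def)

lemma bform_iff_grading: "bform e f \<longleftrightarrow> grading f = monom (poly.coeff (grading f) e) e" for f :: "'k::field poly poly"
proof
  assume f: "bform e f"
  show "grading f = monom (poly.coeff (grading f) e) e"
  proof (rule poly_eqI, rule poly_eqI)
    fix m j
    show "poly.coeff (poly.coeff (grading f) m) j = poly.coeff (poly.coeff (monom (poly.coeff (grading f) e) e) m) j"
      using bform_coeff_0[OF f, of "m - j" j] by (auto simp: coeff_grading)
  qed
next
  assume eq: "grading f = monom (poly.coeff (grading f) e) e"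
  show "bform e f" unfolding bform_def
  proof (intro allI impI)
    fix i j assume "bcoeff f i j \<noteq> 0"
    then have "poly.coeff (poly.coeff (grading f) (i + j)) j \<noteq> 0" by (simp add: coeff_grading)
    then have "poly.coeff (monom (poly.coeff (grading f) e) e) (i + j) \<noteq> 0" by (subst eq[symmetric]) auto
    then show "i + j = e" by (auto split: if_splits)
  qed
qed

lemma bform_grading: "bform e f \<Longrightarrow> \<exists>c. grading f = monom c e" for f :: "'k::field poly poly"
  by (intro exI) (rule iffD1[OF bform_iff_grading])

lemma grading_bform: "grading f = monom c e \<Longrightarrow> bform e f" for f :: "'k::field poly poly"
  by (simp add: bform_iff_grading)

lemma bform_mult: "bform i f \<Longrightarrow> bform j g \<Longrightarrow> bform (i + j) (f * g)" for f :: "'k::field poly poly"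
  using bform_grading[of i f] bform_grading[of j g] grading_bform[of "f * g" _ "i + j"]
  by (auto simp: grading_mult mult_monom)

lemma bform_zero [simp]: "bform e 0" by (simp add: bform_def)

lemma bform_add: "bform e f \<Longrightarrow> bform e g \<Longrightarrow> bform e (f + g)" for f :: "'k::field poly poly"
  unfolding bform_def by (metis add_0 coeff_add)

lemma bform_uminus: "bform e f \<Longrightarrow> bform e (- f)" for f :: "'k::field poly poly"
  by (simp add: bform_def)

lemma bform_diff: "bform e f \<Longrightarrow> bform e g \<Longrightarrow> bform e (f - g)" for f :: "'k::field poly poly"
  using bform_add[of e f "- g"] bform_uminus[of e g] by simp

lemma bform_const: "bform 0 [:[:c:]:]"
  by (auto simp: bform_def coeff_pCons split: nat.splits)

lemma bform_const_mult: "bform e f \<Longrightarrow> bform e ([:[:c:]:] * f)" for f :: "'k::field poly poly"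
  using bform_mult[OF bform_const, of e f c] by (simp only: add_0)

lemma bform_0_const: fixes f :: "'k::field poly poly" assumes "bform 0 f" shows "f = [:[:bcoeff f 0 0:]:]"
  using bform_decomp[OF assms] by (simp add: monom_0)

lemma bform_degree_unique:
  fixes f :: "'k::field poly poly"
  assumes "f \<noteq> 0" "bform e f" "bform e' f" shows "e = e'"
proof -
  obtain i j where "bcoeff f i j \<noteq> 0" using assms(1) by (metis leading_coeff_0_iff)
  then show ?thesis using assms by (auto simp: bform_def)
qed

text \<open>A nonzero polynomial is a monomial if and only if its degree equals its order at zero. The order is at
  most the degree and both are additive, so equality for a product forces it for the factors.\<close>

lemma monom_factor:
  fixes p q :: "'a::idom poly"
  assumes pq: "p * q = monom c e" and c: "c \<noteq> 0"
  shows "p = monom (poly.coeff p (degree p)) (degree p)"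
proof -
  have nz: "p \<noteq> 0" "q \<noteq> 0" "p * q \<noteq> 0" using assms by auto
  have "degree p + degree q = e" using pq nz c by (metis degree_mult_eq degree_monom_eq)
  moreover have "order 0 p + order 0 q = e" using pq nz c by (metis order_mult order_0_monom)
  moreover have "order 0 p \<le> degree p" "order 0 q \<le> degree q" using order_degree nz by auto
  ultimately have "order 0 p = degree p" by linarith
  then have "monom 1 (degree p) dvd p" using nz by (simp add: monom_1_dvd_iff)
  then have low: "\<forall>k<degree p. poly.coeff p k = 0" by (simp add: monom_1_dvd_iff')
  show ?thesis by (rule poly_eqI) (metis coeff_eq_0 coeff_monom linorder_neqE_nat low)
qed

lemma bform_factor:
  fixes a b :: "'k::field poly poly"
  assumes "bform e (a * b)" "a * b \<noteq> 0" shows "\<exists>i. bform i a"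
proof -
  obtain c where c: "grading a * grading b = monom c e" using bform_grading[OF assms(1)] by (auto simp: grading_mult)
  have "c \<noteq> 0" using c assms(2) grading_eq_0[of "a * b"] by (auto simp: grading_mult)
  from monom_factor[OF c this] show ?thesis using grading_bform by blast
qed

lemma bform_dvd:
  fixes f :: "'k::field poly poly"
  assumes "bform e f" "f \<noteq> 0" "a dvd f" shows "\<exists>i\<le>e. bform i a"
proof -
  obtain b where b: "f = a * b" using assms(3) by (elim dvdE)
  obtain i where i: "bform i a" using bform_factor assms b by blast
  obtain j where j: "bform j b" using bform_factor[of e b a] assms b by (auto simp: mult.commute)
  have "e = i + j" using bform_degree_unique[OF assms(2,1)] bform_mult[OF i j] b by simp
  then show ?thesis using i by (intro exI[of _ i]) simp
qed

lemma bform_cofactor: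
  fixes a b :: "'k::field poly poly"
  assumes "bform e (a * b)" "a \<noteq> 0" "bform i a" shows "bform (e - i) b"
proof (cases "b = 0")
  case False
  obtain j where j: "bform j b" using bform_factor[of e b a] assms False by (auto simp: mult.commute)
  have "e = i + j" using bform_degree_unique[OF _ assms(1)] bform_mult[OF assms(3) j] assms False by simp
  then show ?thesis using j by simp
qed simp

lemma total_degree_bform:
  fixes f :: "'k::field poly poly"
  assumes "bform e f" "f \<noteq> 0" shows "total_degree f = e"
proof -
  obtain i j where ij: "bcoeff f i j \<noteq> 0" using assms(2) by (metis leading_coeff_0_iff)
  then have "{i + j | i j. bcoeff f i j \<noteq> 0} = {e}" using assms(1) by (auto simp: bform_def)
  then show ?thesis by (simp add: total_degree_def)
qed

text \<open>The linear form \<open>w\<^sub>1 x - w\<^sub>0 y\<close>, whose only zero on the projective line is \<open>w\<close>.\<close>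

definition lform :: "'k::field vec \<Rightarrow> 'k poly poly" where
  "lform w = [:[:0, w $ 1:], [:- (w $ 0):]:]"

lemma bform_lform: "bform 1 (lform w)"
  by (auto simp: bform_def lform_def coeff_pCons split: nat.splits)

lemma beval_lform: "beval (lform w) v = w $ 1 * v $ 0 - w $ 0 * v $ 1"
  by (simp add: beval_def lform_def algebra_simps)

lemma vec2_eq_iff: "v \<in> carrier_vec 2 \<Longrightarrow> w \<in> carrier_vec 2 \<Longrightarrow> v = w \<longleftrightarrow> v $ 0 = w $ 0 \<and> v $ 1 = w $ 1"
  by (auto intro!: eq_vecI simp: less_2_cases_iff)

lemma vec2_nonzero: "w \<in> carrier_vec 2 \<Longrightarrow> w \<noteq> 0\<^sub>v 2 \<longleftrightarrow> w $ 0 \<noteq> 0 \<or> w $ 1 \<noteq> 0"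
  by (subst vec2_eq_iff) auto

lemma vec_of_list_2: "vec_of_list [a, b] \<in> carrier_vec 2" "vec_of_list [a, b] $ 0 = a" "vec_of_list [a, b] $ 1 = b"
  by (simp_all add: carrier_vecI)

lemma lform_nonzero: "w \<in> carrier_vec 2 \<Longrightarrow> w \<noteq> 0\<^sub>v 2 \<Longrightarrow> lform w \<noteq> 0"
  by (auto simp: vec2_nonzero lform_def)

text \<open>If \<open>w\<^sub>0 \<noteq> 0\<close>, substituting \<open>y = (w\<^sub>1/w\<^sub>0) x\<close> turns \<open>f\<close> into a multiple of \<open>f(w)\<close>, hence into
  zero, and \<open>y - (w\<^sub>1/w\<^sub>0) x\<close> splits off. If \<open>w\<^sub>0 = 0\<close>, the coefficient of the pure power of \<open>y\<close>
  vanishes, so that \<open>x\<close> divides \<open>f\<close>.\<close>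

lemma lform_dvd:
  fixes f :: "'k::field poly poly"
  assumes f: "bform e f" and w: "w \<in> carrier_vec 2" "w \<noteq> 0\<^sub>v 2" and root: "beval f w = 0"
  shows "lform w dvd f"
proof (cases "w $ 0 = 0")
  case False
  define r where "r = w $ 1 / w $ 0"
  have pw: "[:0, r:] ^ j = monom (r ^ j) j" for j
  proof -
    have "[:0, r:] = monom r 1" by (simp add: monom_Suc monom_0)
    then show ?thesis by (simp add: monom_power)
  qed
  have "poly f [:0, r:] = poly (\<Sum>j\<le>e. monom (monom (bcoeff f (e - j) j) (e - j)) j) [:0, r:]"
    using bform_decomp[OF f] by (rule arg_cong)
  also have "\<dots> = (\<Sum>j\<le>e. monom (bcoeff f (e - j) j) (e - j) * monom (r ^ j) j)"
    by (simp add: poly_sum poly_monom pw)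
  also have "\<dots> = (\<Sum>j\<le>e. monom (bcoeff f (e - j) j * r ^ j) e)"
    by (intro sum.cong) (auto simp: mult_monom)
  also have "\<dots> = monom (\<Sum>j\<le>e. bcoeff f (e - j) j * r ^ j) e" by (simp add: monom_sum)
  finally have 1: "poly f [:0, r:] = monom (\<Sum>j\<le>e. bcoeff f (e - j) j * r ^ j) e" .
  have "beval f w = (w $ 0) ^ e * (\<Sum>j\<le>e. bcoeff f (e - j) j * r ^ j)"
    unfolding beval_bform[OF f] sum_distrib_left
  proof (rule sum.cong)
    fix j assume "j \<in> {..e}"
    then have "(w $ 0) ^ e = (w $ 0) ^ (e - j) * (w $ 0) ^ j" by (simp add: power_add[symmetric])
    moreover have "w $ 1 = w $ 0 * r" using False by (simp add: r_def)
    ultimately show "bcoeff f (e - j) j * w $ 0 ^ (e - j) * w $ 1 ^ j = w $ 0 ^ e * (bcoeff f (e - j) j * r ^ j)"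
      by (simp add: power_mult_distrib mult_ac)
  qed simp
  then have "poly f [:0, r:] = 0" using 1 root False by simp
  then have "[:- [:0, r:], 1:] dvd f" by (simp add: poly_eq_0_iff_dvd)
  moreover have "[:- [:0, r:], 1:] = lform w * [:[:- 1 / w $ 0:]:]" using False by (simp add: lform_def r_def one_pCons)
  ultimately have "lform w * [:[:- 1 / w $ 0:]:] dvd f" by (simp only:)
  then show ?thesis by (rule dvd_mult_left)
next
  case True
  then have w1: "w $ 1 \<noteq> 0" using w vec2_nonzero by auto
  have "beval f w = (\<Sum>j\<le>e. if j = e then bcoeff f (e - j) j * (w $ 1) ^ j else 0)"
    unfolding beval_bform[OF f] by (rule sum.cong) (auto simp: True)
  then have c0: "bcoeff f 0 e = 0" using root w1 by simp
  have "[:0, w $ 1:] dvd poly.coeff f j" for j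
  proof -
    have "poly.coeff (poly.coeff f j) 0 = 0" using bform_coeff_0[OF f, of 0 j] c0 by (cases "j = e") auto
    then have "poly (poly.coeff f j) 0 = 0" by (simp add: poly_0_coeff_0)
    then have "[:0, 1:] dvd poly.coeff f j" using poly_eq_0_iff_dvd[of "poly.coeff f j" 0] by simp
    moreover have "[:0, 1:] = [:0, w $ 1:] * [:1 / w $ 1:]" using w1 by simp
    ultimately have "[:0, w $ 1:] * [:1 / w $ 1:] dvd poly.coeff f j" by (simp only:)
    then show ?thesis by (rule dvd_mult_left)
  qed
  then have "[:[:0, w $ 1:]:] dvd f" by (simp add: const_poly_dvd_iff)
  then show ?thesis using True by (simp add: lform_def)
qed

text \<open>Dehomogenize by \<open>x = 1\<close>. If the resulting polynomial is constant, then \<open>f\<close> has no pure power of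
  \<open>y\<close> and vanishes at \<open>(0,1)\<close>.\<close>

lemma bform_root:
  fixes f :: "'k::alg_closed_field poly poly"
  assumes f: "bform e f" and e: "e > 0"
  obtains w where "w \<in> carrier_vec 2" "w \<noteq> 0\<^sub>v 2" "beval f w = 0"
proof -
  define p where "p = (\<Sum>j\<le>e. monom (bcoeff f (e - j) j) j)"
  have cp: "poly.coeff p j = (if j \<le> e then bcoeff f (e - j) j else 0)" for j
    by (simp add: p_def coeff_sum)
  show thesis
  proof (cases "degree p > 0")
    case True
    then obtain r where r: "poly p r = 0" using alg_closed_imp_poly_has_root by blast
    define w where "w = vec_of_list [1, r]"
    have "beval f w = 0" using r unfolding beval_bform[OF f] by (simp add: w_def p_def poly_sum poly_monom)
    then show thesis using that[of w] vec_of_list_2[of 1 r] by (simp add: w_def vec2_nonzero del: vec_of_list_Cons)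
  next
    case False
    then have "poly.coeff p e = 0" using e by (simp add: coeff_eq_0)
    then have c0: "bcoeff f 0 e = 0" using cp[of e] by simp
    define w where "w = vec_of_list [0, 1 :: 'k]"
    have "beval f w = (\<Sum>j\<le>e. if j = e then bcoeff f (e - j) j else 0)"
      unfolding beval_bform[OF f] by (rule sum.cong) (auto simp: w_def)
    then have "beval f w = 0" using c0 by simp
    then show thesis using that[of w] vec_of_list_2[of 0 "1 :: 'k"] by (simp add: w_def vec2_nonzero del: vec_of_list_Cons)
  qed
qed

lemma lform_not_unit: "\<not> lform w dvd 1"
proof
  assume "lform w dvd 1"
  then obtain u where u: "1 = lform w * u" by (elim dvdE)
  have "beval 1 w = beval (lform w * u) w" by (rule arg_cong[OF u])
  then show False by (simp add: beval_lform)
qed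

text \<open>Linear factors of \<open>E\<close> are split off one by one. At a root \<open>w\<close> of \<open>E\<close> some \<open>f \<in> F\<close> is nonzero,
  hence \<open>H\<close> vanishes at \<open>w\<close>, and the linear form at \<open>w\<close> cancels from \<open>E\<close> and \<open>H\<close>.\<close>

lemma dvd_cancel_no_common_zero:
  fixes E H :: "'k::alg_closed_field poly poly"
  assumes "bform i E" "E \<noteq> 0" "bform j H"
    and nz: "\<And>w. w \<in> carrier_vec 2 \<Longrightarrow> w \<noteq> 0\<^sub>v 2 \<Longrightarrow> \<exists>f\<in>F. beval f w \<noteq> 0"
    and dvd: "\<And>f. f \<in> F \<Longrightarrow> E dvd H * f"
  shows "E dvd H"
  using assms(1-3) dvd
proof (induction i arbitrary: E H j)
  case 0
  define c where "c = bcoeff E 0 0"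
  have E: "E = [:[:c:]:]" using bform_0_const[OF 0(1)] by (simp add: c_def)
  then have "c \<noteq> 0" using 0(2) by auto
  then have "E * [:[:1 / c:]:] = 1" using E by (simp add: one_pCons)
  then show ?case by (metis dvd_triv_left dvd_trans one_dvd)
next
  case (Suc i)
  show ?case
  proof (cases "H = 0")
    case False
    obtain w where w: "w \<in> carrier_vec 2" "w \<noteq> 0\<^sub>v 2" "beval E w = 0" using bform_root[OF Suc(2) zero_less_Suc] by blast
    obtain E' where E': "E = lform w * E'" using lform_dvd[OF Suc(2) w] by (elim dvdE)
    obtain f where f: "f \<in> F" "beval f w \<noteq> 0" using nz w by auto
    have "beval H w * beval f w = 0" using Suc(5)[OF f(1)] w(3) by (metis beval_simps(2) dvdE mult_zero_left)
    then have "beval H w = 0" using f by simp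
    from lform_dvd[OF Suc(4) w(1,2) this] obtain H' where H': "H = lform w * H'" by (elim dvdE)
    have l0: "lform w \<noteq> 0" using lform_nonzero w by auto
    have "E' dvd H'"
    proof (rule Suc.IH)
      show "bform i E'" using bform_cofactor[OF Suc(2)[unfolded E'] l0 bform_lform] by simp
      show "E' \<noteq> 0" using E' Suc(3) by auto
      show "bform (j - 1) H'" using bform_cofactor[OF Suc(4)[unfolded H'] l0 bform_lform] by simp
      show "E' dvd H' * f" if "f \<in> F" for f
        using Suc(5)[OF that] l0 unfolding E' H' by (simp add: mult.assoc)
    qed
    then show ?thesis unfolding E' H' by (intro mult_dvd_mono) auto
  qed simp
qed

text \<open>A form \<open>H\<close> of maximal degree among the common divisors is a greatest one: the quotients of \<open>F\<close> by
  \<open>H\<close> have no common zero, because the linear form at such a zero could be multiplied to \<open>H\<close>; now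
  \<open>dvd_cancel_no_common_zero\<close> applies to any common divisor.\<close>

lemma bform_gcd_exists:
  fixes F :: "'k::alg_closed_field poly poly set"
  assumes F: "\<And>f. f \<in> F \<Longrightarrow> bform e f" and f0: "f0 \<in> F" "f0 \<noteq> 0"
  shows "\<exists>h. is_gcd_of h F"
proof -
  define S where "S = {i. \<exists>E. bform i E \<and> (\<forall>f\<in>F. E dvd f)}"
  have "i \<le> e" if iS: "i \<in> S" for i
  proof -
    obtain E where E: "bform i E" "E dvd f0" using iS f0 by (auto simp: S_def)
    obtain i' where "i' \<le> e" "bform i' E" using bform_dvd[OF F[OF f0(1)] f0(2) E(2)] by blast
    moreover have "E \<noteq> 0" using E f0 by auto
    ultimately show ?thesis using bform_degree_unique E by blast
  qed
  then have "finite S" by (meson finite_nat_set_iff_bounded_le)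
  moreover have "0 \<in> S" using bform_const[of 1] by (auto simp: S_def one_pCons[symmetric])
  ultimately have max: "Max S \<in> S" "\<And>i. i \<in> S \<Longrightarrow> i \<le> Max S" by (auto intro: Max_in)
  then obtain H where H: "bform (Max S) H" "\<And>f. f \<in> F \<Longrightarrow> H dvd f" by (auto simp: S_def)
  have H0: "H \<noteq> 0" using H f0 by auto
  define F' where "F' = {f'. H * f' \<in> F}"
  have nz: "\<exists>f\<in>F'. beval f w \<noteq> 0" if w: "w \<in> carrier_vec 2" "w \<noteq> 0\<^sub>v 2" for w
  proof (rule ccontr)
    assume "\<not> ?thesis"
    then have z: "\<And>f. f \<in> F' \<Longrightarrow> beval f w = 0" by auto
    have "H * lform w dvd f" if f: "f \<in> F" for f
    proof -
      obtain f' where f': "f = H * f'" using H(2)[OF f] by (elim dvdE)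
      have "bform (e - Max S) f'" using bform_cofactor[OF F[OF f, unfolded f'] H0 H(1)] .
      moreover have "beval f' w = 0" using z f f' by (auto simp: F'_def)
      ultimately have "lform w dvd f'" using lform_dvd w by blast
      then show ?thesis unfolding f' by (intro mult_dvd_mono) auto
    qed
    then have "Max S + 1 \<in> S" using bform_mult[OF H(1) bform_lform[of w]] by (auto simp: S_def)
    then show False using max(2) by fastforce
  qed
  have "E dvd H" if E: "\<forall>f\<in>F. E dvd f" for E
  proof -
    obtain i where i: "bform i E" using bform_dvd[OF F[OF f0(1)] f0(2)] E f0 by blast
    have E0: "E \<noteq> 0" using E f0 by auto
    show ?thesis
      by (rule dvd_cancel_no_common_zero[OF i E0 H(1), of F']) (use nz E in \<open>auto simp: F'_def\<close>)
  qed
  then show ?thesis using H by (auto simp: is_gcd_of_def)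
qed

text \<open>If all quotients vanished at \<open>w\<close>, the linear form at \<open>w\<close> could be multiplied to the greatest
  common divisor.\<close>

lemma bform_gcd_quotient_nonzero:
  fixes F :: "'k::alg_closed_field poly poly set"
  assumes F: "\<And>f. f \<in> F \<Longrightarrow> bform e f" and f0: "f0 \<in> F" "f0 \<noteq> 0" and h: "is_gcd_of h F"
    and w: "w \<in> carrier_vec 2" "w \<noteq> 0\<^sub>v 2"
  shows "\<exists>f'. h * f' \<in> F \<and> beval f' w \<noteq> 0"
proof (rule ccontr)
  assume "\<not> ?thesis"
  then have z: "\<And>f'. h * f' \<in> F \<Longrightarrow> beval f' w = 0" by auto
  have hd: "\<And>f. f \<in> F \<Longrightarrow> h dvd f" using h by (auto simp: is_gcd_of_def)
  have h0: "h \<noteq> 0" using hd f0 by auto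
  obtain i where i: "bform i h" using bform_dvd[OF F[OF f0(1)] f0(2)] hd f0 by blast
  have "h * lform w dvd f" if f: "f \<in> F" for f
  proof -
    obtain f' where f': "f = h * f'" using hd[OF f] by (elim dvdE)
    have "bform (e - i) f'" using bform_cofactor[OF F[OF f, unfolded f'] h0 i] .
    moreover have "beval f' w = 0" using z f f' by auto
    ultimately have "lform w dvd f'" using lform_dvd w by blast
    then show ?thesis unfolding f' by (intro mult_dvd_mono) auto
  qed
  then have "h * lform w dvd h * 1" using h by (auto simp: is_gcd_of_def)
  then have "lform w dvd 1" using h0 by (simp only: dvd_mult_cancel_left) simp
  then show False using lform_not_unit by blast
qed

section \<open>Affine charts of the projective line\<close>

lemma sum_order_eq_degree:
  fixes p :: "'k::alg_closed_field poly"
  assumes "p \<noteq> 0" "finite T" "\<And>t. poly p t = 0 \<Longrightarrow> t \<in> T"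
  shows "(\<Sum>t\<in>T. order t p) = degree p"
  using assms
proof (induction "degree p" arbitrary: p)
  case 0
  then obtain c where c: "p = [:c:]" "c \<noteq> 0" by (metis degree_eq_zeroE pCons_0_0)
  then show ?case by (simp add: order_0I)
next
  case (Suc n)
  then obtain x where x: "poly p x = 0" using alg_closed_imp_poly_has_root[of p] by auto
  then obtain q where q: "p = [:- x, 1:] * q" unfolding poly_eq_0_iff_dvd by (elim dvdE)
  have q0: "q \<noteq> 0" using q Suc by auto
  have "degree p = Suc (degree q)" unfolding q using q0 by (subst degree_mult_eq) auto
  then have "n = degree q" using Suc by simp
  have IH: "(\<Sum>t\<in>T. order t q) = degree q"
    by (rule Suc.hyps(1)) (use q0 q Suc \<open>n = degree q\<close> in auto)
  have ord: "order t p = (if t = x then 1 else 0) + order t q" for t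
  proof -
    have "order t [:- x, 1:] = (if t = x then 1 else 0)"
      using order_power_n_n[of x 1] by (auto intro: order_0I)
    then show ?thesis using Suc(3) unfolding q by (subst order_mult) auto
  qed
  have "x \<in> T" using x Suc by auto
  then show ?case using IH Suc(4) \<open>degree p = Suc (degree q)\<close> by (simp add: ord sum.distrib)
qed

lemma const_inverse: "c \<noteq> 0 \<Longrightarrow> [:[:c:]:] * [:[:1 / c:]:] = (1 :: 'k::field poly poly)"
  by (simp add: one_pCons)

text \<open>An affine coordinate on the projective line: \<open>t\<close> stands for the point \<open>\<gamma> + t \<eta>\<close>, and \<open>\<eta>\<close> is the
  point at infinity. The choice of \<open>\<eta>\<close> is left free in order to keep a given fibre away from
  infinity.\<close>

locale chart =
  fixes \<gamma> \<eta> :: "'k::alg_closed_field vec"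
  assumes \<gamma>: "\<gamma> \<in> carrier_vec 2" and \<eta>: "\<eta> \<in> carrier_vec 2" and det: "\<gamma> $ 0 * \<eta> $ 1 - \<gamma> $ 1 * \<eta> $ 0 = 1"
begin

definition cpt :: "'k \<Rightarrow> 'k vec" where "cpt t = \<gamma> + t \<cdot>\<^sub>v \<eta>"

lemma cpt_index: "cpt t $ 0 = \<gamma> $ 0 + t * \<eta> $ 0" "cpt t $ 1 = \<gamma> $ 1 + t * \<eta> $ 1"
  using \<gamma> \<eta> by (auto simp: cpt_def)

lemma cpt_carrier: "cpt t \<in> carrier_vec 2" using \<gamma> \<eta> by (simp add: cpt_def)

lemma cpt_det: "cpt s $ 0 * cpt t $ 1 - cpt s $ 1 * cpt t $ 0 = t - s"
proof -
  have "cpt s $ 0 * cpt t $ 1 - cpt s $ 1 * cpt t $ 0 = (t - s) * (\<gamma> $ 0 * \<eta> $ 1 - \<gamma> $ 1 * \<eta> $ 0)"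
    unfolding cpt_index by (simp add: algebra_simps)
  then show ?thesis unfolding det by simp
qed

lemma cpt_nonzero: "cpt t \<noteq> 0\<^sub>v 2"
proof
  assume "cpt t = 0\<^sub>v 2"
  then show False using cpt_det[of t "t + 1"] by simp
qed

lemma \<eta>_nonzero: "\<eta> \<noteq> 0\<^sub>v 2" using det by (auto simp: vec2_nonzero[OF \<eta>])

lemma chart_points:
  assumes w: "w \<in> carrier_vec 2" "w \<noteq> 0\<^sub>v 2"
  shows "(\<exists>c. c \<noteq> 0 \<and> w = c \<cdot>\<^sub>v \<eta>) \<or> (\<exists>c t. c \<noteq> 0 \<and> w = c \<cdot>\<^sub>v cpt t)"
proof -
  define a where "a = w $ 0 * \<eta> $ 1 - w $ 1 * \<eta> $ 0"
  define b where "b = \<gamma> $ 0 * w $ 1 - \<gamma> $ 1 * w $ 0"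
  have "a * \<gamma> $ 0 + b * \<eta> $ 0 = w $ 0 * (\<gamma> $ 0 * \<eta> $ 1 - \<gamma> $ 1 * \<eta> $ 0)" unfolding a_def b_def by (simp add: algebra_simps)
  then have 0: "w $ 0 = a * \<gamma> $ 0 + b * \<eta> $ 0" unfolding det by simp
  have "a * \<gamma> $ 1 + b * \<eta> $ 1 = w $ 1 * (\<gamma> $ 0 * \<eta> $ 1 - \<gamma> $ 1 * \<eta> $ 0)" unfolding a_def b_def by (simp add: algebra_simps)
  then have 1: "w $ 1 = a * \<gamma> $ 1 + b * \<eta> $ 1" unfolding det by simp
  show ?thesis
  proof (cases "a = 0")
    case True
    then have "w = b \<cdot>\<^sub>v \<eta>" unfolding vec2_eq_iff[OF w(1) iffD2[OF smult_carrier_vec \<eta>]] using \<eta> 0 1 by simp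
    moreover have "b \<noteq> 0" using calculation w \<eta> by auto
    ultimately show ?thesis by blast
  next
    case False
    have "w = a \<cdot>\<^sub>v cpt (b / a)" unfolding vec2_eq_iff[OF w(1) iffD2[OF smult_carrier_vec cpt_carrier]]
      using 0 1 False cpt_carrier[of "b / a"] by (simp add: cpt_index[unfolded One_nat_def] algebra_simps)
    then show ?thesis using False by blast
  qed
qed

text \<open>The polynomial function \<open>t \<mapsto> f(\<gamma> + t \<eta>)\<close>.\<close>

definition dehom :: "'k poly poly \<Rightarrow> 'k poly" where
  "dehom f = (\<Sum>j\<le>degree f. (poly.coeff f j \<circ>\<^sub>p [:\<gamma> $ 0, \<eta> $ 0:]) * [:\<gamma> $ 1, \<eta> $ 1:] ^ j)"

lemma poly_dehom: "poly (dehom f) t = beval f (cpt t)"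
  by (simp add: dehom_def beval_def poly_sum poly_pcompose cpt_index[unfolded One_nat_def] poly_altdef[of f])

lemma dehom_simps [simp]: "dehom (f * g) = dehom f * dehom g" "dehom (f + g) = dehom f + dehom g"
  "dehom (f - g) = dehom f - dehom g" "dehom [:[:c:]:] = [:c:]" "dehom 0 = 0"
  by (rule poly_eqI_pointwise; simp add: poly_dehom)+

lemma dehom_bform:
  assumes "bform e f"
  shows "dehom f = (\<Sum>j\<le>e. Polynomial.smult (bcoeff f (e - j) j) ([:\<gamma> $ 0, \<eta> $ 0:] ^ (e - j) * [:\<gamma> $ 1, \<eta> $ 1:] ^ j))"
  by (rule poly_eqI_pointwise) (simp add: poly_dehom beval_bform[OF assms] poly_sum cpt_index[unfolded One_nat_def] mult.assoc)

lemma degree_linear_power: "degree ([:a, b:] ^ n) \<le> n" for a b :: 'k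
  by (rule order_trans[OF degree_power_le]) auto

lemma coeff_mult_top:
  fixes p q :: "'k poly"
  assumes "degree p \<le> a" "degree q \<le> b"
  shows "poly.coeff (p * q) (a + b) = poly.coeff p a * poly.coeff q b"
proof -
  have "poly.coeff (p * q) (a + b) = (\<Sum>i\<le>a + b. if i = a then poly.coeff p a * poly.coeff q b else 0)"
    unfolding coeff_mult
  proof (rule sum.cong)
    fix i assume "i \<in> {..a + b}"
    show "poly.coeff p i * poly.coeff q (a + b - i) = (if i = a then poly.coeff p a * poly.coeff q b else 0)"
    proof (cases i a rule: linorder_cases)
      case less then have "poly.coeff q (a + b - i) = 0" using assms by (intro coeff_eq_0) auto
      then show ?thesis using less by simp
    next
      case greater then have "poly.coeff p i = 0" using assms by (intro coeff_eq_0) auto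
      then show ?thesis using greater by simp
    qed simp
  qed simp
  then show ?thesis by simp
qed

lemma coeff_linear_power: "poly.coeff ([:a, b:] ^ n) n = b ^ n" for a b :: 'k
proof (induction n)
  case (Suc n)
  have "poly.coeff ([:a, b:] * [:a, b:] ^ n) (1 + n) = b * b ^ n"
    using Suc coeff_mult_top[of "[:a, b:]" 1 "[:a, b:] ^ n" n] degree_linear_power by simp
  then show ?case by simp
qed simp

lemma degree_dehom: assumes "bform e f" shows "degree (dehom f) \<le> e"
  unfolding dehom_bform[OF assms]
proof (rule degree_sum_le)
  fix j assume j: "j \<in> {..e}"
  have "degree ([:\<gamma> $ 0, \<eta> $ 0:] ^ (e - j) * [:\<gamma> $ 1, \<eta> $ 1:] ^ j) \<le> (e - j) + j"
    by (rule order_trans[OF degree_mult_le]) (intro add_mono degree_linear_power)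
  then show "degree (Polynomial.smult (bcoeff f (e - j) j) ([:\<gamma> $ 0, \<eta> $ 0:] ^ (e - j) * [:\<gamma> $ 1, \<eta> $ 1:] ^ j)) \<le> e"
    using j by (intro order_trans[OF degree_smult_le]) simp
qed simp

text \<open>The degree drops exactly if \<open>f\<close> vanishes at infinity.\<close>

lemma coeff_dehom: assumes "bform e f" shows "poly.coeff (dehom f) e = beval f \<eta>"
proof -
  have "poly.coeff ([:\<gamma> $ 0, \<eta> $ 0:] ^ (e - j) * [:\<gamma> $ 1, \<eta> $ 1:] ^ j) e = \<eta> $ 0 ^ (e - j) * \<eta> $ 1 ^ j" if "j \<le> e" for j
    using coeff_mult_top[OF degree_linear_power degree_linear_power, of "\<gamma> $ 0" "\<eta> $ 0" "e - j" "\<gamma> $ 1" "\<eta> $ 1" j] that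
    by (simp add: coeff_linear_power)
  then show ?thesis unfolding dehom_bform[OF assms] beval_bform[OF assms]
    by (simp add: coeff_sum mult.assoc)
qed

lemma dehom_lform: "dehom (lform (cpt t)) = [:- t, 1:] * [:- 1:]"
  by (rule poly_eqI_pointwise) (use cpt_det in \<open>simp add: poly_dehom beval_lform algebra_simps\<close>)

lemma dehom_eq_0: "bform e f \<Longrightarrow> dehom f = 0 \<Longrightarrow> f = 0"
proof (induction e arbitrary: f)
  case 0
  then show ?case using bform_0_const[OF 0(1)] by (metis dehom_simps(4) pCons_eq_0_iff)
next
  case (Suc e)
  have "beval f (cpt 0) = 0" using Suc poly_dehom[of f 0] by simp
  from lform_dvd[OF Suc(2) cpt_carrier cpt_nonzero this] obtain f' where f': "f = lform (cpt 0) * f'" by (elim dvdE)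
  have l0: "lform (cpt 0) \<noteq> 0" using lform_nonzero cpt_carrier cpt_nonzero by blast
  have b: "bform e f'" using bform_cofactor[OF Suc(2)[unfolded f'] l0 bform_lform] by simp
  have "dehom (lform (cpt 0)) * dehom f' = 0" using Suc(3) unfolding f' by simp
  then have "dehom f' = 0" unfolding dehom_lform by simp
  then show ?case using Suc.IH[OF b] f' by simp
qed

lemma linear_factors_eq:
  assumes h: "bform i h" "h \<noteq> 0" and \<eta>0: "beval h \<eta> \<noteq> 0"
  shows "l \<in> linear_factors h \<longleftrightarrow> (\<exists>t c. c \<noteq> 0 \<and> poly (dehom h) t = 0 \<and> l = lform (cpt t) * [:[:c:]:])"
proof
  assume l: "l \<in> linear_factors h"
  then have ldvd: "l dvd h" by (simp add: linear_factors_def)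
  obtain j where j: "bform j l" using bform_dvd[OF h ldvd] by blast
  have l0: "l \<noteq> 0" using ldvd h by auto
  have "j = 1" using total_degree_bform[OF j l0] l by (simp add: linear_factors_def)
  then have l1: "bform 1 l" using j by simp
  obtain w where w: "w \<in> carrier_vec 2" "w \<noteq> 0\<^sub>v 2" "beval l w = 0" by (rule bform_root[OF l1]) auto
  obtain h' where h': "h = l * h'" using ldvd by (elim dvdE)
  consider c where "c \<noteq> 0" "w = c \<cdot>\<^sub>v \<eta>" | c t where "c \<noteq> 0" "w = c \<cdot>\<^sub>v cpt t" using chart_points[OF w(1,2)] by blast
  then show "\<exists>t c. c \<noteq> 0 \<and> poly (dehom h) t = 0 \<and> l = lform (cpt t) * [:[:c:]:]"
  proof cases
    case 1
    then have "beval l \<eta> = 0" using w(3) beval_scale[OF l1, of \<eta> c] \<eta> by simp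
    then show ?thesis using \<eta>0 h' by simp
  next
    case 2
    have lt: "beval l (cpt t) = 0" using 2 w(3) beval_scale[OF l1, of "cpt t" c] cpt_carrier[of t] by simp
    obtain u where u: "l = lform (cpt t) * u" using lform_dvd[OF l1 cpt_carrier cpt_nonzero lt] by (elim dvdE)
    have "bform 0 u" using bform_cofactor[OF l1[unfolded u] _ bform_lform] lform_nonzero[OF cpt_carrier cpt_nonzero] by simp
    then have uc: "u = [:[:bcoeff u 0 0:]:]" by (rule bform_0_const)
    moreover have "bcoeff u 0 0 \<noteq> 0" using uc u l0 by auto
    moreover have "poly (dehom h) t = 0" using lt h' by (simp add: poly_dehom)
    ultimately show ?thesis using u by metis
  qed
next
  assume "\<exists>t c. c \<noteq> 0 \<and> poly (dehom h) t = 0 \<and> l = lform (cpt t) * [:[:c:]:]"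
  then obtain t c where c: "c \<noteq> 0" "poly (dehom h) t = 0" "l = lform (cpt t) * [:[:c:]:]" by blast
  have l0: "lform (cpt t) \<noteq> 0" using lform_nonzero[OF cpt_carrier cpt_nonzero] .
  have "bform 1 l" unfolding c(3) using bform_mult[OF bform_lform bform_const, of "cpt t" c] by simp
  moreover have "l \<noteq> 0" using c l0 by simp
  ultimately have "total_degree l = 1" by (rule total_degree_bform)
  moreover have "l dvd h"
  proof -
    have "lform (cpt t) dvd h" using lform_dvd[OF h(1) cpt_carrier cpt_nonzero] c(2) by (simp add: poly_dehom)
    then obtain h' where "h = lform (cpt t) * h'" by (elim dvdE)
    then have "h = lform (cpt t) * ([:[:c:]:] * [:[:1 / c:]:]) * h'" by (simp only: const_inverse[OF c(1)] mult_1_right)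
    then have "h = l * ([:[:1 / c:]:] * h')" unfolding c(3) by (simp only: mult.assoc)
    then show ?thesis by (rule dvdI)
  qed
  ultimately show "l \<in> linear_factors h" by (simp add: linear_factors_def)
qed

text \<open>As \<open>h\<close> does not vanish at infinity, its linear factors are, up to constants, the linear forms at
  the roots of its dehomogenization.\<close>

lemma card_linear_factors:
  assumes h: "bform i h" "h \<noteq> 0" and \<eta>0: "beval h \<eta> \<noteq> 0"
  shows "card (linear_factors h // associated_rel) = card {t. poly (dehom h) t = 0}"
proof -
  define F where "F t = associated_rel `` {lform (cpt t)}" for t
  have cls: "associated_rel `` {lform (cpt t) * [:[:c:]:]} = F t" if "c \<noteq> 0" for c t
  proof -
    have "lform (cpt t) = (lform (cpt t) * [:[:c:]:]) * [:[:1 / c:]:]"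
      by (simp only: mult.assoc const_inverse[OF that] mult_1_right)
    then have 1: "lform (cpt t) * [:[:c:]:] dvd lform (cpt t)" by (rule dvdI)
    have 2: "lform (cpt t) dvd lform (cpt t) * [:[:c:]:]" by (rule dvd_triv_left)
    show ?thesis unfolding F_def associated_rel_def using 1 2 dvd_trans by blast
  qed
  have "linear_factors h // associated_rel = (\<lambda>l. associated_rel `` {l}) ` linear_factors h"
    by (auto simp: quotient_def)
  also have "\<dots> = F ` {t. poly (dehom h) t = 0}"
  proof (intro equalityI image_subsetI)
    fix l assume "l \<in> linear_factors h"
    then obtain t c where tc: "c \<noteq> 0" "poly (dehom h) t = 0" "l = lform (cpt t) * [:[:c:]:]"
      using linear_factors_eq[OF h \<eta>0] by blast
    show "associated_rel `` {l} \<in> F ` {t. poly (dehom h) t = 0}"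
      unfolding tc(3) cls[OF tc(1)] using tc(2) by blast
  next
    fix t assume "t \<in> {t. poly (dehom h) t = 0}"
    then have "lform (cpt t) * [:[:1:]:] \<in> linear_factors h"
      unfolding linear_factors_eq[OF h \<eta>0] using one_neq_zero by blast
    then have "associated_rel `` {lform (cpt t) * [:[:1:]:]} \<in> (\<lambda>l. associated_rel `` {l}) ` linear_factors h"
      by (rule imageI)
    then show "F t \<in> (\<lambda>l. associated_rel `` {l}) ` linear_factors h"
      unfolding cls[OF one_neq_zero] .
  qed
  finally have "linear_factors h // associated_rel = F ` {t. poly (dehom h) t = 0}" .
  moreover have "inj F"
  proof (rule injI)
    fix s t assume eq: "F s = F t"
    have "lform (cpt t) \<in> F s" unfolding eq by (simp add: F_def associated_rel_def)
    then have "lform (cpt s) dvd lform (cpt t)" unfolding F_def associated_rel_def by simp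
    then obtain u where u: "lform (cpt t) = lform (cpt s) * u" by (elim dvdE)
    have "beval (lform (cpt t)) (cpt s) = 0" unfolding u by (simp add: beval_lform)
    then show "s = t" using cpt_det[of s t] by (simp add: beval_lform algebra_simps)
  qed
  then have "inj_on F {t. poly (dehom h) t = 0}" by (rule inj_on_subset) simp
  ultimately show ?thesis by (simp add: card_image)
qed

lemma degree_dehom_eq:
  assumes h: "bform i h" and \<eta>0: "beval h \<eta> \<noteq> 0" shows "degree (dehom h) = i"
  using degree_dehom[OF h] coeff_dehom[OF h] \<eta>0 by (metis antisym le_degree)

end

section \<open>Ideals of height two have no common zero\<close>

lemma degree_grading_lform: "w \<in> carrier_vec 2 \<Longrightarrow> w \<noteq> 0\<^sub>v 2 \<Longrightarrow> degree (grading (lform w)) = 1"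
  using bform_iff_grading[of 1 "lform w"] bform_lform[of w] grading_eq_0[of "lform w"] lform_nonzero[of w]
  by (metis degree_monom_eq monom_eq_0)

lemma lform_prime:
  fixes w :: "'k::field vec"
  assumes w: "w \<in> carrier_vec 2" "w \<noteq> 0\<^sub>v 2" and dvd: "lform w dvd a * b"
  shows "lform w dvd a \<or> lform w dvd b"
proof (cases "w $ 0 = 0")
  case False
  define r where "r = w $ 1 / w $ 0"
  have 1: "[:- [:0, r:], 1:] = lform w * [:[:- 1 / w $ 0:]:]" using False by (simp add: lform_def r_def one_pCons)
  have 2: "lform w = [:- [:0, r:], 1:] * [:[:- (w $ 0):]:]" using False by (simp add: lform_def r_def one_pCons)
  have iff: "lform w dvd f \<longleftrightarrow> poly f [:0, r:] = 0" for f
  proof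
    assume "lform w dvd f"
    then have "[:- [:0, r:], 1:] dvd f" unfolding 2 by (rule dvd_mult_left)
    then show "poly f [:0, r:] = 0" by (simp add: poly_eq_0_iff_dvd)
  next
    assume "poly f [:0, r:] = 0"
    then have "[:- [:0, r:], 1:] dvd f" by (simp add: poly_eq_0_iff_dvd)
    then show "lform w dvd f" unfolding 1 by (rule dvd_mult_left)
  qed
  show ?thesis using dvd unfolding iff by simp
next
  case True
  then have "w $ 1 \<noteq> 0" using w vec2_nonzero by auto
  then have "prime_elem [:0, w $ 1:]" by (rule prime_elem_linear_field_poly)
  then have "prime_elem [:[:0, w $ 1:]:]" by (simp add: prime_elem_const_poly_iff)
  then have "prime_elem (lform w)" using True by (simp add: lform_def)
  then show ?thesis using dvd prime_elem_dvd_mult_iff by blast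
qed

lemma ring_of_type_algebra_sel: "carrier (ring_of_type_algebra :: 'a::comm_ring_1 ring) = UNIV"
  "monoid.mult (ring_of_type_algebra :: 'a ring) = (*)" "ring.add (ring_of_type_algebra :: 'a ring) = (+)"
  "ring.zero (ring_of_type_algebra :: 'a ring) = 0" "monoid.one (ring_of_type_algebra :: 'a ring) = 1"
  by (simp_all add: ring_of_type_algebra_def)

lemma dvd_ideal: "ideal {f. l dvd f} (ring_of_type_algebra :: 'a::comm_ring_1 ring)"
proof (rule idealI)
  show "ring (ring_of_type_algebra :: 'a ring)" by (rule ring_from_type_algebra)
  interpret ring "ring_of_type_algebra :: 'a ring" by (rule ring_from_type_algebra)
  show "subgroup {f. l dvd f} (add_monoid ring_of_type_algebra)"
  proof (rule add.subgroupI)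
    fix a assume "a \<in> {f. l dvd f}"
    moreover have "\<ominus>\<^bsub>ring_of_type_algebra\<^esub> a = - a"
      by (rule minus_equality) (auto simp: ring_of_type_algebra_sel)
    ultimately show "\<ominus>\<^bsub>ring_of_type_algebra\<^esub> a \<in> {f. l dvd f}" by simp
  qed (auto simp: ring_of_type_algebra_sel)
qed (auto simp: ring_of_type_algebra_sel)

lemma lform_primeideal:
  fixes w :: "'k::field vec"
  assumes w: "w \<in> carrier_vec 2" "w \<noteq> 0\<^sub>v 2"
  shows "primeideal {f. lform w dvd f} ring_of_type_algebra"
proof (rule primeidealI[OF dvd_ideal])
  show "cring (ring_of_type_algebra :: 'k poly poly ring)" by (rule cring_from_type_algebra)
  show "carrier ring_of_type_algebra \<noteq> {f. lform w dvd f}" using lform_not_unit[of w] by (auto simp: ring_of_type_algebra_sel)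
qed (use lform_prime[OF w] in \<open>auto simp: ring_of_type_algebra_sel\<close>)

text \<open>A prime ideal properly contained in \<open>(l)\<close> does not contain \<open>l\<close>, so for each of its elements
  \<open>f = l f'\<close> it also contains \<open>f'\<close>, which has smaller degree if \<open>f \<noteq> 0\<close>; by descent the prime is
  zero.\<close>

lemma height_lform_le:
  fixes w :: "'k::field vec"
  assumes w: "w \<in> carrier_vec 2" "w \<noteq> 0\<^sub>v 2"
  shows "prime_height ring_of_type_algebra {f. lform w dvd f} \<le> 1"
  unfolding prime_height_def
proof (rule Sup_least, clarify)
  fix c m assume ch: "chain_of (\<lambda>J. primeideal J ring_of_type_algebra) c m" and top: "c m = {f. lform w dvd f}"
  show "enat m \<le> 1"
  proof (rule ccontr)
    assume "\<not> enat m \<le> 1"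
    then have m: "2 \<le> m" by (simp add: one_enat_def)
    define k where "k = m - 2"
    have km: "m = Suc (Suc k)" using m by (simp add: k_def)
    have str: "c k \<subset> c (Suc k)" "c (Suc k) \<subset> {f. lform w dvd f}" and pr: "primeideal (c (Suc k)) ring_of_type_algebra"
      "primeideal (c k) ring_of_type_algebra"
      using ch top unfolding chain_of_def km by (auto simp: km)
    interpret Q: primeideal "c (Suc k)" "ring_of_type_algebra" by (rule pr)
    interpret Q': primeideal "c k" "ring_of_type_algebra" by (rule pr)
    have lQ: "lform w \<notin> c (Suc k)"
    proof
      assume l: "lform w \<in> c (Suc k)"
      have lu: "lform w * u \<in> c (Suc k)" for u using Q.I_r_closed[OF l, of u] by (simp add: ring_of_type_algebra_sel)
      have "{f. lform w dvd f} \<subseteq> c (Suc k)"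
      proof
        fix f assume "f \<in> {f. lform w dvd f}"
        then have "lform w dvd f" by simp
        then obtain u where "f = lform w * u" by (elim dvdE)
        then show "f \<in> c (Suc k)" using lu by simp
      qed
      then show False using str by blast
    qed
    have "f \<in> c (Suc k) \<Longrightarrow> f = 0" for f
    proof (induction "degree (grading f)" arbitrary: f rule: less_induct)
      case less
      show ?case
      proof (rule ccontr)
        assume f0: "f \<noteq> 0"
        have "lform w dvd f" using less.prems str(2) by blast
        then obtain f' where f': "f = lform w * f'" by (elim dvdE)
        have "f' \<in> c (Suc k)" using Q.I_prime[of "lform w" f'] less.prems lQ by (simp add: ring_of_type_algebra_sel f')
        moreover have "degree (grading f') < degree (grading f)"
        proof -
          have "grading (lform w) \<noteq> 0" "grading f' \<noteq> 0" unfolding grading_eq_0 using f0 f' by auto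
          then show ?thesis using degree_grading_lform[OF w] by (simp add: f' grading_mult degree_mult_eq)
        qed
        ultimately have "f' = 0" using less.hyps by blast
        then show False using f0 f' by simp
      qed
    qed
    moreover have "0 \<in> c k" using Q'.zero_closed by (simp add: ring_of_type_algebra_sel)
    ultimately show False using str(1) by auto
  qed
qed

text \<open>A common zero \<open>w\<close> would put the ideal into the prime ideal of the linear form at \<open>w\<close>, which has
  height at most one.\<close>

lemma height_2_no_common_zero:
  fixes g :: "'k::field poly poly vec"
  assumes forms: "\<forall>i<n. bform d (g $ i)" and ht: "height ring_of_type_algebra (gen_ideal g {..<n}) = 2"
    and w: "w \<in> carrier_vec 2" "w \<noteq> 0\<^sub>v 2"
  shows "\<exists>i<n. beval (g $ i) w \<noteq> 0"
proof (rule ccontr)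
  assume "\<not> ?thesis"
  then have z: "lform w dvd g $ i" if "i < n" for i using lform_dvd[OF _ w] forms that by blast
  have "gen_ideal g {..<n} \<subseteq> {f. lform w dvd f}"
    unfolding gen_ideal_def by (rule ring.genideal_minimal[OF ring_from_type_algebra dvd_ideal]) (use z in auto)
  then have "height ring_of_type_algebra (gen_ideal g {..<n}) \<le> prime_height ring_of_type_algebra {f. lform w dvd f}"
    unfolding height_def using lform_primeideal[OF w] by (intro Inf_lower) blast
  also have "\<dots> \<le> 1" by (rule height_lform_le[OF w])
  finally show False using ht by (simp add: one_enat_def numeral_eq_enat)
qed

section \<open>Syzygies and minors\<close>

text \<open>The \<open>2 \<times> 2\<close> minors of the matrix with rows \<open>v\<close> and \<open>g\<close>.\<close>

definition minors :: "'k::field vec \<Rightarrow> 'k poly poly vec \<Rightarrow> 'k poly poly set" where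
  "minors v g = {[:[:v $ i:]:] * g $ j - [:[:v $ j:]:] * g $ i | i j. i < dim_vec g \<and> j < dim_vec g}"

lemma bform_minors: "\<forall>i<n. bform d (g $ i) \<Longrightarrow> dim_vec g = n \<Longrightarrow> f \<in> minors v g \<Longrightarrow> bform d f"
  unfolding minors_def by (auto intro!: bform_diff bform_const_mult simp del: mult_pCons_left)

text \<open>The Koszul syzygies of \<open>g\<close>, whose products with \<open>v\<close> are the minors, are combinations of the
  columns of \<open>\<phi>\<close>. Conversely, the products of a row entry with the \<open>g\<^sub>l\<close> are combinations of
  minors, and the \<open>g\<^sub>l\<close> can be cancelled as they have no common zero.\<close>

lemma common_divisors_minors:
  fixes g :: "'k::alg_closed_field poly poly vec"
  assumes g: "g \<in> carrier_vec n" and forms: "\<forall>i<n. bform d (g $ i)"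
    and nz: "\<And>w. w \<in> carrier_vec 2 \<Longrightarrow> w \<noteq> 0\<^sub>v 2 \<Longrightarrow> \<exists>i<n. beval (g $ i) w \<noteq> 0"
    and hb: "hilbert_burch g \<delta> \<phi>" and v: "v \<in> carrier_vec n"
    and f0: "f0 \<in> minors v g" "f0 \<noteq> 0"
  shows "(\<forall>s\<in>row_entries v \<phi>. E dvd s) \<longleftrightarrow> (\<forall>s\<in>minors v g. E dvd s)"
proof -
  have dg: "dim_vec g = n" using g by simp
  have phi: "\<phi> \<in> carrier_mat n (n - 1)" and ent: "\<And>i j. i < n \<Longrightarrow> j < n - 1 \<Longrightarrow> bform (\<delta> j) (\<phi> $$ (i, j))"
    and im: "(\<lambda>w. \<phi> *\<^sub>v w) ` carrier_vec (n - 1) = {u \<in> carrier_vec n. g \<bullet> u = 0}"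
    using hb unfolding hilbert_burch_def Let_def dg by auto
  define p where "p = map_vec (\<lambda>c. [:[:c:]:]) v"
  have p: "p \<in> carrier_vec n" using v by (simp add: p_def)
  have pi: "p $ i = [:[:v $ i:]:]" if "i < n" for i using that v by (simp add: p_def)
  have rows: "row_entries v \<phi> = {p \<bullet> col \<phi> j | j. j < n - 1}" using phi by (simp add: row_entries_def p_def)
  have minI: "p $ i * g $ j - p $ j * g $ i \<in> minors v g" if "i < n" "j < n" for i j
    using that unfolding minors_def dg pi[OF that(1)] pi[OF that(2)] by blast
  show ?thesis
  proof
    assume E: "\<forall>s\<in>row_entries v \<phi>. E dvd s"
    show "\<forall>s\<in>minors v g. E dvd s"
    proof
      fix s assume "s \<in> minors v g"
      then obtain i j where ij: "i < n" "j < n" and s: "s = p $ i * g $ j - p $ j * g $ i"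
        unfolding minors_def dg using pi by auto
      show "E dvd s"
      proof (cases "i = j")
        case True then show ?thesis by (simp add: s)
      next
        case False
        \<comment> \<open>the Koszul syzygy of \<open>g\<^sub>i\<close> and \<open>g\<^sub>j\<close>\<close>
        define u where "u = vec n (\<lambda>k. if k = i then g $ j else if k = j then - (g $ i) else 0)"
        have u: "u \<in> carrier_vec n" by (simp add: u_def)
        have sp: "q \<bullet> u = q $ i * g $ j - q $ j * g $ i" if "q \<in> carrier_vec n" for q
        proof -
          have "q \<bullet> u = (\<Sum>k\<in>{0..<n}. (if k = i then q $ i * g $ j else 0) + (if k = j then - (q $ j * g $ i) else 0))"
            unfolding scalar_prod_def using False by (intro sum.cong) (auto simp: u_def)
          also have "\<dots> = q $ i * g $ j - q $ j * g $ i" using ij by (simp add: sum.distrib)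
          finally show ?thesis .
        qed
        have "g \<bullet> u = 0" using sp[OF g] by (simp add: mult.commute)
        then obtain w where w: "w \<in> carrier_vec (n - 1)" "u = \<phi> *\<^sub>v w" using im u by blast
        have "s = p \<bullet> u" using sp[OF p] s by simp
        also have "\<dots> = (\<Sum>k\<in>{0..<n}. \<Sum>l\<in>{0..<n-1}. p $ k * (\<phi> $$ (k, l) * w $ l))"
          unfolding w(2) scalar_prod_def using phi w(1)
          by (intro sum.cong) (auto simp: scalar_prod_def sum_distrib_left)
        also have "\<dots> = (\<Sum>l\<in>{0..<n-1}. (p \<bullet> col \<phi> l) * w $ l)"
          unfolding scalar_prod_def using phi
          by (subst sum.swap, intro sum.cong) (auto simp: sum_distrib_right mult.assoc)
        finally have s': "s = (\<Sum>l\<in>{0..<n-1}. (p \<bullet> col \<phi> l) * w $ l)" .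
        have "E dvd p \<bullet> col \<phi> l" if "l < n - 1" for l using E rows that by blast
        then show ?thesis unfolding s' by (intro dvd_sum dvd_mult2) simp
      qed
    qed
  next
    assume E: "\<forall>s\<in>minors v g. E dvd s"
    have "bform d f0" using bform_minors[OF forms dg f0(1)] .
    from bform_dvd[OF this f0(2)] obtain i where i: "bform i E" using E f0(1) by blast
    have E0: "E \<noteq> 0" using E f0 by auto
    show "\<forall>s\<in>row_entries v \<phi>. E dvd s"
    proof
      fix s assume "s \<in> row_entries v \<phi>"
      then obtain j where j: "j < n - 1" "s = p \<bullet> col \<phi> j" using rows by auto
      define u where "u = col \<phi> j"
      have u: "u \<in> carrier_vec n" unfolding u_def by (rule carrier_vecI) (use phi in simp)
      have "u = \<phi> *\<^sub>v unit_vec (n - 1) j" using phi j by (auto simp: u_def)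
      then have "u \<in> {u \<in> carrier_vec n. g \<bullet> u = 0}" unfolding im[symmetric] by (rule image_eqI) simp
      then have gu: "g \<bullet> u = 0" by simp
      have s: "s = (\<Sum>k\<in>{0..<n}. p $ k * u $ k)"
        unfolding j(2) u_def[symmetric] scalar_prod_def carrier_vecD[OF u] ..
      have bs: "bform (\<delta> j) s"
      proof -
        have "bform (\<delta> j) (\<Sum>k\<in>A. p $ k * u $ k)" if "A \<subseteq> {0..<n}" "finite A" for A
          using that(2,1)
        proof (induction A rule: finite_induct)
          case (insert k A)
          have "bform (\<delta> j) (p $ k * u $ k)" using insert phi j ent[of k j] pi[of k]
            by (auto simp: u_def intro!: bform_const_mult simp del: mult_pCons_left)
          then show ?case using insert by (auto intro: bform_add)
        qed simp
        then show ?thesis unfolding s by simp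
      qed
      show "E dvd s"
      proof (rule dvd_cancel_no_common_zero[OF i E0 bs, of "{g $ l | l. l < n}"])
        fix w :: "'k vec" assume "w \<in> carrier_vec 2" "w \<noteq> 0\<^sub>v 2"
        from nz[OF this] show "\<exists>f\<in>{g $ l | l. l < n}. beval f w \<noteq> 0" by blast
      next
        fix f assume "f \<in> {g $ l | l. l < n}"
        then obtain l where l: "l < n" "f = g $ l" by blast
        have "s * f = (\<Sum>k\<in>{0..<n}. (p $ k * g $ l - p $ l * g $ k) * u $ k) + p $ l * (\<Sum>k\<in>{0..<n}. g $ k * u $ k)"
          unfolding s l sum_distrib_left sum_distrib_right sum.distrib[symmetric]
          by (rule sum.cong) (simp_all add: algebra_simps)
        also have "(\<Sum>k\<in>{0..<n}. g $ k * u $ k) = 0" using gu u by (simp add: scalar_prod_def)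
        finally have "s * f = (\<Sum>k\<in>{0..<n}. (p $ k * g $ l - p $ l * g $ k) * u $ k)" by simp
        moreover have "E dvd (p $ k * g $ l - p $ l * g $ k) * u $ k" if "k < n" for k
          using E minI[OF that l(1)] by (intro dvd_mult2) blast
        ultimately show "E dvd s * f" by (simp only:) (intro dvd_sum, simp)
      qed
    qed
  qed
qed

section \<open>Evaluation of forms in several variables\<close>

abbreviation lookup where "lookup \<equiv> Poly_Mapping.lookup"
abbreviation keys where "keys \<equiv> Poly_Mapping.keys"
abbreviation single where "single \<equiv> Poly_Mapping.single"

definition mon :: "(nat \<Rightarrow> 'r::comm_semiring_1) \<Rightarrow> (nat \<Rightarrow>\<^sub>0 nat) \<Rightarrow> 'r" where
  "mon x m = (\<Prod>i\<in>keys m. x i ^ lookup m i)"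

text \<open>The value of a polynomial at \<open>x\<close>, with coefficients transported by \<open>\<phi>\<close>. Polynomials on the
  projective space are evaluated in the field, in \<open>k[x,y]\<close> and in \<open>k[t]\<close>.\<close>

definition mev :: "('k::zero \<Rightarrow> 'r::comm_semiring_1) \<Rightarrow> (nat \<Rightarrow> 'r) \<Rightarrow> 'k mpoly \<Rightarrow> 'r" where
  "mev \<phi> x F = (\<Sum>m\<in>keys F. \<phi> (lookup F m) * mon x m)"

lemma meval_mev: "meval F v = mev (\<lambda>c. c) (\<lambda>i. v $ i) F"
  by (simp add: meval_def mev_def mon_def)

lemma mon_superset: "finite A \<Longrightarrow> keys m \<subseteq> A \<Longrightarrow> mon x m = (\<Prod>i\<in>A. x i ^ lookup m i)"
  unfolding mon_def by (rule prod.mono_neutral_left) (auto simp: in_keys_iff)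

lemma mon_0 [simp]: "mon x 0 = 1" by (simp add: mon_def)

lemma mon_add: "mon x (m + m') = mon x m * mon x m'"
proof -
  have "mon x (m + m') = (\<Prod>i\<in>keys m \<union> keys m'. x i ^ lookup (m + m') i)"
    by (intro mon_superset keys_add finite_UnI finite_keys)
  also have "\<dots> = (\<Prod>i\<in>keys m \<union> keys m'. x i ^ lookup m i) * (\<Prod>i\<in>keys m \<union> keys m'. x i ^ lookup m' i)"
    by (simp add: lookup_add power_add prod.distrib)
  also have "\<dots> = mon x m * mon x m'"
    by (simp add: mon_superset[of "keys m \<union> keys m'" m] mon_superset[of "keys m \<union> keys m'" m'])
  finally show ?thesis .
qed

lemma mon_single: "mon x (single i k) = x i ^ k"
  by (cases "k = 0") (auto simp: mon_def)

lemma poly_mapping_eq_sum: "F = (\<Sum>m\<in>keys F. single m (lookup F m))" for F :: "'a \<Rightarrow>\<^sub>0 'b::comm_monoid_add"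
proof (rule poly_mapping_eqI)
  fix k
  have "lookup (\<Sum>m\<in>keys F. single m (lookup F m)) k = (\<Sum>m\<in>keys F. if m = k then lookup F k else 0)"
    unfolding lookup_sum by (rule sum.cong) (auto simp: lookup_single when_def)
  also have "\<dots> = lookup F k" by (auto simp: sum.delta in_keys_iff)
  finally show "lookup F k = lookup (\<Sum>m\<in>keys F. single m (lookup F m)) k" ..
qed

context comm_ring_hom
begin

lemma mev_superset: "finite A \<Longrightarrow> keys F \<subseteq> A \<Longrightarrow> mev hom x F = (\<Sum>m\<in>A. hom (lookup F m) * mon x m)"
  unfolding mev_def by (rule sum.mono_neutral_left) (auto simp: in_keys_iff)

lemma mev_0: "mev hom x 0 = 0" by (simp add: mev_def)

lemma mev_single: "mev hom x (single m c) = hom c * mon x m"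
  by (cases "c = 0") (auto simp: mev_def)

lemma mev_1: "mev hom x 1 = 1"
  using mev_single[of x 0 1] by simp

lemma mev_add: "mev hom x (F + G) = mev hom x F + mev hom x G"
proof -
  have "mev hom x (F + G) = (\<Sum>m\<in>keys F \<union> keys G. hom (lookup (F + G) m) * mon x m)"
    by (intro mev_superset keys_add finite_UnI finite_keys)
  also have "\<dots> = (\<Sum>m\<in>keys F \<union> keys G. hom (lookup F m) * mon x m) + (\<Sum>m\<in>keys F \<union> keys G. hom (lookup G m) * mon x m)"
    by (simp add: lookup_add hom_add distrib_right sum.distrib)
  also have "\<dots> = mev hom x F + mev hom x G"
    by (simp add: mev_superset[of "keys F \<union> keys G"])
  finally show ?thesis .
qed

lemma mev_sum: "mev hom x (\<Sum>a\<in>A. F a) = (\<Sum>a\<in>A. mev hom x (F a))"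
  by (induction A rule: infinite_finite_induct) (auto simp: mev_0 mev_add)

lemma mev_uminus: "mev hom x (- F) = - mev hom x F"
proof -
  have "mev hom x F + mev hom x (- F) = 0" using mev_add[of x F "- F"] by (simp add: mev_0)
  then show ?thesis by (simp add: eq_neg_iff_add_eq_0 add.commute)
qed

lemma mev_diff: "mev hom x (F - G) = mev hom x F - mev hom x G"
  using mev_add[of x F "- G"] by (simp add: mev_uminus)

lemma mev_mult: "mev hom x (F * G) = mev hom x F * mev hom x G"
proof -
  have "F * G = (\<Sum>m\<in>keys F. single m (lookup F m)) * (\<Sum>m\<in>keys G. single m (lookup G m))"
    by (simp only: poly_mapping_eq_sum[symmetric])
  also have "\<dots> = (\<Sum>m\<in>keys F. \<Sum>m'\<in>keys G. single (m + m') (lookup F m * lookup G m'))"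
    by (simp only: sum_product mult_single)
  finally have "mev hom x (F * G) = (\<Sum>m\<in>keys F. \<Sum>m'\<in>keys G. hom (lookup F m * lookup G m') * mon x (m + m'))"
    by (simp only: mev_sum mev_single)
  also have "\<dots> = mev hom x F * mev hom x G"
    by (simp add: mev_def sum_product mon_add hom_mult mult_ac)
  finally show ?thesis .
qed

lemma mev_power: "mev hom x (F ^ k) = mev hom x F ^ k"
  by (induction k) (auto simp: mev_1 mev_mult)

end

lemma mev_hom:
  assumes "comm_ring_hom \<psi>"
  shows "\<psi> (mev \<phi> x F) = mev (\<lambda>c. \<psi> (\<phi> c)) (\<lambda>i. \<psi> (x i)) F"
proof -
  interpret comm_ring_hom \<psi> by fact
  show ?thesis by (simp add: mev_def mon_def hom_sum hom_mult hom_prod hom_power)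
qed

lemma id_hom: "comm_ring_hom (\<lambda>c :: 'k::comm_ring_1. c)" by unfold_locales auto

lemma mform_iff: "mform n e F \<longleftrightarrow> (\<forall>m\<in>keys F. keys m \<subseteq> {..<n} \<and> (\<Sum>i<n. lookup m i) = e)"
proof -
  have "(\<Sum>i\<in>keys m. lookup m i) = (\<Sum>i<n. lookup m i)" if "keys m \<subseteq> {..<n}" for m :: "nat \<Rightarrow>\<^sub>0 nat"
    by (rule sum.mono_neutral_left) (use that in \<open>auto simp: in_keys_iff\<close>)
  then show ?thesis unfolding mform_def by auto
qed

lemma mform_0 [simp]: "mform n e 0" by (simp add: mform_def)

lemma mform_add: "mform n e F \<Longrightarrow> mform n e G \<Longrightarrow> mform n e (F + G)"
  unfolding mform_iff using keys_add[of F G] by blast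

lemma mform_uminus: "mform n e F \<Longrightarrow> mform n e (- F)" for F :: "'k::comm_ring_1 mpoly"
  unfolding mform_iff by (auto simp: in_keys_iff)

lemma mform_diff: "mform n e F \<Longrightarrow> mform n e G \<Longrightarrow> mform n e (F - G)" for F :: "'k::comm_ring_1 mpoly"
  using mform_add[of n e F "- G"] mform_uminus[of n e G] by simp

lemma mform_mult:
  fixes F G :: "'k::comm_semiring_1 mpoly"
  assumes "mform n e F" "mform n e' G" shows "mform n (e + e') (F * G)"
  unfolding mform_iff
proof
  fix m assume "m \<in> keys (F * G)"
  then obtain a b where ab: "m = a + b" "a \<in> keys F" "b \<in> keys G" using keys_mult[of F G] by blast
  then have "keys a \<subseteq> {..<n}" "keys b \<subseteq> {..<n}" "(\<Sum>i<n. lookup a i) = e" "(\<Sum>i<n. lookup b i) = e'"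
    using assms unfolding mform_iff by blast+
  then show "keys m \<subseteq> {..<n} \<and> (\<Sum>i<n. lookup m i) = e + e'"
    using keys_add[of a b] unfolding ab(1) by (auto simp: lookup_add sum.distrib)
qed

lemma mform_single: "mform n 0 (single 0 c)"
  by (cases "c = 0") (auto simp: mform_def)

lemma mform_1: "mform n 0 (1 :: 'k::comm_semiring_1 mpoly)"
  using mform_single[of n "1 :: 'k"] by (simp only: single_one)

lemma mform_power: "mform n e F \<Longrightarrow> mform n (k * e) (F ^ k)" for F :: "'k::comm_semiring_1 mpoly"
  by (induction k) (auto simp: mform_1 mform_mult)

lemma mform_sum: "(\<And>a. a \<in> A \<Longrightarrow> mform n e (F a)) \<Longrightarrow> mform n e (\<Sum>a\<in>A. F a)"
  by (induction A rule: infinite_finite_induct) (auto intro: mform_add)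

lemma mon_scale:
  assumes "keys m \<subseteq> {..<n}"
  shows "mon (\<lambda>i. c * x i) m = c ^ (\<Sum>i<n. lookup m i) * mon x m"
  using assms by (simp add: mon_superset[of "{..<n}"] power_mult_distrib prod.distrib power_sum)

lemma mev_scale:
  assumes "mform n e F" shows "mev \<phi> (\<lambda>i. c * x i) F = c ^ e * mev \<phi> x F"
  unfolding mev_def sum_distrib_left
proof (rule sum.cong)
  fix m assume "m \<in> keys F"
  then have "keys m \<subseteq> {..<n}" "(\<Sum>i<n. lookup m i) = e" using assms unfolding mform_iff by blast+
  then show "\<phi> (lookup F m) * mon (\<lambda>i. c * x i) m = c ^ e * (\<phi> (lookup F m) * mon x m)"
    using mon_scale[of m n c x] by (simp add: mult_ac)
qed simp

lemma mev_cong: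
  assumes "mform n e F" "\<And>i. i < n \<Longrightarrow> x i = y i" shows "mev \<phi> x F = mev \<phi> y F"
  unfolding mev_def
proof (rule sum.cong)
  fix m assume "m \<in> keys F"
  then have "keys m \<subseteq> {..<n}" using assms unfolding mform_iff by blast
  then have "mon x m = mon y m" unfolding mon_def using assms(2) by (intro prod.cong) auto
  then show "\<phi> (lookup F m) * mon x m = \<phi> (lookup F m) * mon y m" by simp
qed simp

lemma meval_scale:
  assumes "mform n e F" "v \<in> carrier_vec n" shows "meval F (c \<cdot>\<^sub>v v) = c ^ e * meval F v"
  unfolding meval_mev mev_scale[OF assms(1), symmetric]
  by (rule mev_cong[OF assms(1)]) (use assms(2) in simp)

lemma dvd_mev_cong:
  fixes h :: "'r::comm_ring_1"
  assumes "mform n e F" "\<And>i. i < n \<Longrightarrow> h dvd x i - y i" shows "h dvd mev \<phi> x F - mev \<phi> y F"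
proof -
  have prd: "h dvd a * b - a' * b'" if "h dvd a - a'" "h dvd b - b'" for a a' b b'
  proof -
    have "a * b - a' * b' = (a - a') * b + a' * (b - b')" by (simp add: algebra_simps)
    then show ?thesis using that by (auto intro!: dvd_add)
  qed
  have pw: "h dvd a ^ k - a' ^ k" if "h dvd a - a'" for a a' and k :: nat
    by (induction k) (use that in \<open>auto intro!: prd\<close>)
  have mo: "h dvd mon x m - mon y m" if "keys m \<subseteq> {..<n}" for m
  proof -
    have "h dvd (\<Prod>i\<in>A. x i ^ lookup m i) - (\<Prod>i\<in>A. y i ^ lookup m i)" if "finite A" "A \<subseteq> {..<n}" for A
      using that by (induction A rule: finite_induct) (auto intro!: prd pw assms(2))
    then show ?thesis using that unfolding mon_def by simp
  qed
  have "mev \<phi> x F - mev \<phi> y F = (\<Sum>m\<in>keys F. \<phi> (lookup F m) * (mon x m - mon y m))"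
    unfolding mev_def by (simp add: sum_subtractf algebra_simps)
  also have "h dvd \<dots>" using mo assms(1) unfolding mform_iff by (auto intro!: dvd_sum)
  finally show ?thesis .
qed

lemma bform_power: "bform e f \<Longrightarrow> bform (e * k) (f ^ k)" for f :: "'k::field poly poly"
proof (induction k)
  case 0 then show ?case using bform_const[of "1 :: 'k"] by (simp add: one_pCons)
next
  case (Suc k) then show ?case using bform_mult[of e f "e * k" "f ^ k"] by simp
qed

lemma bform_prod: "finite A \<Longrightarrow> (\<And>i. i \<in> A \<Longrightarrow> bform (e i) (f i)) \<Longrightarrow> bform (\<Sum>i\<in>A. e i) (\<Prod>i\<in>A. f i)"
  for f :: "_ \<Rightarrow> 'k::field poly poly"
proof (induction A rule: finite_induct)
  case empty then show ?case using bform_const[of "1 :: 'k"] by (simp add: one_pCons)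
next
  case (insert i A) then show ?case by (auto intro!: bform_mult)
qed

lemma bform_sum: "(\<And>i. i \<in> A \<Longrightarrow> bform e (f i)) \<Longrightarrow> bform e (\<Sum>i\<in>A. f i)" for f :: "_ \<Rightarrow> 'k::field poly poly"
  by (induction A rule: infinite_finite_induct) (auto intro: bform_add)

lemma bform_mev:
  fixes x :: "nat \<Rightarrow> 'k::field poly poly"
  assumes "mform n e F" "\<And>i. i < n \<Longrightarrow> bform d (x i)"
  shows "bform (d * e) (mev (\<lambda>c. [:[:c:]:]) x F)"
  unfolding mev_def
proof (rule bform_sum, rule bform_const_mult)
  fix m assume "m \<in> keys F"
  then have m: "keys m \<subseteq> {..<n}" "(\<Sum>i<n. lookup m i) = e" using assms unfolding mform_iff by blast+
  have "bform (\<Sum>i<n. d * lookup m i) (\<Prod>i<n. x i ^ lookup m i)"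
    by (rule bform_prod) (auto intro: bform_power assms(2))
  then show "bform (d * e) (mon x m)" using m by (simp add: mon_superset[of "{..<n}"] sum_distrib_left[symmetric])
qed

section \<open>The local ring of the curve at a point\<close>

lemma proj_point_self: "v \<in> proj_point v"
  unfolding proj_point_def using one_smult_vec[of v] zero_neq_one by (metis (mono_tags, lifting) mem_Collect_eq)

lemma proj_point_smult: assumes "c \<noteq> 0" shows "proj_point (c \<cdot>\<^sub>v v) = proj_point (v :: 'k::field vec)"
proof (intro equalityI subsetI)
  fix u assume "u \<in> proj_point (c \<cdot>\<^sub>v v)"
  then obtain a where "a \<noteq> 0" "u = a \<cdot>\<^sub>v (c \<cdot>\<^sub>v v)" unfolding proj_point_def by blast
  then have "a * c \<noteq> 0" "u = (a * c) \<cdot>\<^sub>v v" using assms by (auto simp: smult_smult_assoc)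
  then show "u \<in> proj_point v" unfolding proj_point_def by blast
next
  fix u assume "u \<in> proj_point v"
  then obtain a where "a \<noteq> 0" "u = a \<cdot>\<^sub>v v" unfolding proj_point_def by blast
  then have "a / c \<noteq> 0" "u = (a / c) \<cdot>\<^sub>v (c \<cdot>\<^sub>v v)" using assms by (auto simp: smult_smult_assoc)
  then show "u \<in> proj_point (c \<cdot>\<^sub>v v)" unfolding proj_point_def by blast
qed

lemma proj_pointE: assumes "u \<in> proj_point v" obtains c where "c \<noteq> 0" "u = c \<cdot>\<^sub>v v"
  using assms unfolding proj_point_def by blast

lemma nonzero_index:
  fixes v :: "'k::field vec"
  assumes v: "v \<in> carrier_vec n" "v \<noteq> 0\<^sub>v n" obtains i where "i < n" "v $ i \<noteq> 0"
proof -
  have "\<exists>i<n. v $ i \<noteq> 0"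
  proof (rule ccontr)
    assume "\<not> ?thesis"
    then have "v = 0\<^sub>v n" using v(1) by (intro eq_vecI) auto
    then show False using v(2) by simp
  qed
  then show thesis using that by blast
qed

lemma smult_vec_nonzero:
  fixes u :: "'k::field vec"
  assumes "c \<noteq> 0" "u \<in> carrier_vec n" "u \<noteq> 0\<^sub>v n" shows "c \<cdot>\<^sub>v u \<noteq> 0\<^sub>v n"
proof
  assume z: "c \<cdot>\<^sub>v u = 0\<^sub>v n"
  obtain i where i: "i < n" "u $ i \<noteq> 0" by (rule nonzero_index[OF assms(2,3)])
  have "(c \<cdot>\<^sub>v u) $ i = c * u $ i" using i assms(2) by simp
  then show False using z i assms(1) by simp
qed

definition gvec :: "'k::field poly poly vec \<Rightarrow> 'k vec \<Rightarrow> 'k vec" where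
  "gvec g w = map_vec (\<lambda>f. beval f w) g"

lemma gvec_scale:
  fixes g :: "'k::field poly poly vec"
  assumes "\<forall>i<n. bform d (g $ i)" "g \<in> carrier_vec n" "w \<in> carrier_vec 2"
  shows "gvec g (c \<cdot>\<^sub>v w) = c ^ d \<cdot>\<^sub>v gvec g w"
  using assms by (intro eq_vecI) (auto simp: gvec_def beval_scale)

lemma gvec_nonzeroI:
  assumes g: "g \<in> carrier_vec n" and nz: "\<exists>i<n. beval (g $ i) w \<noteq> 0" shows "gvec g w \<noteq> 0\<^sub>v n"
proof
  assume z: "gvec g w = 0\<^sub>v n"
  obtain i where i: "i < n" "beval (g $ i) w \<noteq> 0" using nz by blast
  have "gvec g w $ i = beval (g $ i) w" using i g by (simp add: gvec_def)
  then show False using i z by simp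
qed

lemma Psi_proj_point:
  fixes g :: "'k::field poly poly vec"
  assumes "\<forall>i<n. bform d (g $ i)" "g \<in> carrier_vec n" "w \<in> carrier_vec 2"
  shows "Psi g (proj_point w) = proj_point (gvec g w)"
proof -
  have "proj_point (gvec g u) = proj_point (gvec g w)" if u: "u \<in> proj_point w" for u
    using u
  proof (rule proj_pointE)
    fix c assume "c \<noteq> 0" "u = c \<cdot>\<^sub>v w"
    then show ?thesis using gvec_scale[OF assms] proj_point_smult[of "c ^ d"] by simp
  qed
  then show ?thesis unfolding Psi_def gvec_def[symmetric] using proj_point_self[of w] by blast
qed

lemma curve_eq:
  fixes g :: "'k::field poly poly vec"
  assumes "\<forall>i<n. bform d (g $ i)" "g \<in> carrier_vec n"
  shows "curve g = {proj_point (gvec g w) | w. w \<in> carrier_vec 2 \<and> w \<noteq> 0\<^sub>v 2}"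
  unfolding curve_def proj_space_def using Psi_proj_point[OF assms] by force

text \<open>A point \<open>p\<close> of the curve, given by coordinates \<open>v\<close>, with a chart whose point at infinity is not
  mapped to \<open>p\<close>.\<close>

locale curve_point = chart \<gamma> \<eta> for \<gamma> \<eta> :: "'k::alg_closed_field vec" +
  fixes n d :: nat and g :: "'k poly poly vec" and v :: "'k vec"
  assumes g: "g \<in> carrier_vec n" and forms: "\<forall>i<n. bform d (g $ i)"
    and nocz: "\<And>w. w \<in> carrier_vec 2 \<Longrightarrow> w \<noteq> 0\<^sub>v 2 \<Longrightarrow> \<exists>i<n. beval (g $ i) w \<noteq> 0"
    and on_curve: "proj_point v \<in> curve g"
    and off: "proj_point (gvec g \<eta>) \<noteq> proj_point v"
begin

abbreviation p where "p \<equiv> proj_point v"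

text \<open>The pullback of a form along the parametrization, as a polynomial in the chart (\<open>pe\<close>) and as a
  binary form (\<open>be\<close>).\<close>

definition pe :: "'k mpoly \<Rightarrow> 'k poly" where "pe F = mev (\<lambda>c. [:c:]) (\<lambda>i. dehom (g $ i)) F"
definition be :: "'k mpoly \<Rightarrow> 'k poly poly" where "be F = mev (\<lambda>c. [:[:c:]:]) (\<lambda>i. g $ i) F"

lemma beval_hom: "comm_ring_hom (\<lambda>f :: 'k poly poly. beval f w)" by unfold_locales auto
lemma dehom_hom: "comm_ring_hom dehom"
  by unfold_locales (auto, use dehom_simps(4)[of 1] in \<open>simp add: one_pCons\<close>)

lemma pe_simps [simp]: "pe (F * G) = pe F * pe G" "pe (F + G) = pe F + pe G" "pe (F - G) = pe F - pe G"
  "pe 0 = 0" "pe 1 = 1" "pe (single 0 c) = [:c:]" "pe (F ^ k) = pe F ^ k" "pe (- F) = - pe F"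
  by (simp_all add: pe_def comm_ring_hom.mev_mult[OF lift_hom] comm_ring_hom.mev_add[OF lift_hom]
      comm_ring_hom.mev_diff[OF lift_hom] comm_ring_hom.mev_0[OF lift_hom] comm_ring_hom.mev_1[OF lift_hom]
      comm_ring_hom.mev_single[OF lift_hom] comm_ring_hom.mev_power[OF lift_hom] comm_ring_hom.mev_uminus[OF lift_hom])

lemma dehom_be: "dehom (be F) = pe F"
  unfolding be_def pe_def mev_hom[OF dehom_hom] by simp

lemma beval_be: assumes "mform n e F" shows "beval (be F) w = meval F (gvec g w)"
  unfolding be_def meval_mev mev_hom[OF beval_hom]
  by (simp, rule mev_cong[OF assms]) (use g in \<open>simp add: gvec_def\<close>)

lemma poly_pe: assumes "mform n e F" shows "poly (pe F) t = meval F (gvec g (cpt t))"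
  unfolding dehom_be[symmetric] poly_dehom using beval_be[OF assms] .

lemma bform_be: "mform n e F \<Longrightarrow> bform (d * e) (be F)"
  unfolding be_def using forms by (intro bform_mev) auto

lemma degree_pe: "mform n e F \<Longrightarrow> degree (pe F) \<le> d * e"
  unfolding dehom_be[symmetric] by (rule degree_dehom[OF bform_be])

lemma curve_points: "curve g = {proj_point (gvec g w) | w. w \<in> carrier_vec 2 \<and> w \<noteq> 0\<^sub>v 2}"
  by (rule curve_eq[OF forms g])

lemma gvec_carrier: "gvec g w \<in> carrier_vec n" using g by (simp add: gvec_def)

lemma gvec_nonzero: assumes "w \<in> carrier_vec 2" "w \<noteq> 0\<^sub>v 2" shows "gvec g w \<noteq> 0\<^sub>v n"
  using gvec_nonzeroI[OF g nocz[OF assms]] .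

text \<open>The ideal of the curve is the kernel of the pullback, since a polynomial that vanishes on an
  infinite field is zero.\<close>

lemma vanishes_iff: assumes F: "mform n e F" shows "vanishes_on F (curve g) \<longleftrightarrow> pe F = 0"
proof
  assume van: "vanishes_on F (curve g)"
  show "pe F = 0"
  proof (rule poly_eqI_pointwise)
    fix t
    have "proj_point (gvec g (cpt t)) \<in> curve g" unfolding curve_points using cpt_carrier cpt_nonzero by blast
    then have "meval F (gvec g (cpt t)) = 0" using van proj_point_self unfolding vanishes_on_def by blast
    then show "poly (pe F) t = poly 0 t" by (simp add: poly_pe[OF F])
  qed
next
  assume "pe F = 0"
  then have be0: "be F = 0" using dehom_eq_0[OF bform_be[OF F]] dehom_be by simp
  show "vanishes_on F (curve g)" unfolding vanishes_on_def curve_points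
  proof (intro ballI)
    fix q u assume "q \<in> {proj_point (gvec g w) | w. w \<in> carrier_vec 2 \<and> w \<noteq> 0\<^sub>v 2}" and u: "u \<in> q"
    then obtain w where w: "q = proj_point (gvec g w)" by blast
    obtain c where c: "u = c \<cdot>\<^sub>v gvec g w" using u unfolding w by (elim proj_pointE)
    show "meval F u = 0" unfolding c meval_scale[OF F gvec_carrier] using beval_be[OF F, of w] be0 by simp
  qed
qed

text \<open>The fibre of the parametrization over \<open>p\<close>; by \<open>off\<close> it lies in the chart completely.\<close>

definition T :: "'k set" where "T = {t. proj_point (gvec g (cpt t)) = p}"

lemma fibre_point: obtains t where "t \<in> T"
proof -
  obtain w where w: "p = proj_point (gvec g w)" "w \<in> carrier_vec 2" "w \<noteq> 0\<^sub>v 2"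
    using on_curve unfolding curve_points by blast
  have Psi: "proj_point (gvec g (c \<cdot>\<^sub>v u)) = proj_point (gvec g u)" if "c \<noteq> 0" "u \<in> carrier_vec 2" for c u
    using gvec_scale[OF forms g that(2), of c] proj_point_smult[of "c ^ d"] that by simp
  consider c where "c \<noteq> 0" "w = c \<cdot>\<^sub>v \<eta>" | c t where "c \<noteq> 0" "w = c \<cdot>\<^sub>v cpt t" using chart_points[OF w(2,3)] by blast
  then show thesis
  proof cases
    case 1 then show ?thesis using off w(1) Psi[OF _ \<eta>] by simp
  next
    case 2 then show ?thesis using that[of t] w(1) Psi[OF _ cpt_carrier] by (simp add: T_def)
  qed
qed

lemma T_nonempty: "T \<noteq> {}" using fibre_point by blast

lemma T_scale: assumes "t \<in> T" obtains c where "c \<noteq> 0" "v = c \<cdot>\<^sub>v gvec g (cpt t)"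
  using proj_point_self[of v] assms unfolding T_def by (auto elim: proj_pointE)

lemma v_carrier: "v \<in> carrier_vec n"
  using fibre_point T_scale gvec_carrier by (metis smult_carrier_vec)

lemma v_nonzero: "v \<noteq> 0\<^sub>v n"
proof -
  obtain t where t: "t \<in> T" by (rule fibre_point)
  then obtain c where c: "c \<noteq> 0" "v = c \<cdot>\<^sub>v gvec g (cpt t)" by (rule T_scale)
  show ?thesis unfolding c(2)
    by (rule smult_vec_nonzero[OF c(1) gvec_carrier gvec_nonzero[OF cpt_carrier cpt_nonzero]])
qed

lemma nonzero_at_iff: assumes "mform n e G" shows "nonzero_at G p \<longleftrightarrow> meval G v \<noteq> 0"
proof
  assume "nonzero_at G p" then show "meval G v \<noteq> 0" using proj_point_self unfolding nonzero_at_def by blast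
next
  assume nz: "meval G v \<noteq> 0"
  show "nonzero_at G p" unfolding nonzero_at_def
  proof
    fix u assume "u \<in> p"
    then obtain c where "c \<noteq> 0" "u = c \<cdot>\<^sub>v v" by (rule proj_pointE)
    then show "meval G u \<noteq> 0" using meval_scale[OF assms v_carrier] nz by simp
  qed
qed

lemma pe_T: assumes "mform n e G" "t \<in> T" shows "poly (pe G) t = 0 \<longleftrightarrow> meval G v = 0"
proof -
  obtain c where c: "c \<noteq> 0" "v = c \<cdot>\<^sub>v gvec g (cpt t)" using assms(2) by (rule T_scale)
  show ?thesis unfolding c(2) meval_scale[OF assms(1) gvec_carrier] poly_pe[OF assms(1)] using c(1) by simp
qed

abbreviation Fr where "Fr \<equiv> fracs_at n p"
abbreviation rel where "rel \<equiv> frac_rel n (curve g) p"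
abbreviation R where "R \<equiv> stalk n (curve g) p"

lemma Fr_iff: "(F, G) \<in> Fr \<longleftrightarrow> (\<exists>e. mform n e F \<and> mform n e G) \<and> meval G v \<noteq> 0"
  unfolding fracs_at_def using nonzero_at_iff by blast

lemma Fr_pe: "(F, G) \<in> Fr \<Longrightarrow> pe G \<noteq> 0"
  using fibre_point pe_T unfolding Fr_iff by (metis poly_0)

lemma Fr_T: "(F, G) \<in> Fr \<Longrightarrow> t \<in> T \<Longrightarrow> poly (pe G) t \<noteq> 0"
  using pe_T unfolding Fr_iff by blast

text \<open>The local ring embeds into \<open>k(t)\<close> by \<open>F/G \<mapsto> pe F / pe G\<close>: the auxiliary form in the definition
  of the localization has a nonzero pullback and cancels in the domain \<open>k[t]\<close>.\<close>

lemma rel_iff: "((F, G), (F', G')) \<in> rel \<longleftrightarrow> (F, G) \<in> Fr \<and> (F', G') \<in> Fr \<and> pe F * pe G' = pe F' * pe G"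
proof -
  have "(\<exists>H. (\<exists>e. mform n e H) \<and> nonzero_at H p \<and> vanishes_on (H * (F * G' - F' * G)) (curve g)) \<longleftrightarrow>
      pe F * pe G' = pe F' * pe G" if FG: "(F, G) \<in> Fr" and FG': "(F', G') \<in> Fr"
  proof -
    obtain e where e: "mform n e F" "mform n e G" using FG unfolding Fr_iff by blast
    obtain e' where e': "mform n e' F'" "mform n e' G'" using FG' unfolding Fr_iff by blast
    have m: "mform n (e + e') (F * G' - F' * G)"
      using mform_mult[OF e(1) e'(2)] mform_mult[OF e'(1) e(2)] by (simp add: mform_diff add.commute)
    show ?thesis
    proof
      assume "\<exists>H. (\<exists>e. mform n e H) \<and> nonzero_at H p \<and> vanishes_on (H * (F * G' - F' * G)) (curve g)"
      then obtain H k where H: "mform n k H" "nonzero_at H p" "vanishes_on (H * (F * G' - F' * G)) (curve g)" by blast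
      have "pe H \<noteq> 0" using fibre_point pe_T[OF H(1)] nonzero_at_iff[OF H(1)] H(2) by (metis poly_0)
      moreover have "pe (H * (F * G' - F' * G)) = 0" using vanishes_iff[OF mform_mult[OF H(1) m]] H(3) by simp
      ultimately show "pe F * pe G' = pe F' * pe G" by simp
    next
      assume eq: "pe F * pe G' = pe F' * pe G"
      have "vanishes_on (1 * (F * G' - F' * G)) (curve g)"
        using vanishes_iff[OF m] eq by simp
      moreover have "nonzero_at 1 p" unfolding nonzero_at_def meval_mev comm_ring_hom.mev_1[OF id_hom] by simp
      ultimately show "\<exists>H. (\<exists>e. mform n e H) \<and> nonzero_at H p \<and> vanishes_on (H * (F * G' - F' * G)) (curve g)"
        using mform_1 by blast
    qed
  qed
  then show ?thesis unfolding frac_rel_def by auto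
qed

lemma Fr_mult: assumes "(F, G) \<in> Fr" "(F', G') \<in> Fr" shows "(F * F', G * G') \<in> Fr"
proof -
  obtain e e' where "mform n e F" "mform n e G" "mform n e' F'" "mform n e' G'" using assms unfolding Fr_iff by blast
  then have "mform n (e + e') (F * F') \<and> mform n (e + e') (G * G')" by (simp add: mform_mult)
  moreover have "meval (G * G') v \<noteq> 0" using assms unfolding Fr_iff meval_mev comm_ring_hom.mev_mult[OF id_hom] by simp
  ultimately show ?thesis unfolding Fr_iff by blast
qed

lemma Fr_add: assumes "(F, G) \<in> Fr" "(F', G') \<in> Fr" shows "(F * G' + F' * G, G * G') \<in> Fr"
proof -
  obtain e e' where m: "mform n e F" "mform n e G" "mform n e' F'" "mform n e' G'" using assms unfolding Fr_iff by blast
  have "mform n (e + e') (F * G' + F' * G) \<and> mform n (e + e') (G * G')"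
    using mform_mult[OF m(1,4)] mform_mult[OF m(3,2)] mform_mult[OF m(2,4)] by (simp add: mform_add add.commute)
  moreover have "meval (G * G') v \<noteq> 0" using assms unfolding Fr_iff meval_mev comm_ring_hom.mev_mult[OF id_hom] by simp
  ultimately show ?thesis unfolding Fr_iff by blast
qed

lemma Fr_const: "(single 0 c, 1) \<in> Fr"
  unfolding Fr_iff meval_mev comm_ring_hom.mev_1[OF id_hom] using mform_single mform_1 by auto

lemma Fr_one: "(1, 1) \<in> Fr" using Fr_const[of 1] by (simp only: single_one)
lemma Fr_zero: "(0, 1) \<in> Fr" using Fr_const[of 0] by (simp only: single_zero)

lemma Fr_uminus: "(F, G) \<in> Fr \<Longrightarrow> (- F, G) \<in> Fr"
  unfolding Fr_iff using mform_uminus by blast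

lemma rel_equiv: "equiv Fr rel"
proof (rule equivI)
  show "rel \<subseteq> Fr \<times> Fr" unfolding frac_rel_def by auto
  show "refl_on Fr rel" by (rule refl_onI) (use rel_iff in auto)
  show "sym rel" by (rule symI) (use rel_iff in auto)
  show "trans rel"
  proof (rule transI)
    fix x y z assume xy: "(x, y) \<in> rel" and yz: "(y, z) \<in> rel"
    obtain F G where x: "x = (F, G)" by (cases x)
    obtain F' G' where y: "y = (F', G')" by (cases y)
    obtain F'' G'' where z: "z = (F'', G'')" by (cases z)
    have 1: "(F, G) \<in> Fr" "(F', G') \<in> Fr" "(F'', G'') \<in> Fr" "pe F * pe G' = pe F' * pe G" "pe F' * pe G'' = pe F'' * pe G'"
      using xy yz unfolding x y z rel_iff by blast+
    have "pe G' * (pe F * pe G'') = pe G * (pe F' * pe G'')" using 1(4) by (simp add: mult_ac)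
    also have "\<dots> = pe G' * (pe F'' * pe G)" using 1(5) by (simp add: mult_ac)
    finally have "pe F * pe G'' = pe F'' * pe G" using Fr_pe[OF 1(2)] by simp
    then show "(x, z) \<in> rel" unfolding x z rel_iff using 1 by blast
  qed
qed

definition cl :: "'k mpoly \<Rightarrow> 'k mpoly \<Rightarrow> ('k mpoly \<times> 'k mpoly) set" where
  "cl F G = rel `` {(F, G)}"

lemma cl_eq_iff: "(F, G) \<in> Fr \<Longrightarrow> (F', G') \<in> Fr \<Longrightarrow> cl F G = cl F' G' \<longleftrightarrow> pe F * pe G' = pe F' * pe G"
  unfolding cl_def eq_equiv_class_iff[OF rel_equiv] rel_iff by blast

lemma mem_cl: "(F', G') \<in> cl F G \<longleftrightarrow> (F, G) \<in> Fr \<and> (F', G') \<in> Fr \<and> pe F * pe G' = pe F' * pe G"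
  unfolding cl_def using rel_iff by blast

lemma cl_self: "(F, G) \<in> Fr \<Longrightarrow> (F, G) \<in> cl F G" by (simp add: mem_cl)

lemma carrier_R: "carrier R = {cl F G | F G. (F, G) \<in> Fr}"
  unfolding stalk_def quotient_def cl_def by auto

lemma carrier_RE: assumes "U \<in> carrier R" obtains F G where "(F, G) \<in> Fr" "U = cl F G"
  using assms unfolding carrier_R by blast

lemma carrier_RI: "(F, G) \<in> Fr \<Longrightarrow> cl F G \<in> carrier R" unfolding carrier_R by blast

lemma R_mult: assumes "(F, G) \<in> Fr" "(F', G') \<in> Fr" shows "cl F G \<otimes>\<^bsub>R\<^esub> cl F' G' = cl (F * F') (G * G')"
proof -
  have "rel `` {(A * A', B * B')} = cl (F * F') (G * G')" if "(A, B) \<in> cl F G" "(A', B') \<in> cl F' G'" for A B A' B'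
  proof -
    have 1: "(A, B) \<in> Fr" "(A', B') \<in> Fr" "pe F * pe B = pe A * pe G" "pe F' * pe B' = pe A' * pe G'"
      using that unfolding mem_cl by blast+
    have "pe (A * A') * pe (G * G') = (pe A * pe G) * (pe A' * pe G')" by (simp add: mult_ac)
    also have "\<dots> = (pe F * pe B) * (pe F' * pe B')" by (simp only: 1)
    also have "\<dots> = pe (F * F') * pe (B * B')" by (simp add: mult_ac)
    finally show ?thesis unfolding cl_def[of "A * A'", symmetric]
      using cl_eq_iff[OF Fr_mult[OF 1(1,2)] Fr_mult[OF assms]] by blast
  qed
  then have "(\<Union>(A, B)\<in>cl F G. \<Union>(A', B')\<in>cl F' G'. rel `` {(A * A', B * B')}) = cl (F * F') (G * G')"
    using cl_self[OF assms(1)] cl_self[OF assms(2)] by fast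
  then show ?thesis by (simp add: stalk_def)
qed

lemma R_add: assumes "(F, G) \<in> Fr" "(F', G') \<in> Fr" shows "cl F G \<oplus>\<^bsub>R\<^esub> cl F' G' = cl (F * G' + F' * G) (G * G')"
proof -
  have "rel `` {(A * B' + A' * B, B * B')} = cl (F * G' + F' * G) (G * G')" if "(A, B) \<in> cl F G" "(A', B') \<in> cl F' G'" for A B A' B'
  proof -
    have 1: "(A, B) \<in> Fr" "(A', B') \<in> Fr" "pe F * pe B = pe A * pe G" "pe F' * pe B' = pe A' * pe G'"
      using that unfolding mem_cl by blast+
    have "pe (A * B' + A' * B) * pe (G * G') = (pe A * pe G) * (pe B' * pe G') + (pe A' * pe G') * (pe B * pe G)"
      by (simp add: algebra_simps)
    also have "\<dots> = (pe F * pe B) * (pe B' * pe G') + (pe F' * pe B') * (pe B * pe G)" by (simp only: 1)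
    also have "\<dots> = pe (F * G' + F' * G) * pe (B * B')" by (simp add: algebra_simps)
    finally show ?thesis unfolding cl_def[of "A * B' + A' * B", symmetric]
      using cl_eq_iff[OF Fr_add[OF 1(1,2)] Fr_add[OF assms]] by blast
  qed
  then have "(\<Union>(A, B)\<in>cl F G. \<Union>(A', B')\<in>cl F' G'. rel `` {(A * B' + A' * B, B * B')}) = cl (F * G' + F' * G) (G * G')"
    using cl_self[OF assms(1)] cl_self[OF assms(2)] by fast
  then show ?thesis by (simp add: stalk_def)
qed

lemma R_one: "\<one>\<^bsub>R\<^esub> = cl 1 1" by (simp add: stalk_def cl_def)
lemma R_zero: "\<zero>\<^bsub>R\<^esub> = cl 0 1" by (simp add: stalk_def cl_def)

lemma R_uminus_add: assumes "(F, G) \<in> Fr" shows "cl (- F) G \<oplus>\<^bsub>R\<^esub> cl F G = \<zero>\<^bsub>R\<^esub>"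
  unfolding R_add[OF Fr_uminus[OF assms] assms] R_zero
  using cl_eq_iff[OF Fr_add[OF Fr_uminus[OF assms] assms] Fr_zero] by simp

lemma R_cring: "cring R"
proof (rule cringI)
  note ops = R_mult R_add R_one R_zero Fr_mult Fr_add Fr_one Fr_zero Fr_uminus cl_eq_iff carrier_RI
  show "abelian_group R"
  proof (rule abelian_groupI)
    fix U W assume "U \<in> carrier R" "W \<in> carrier R"
    then obtain F G F' G' where r: "(F, G) \<in> Fr" "U = cl F G" "(F', G') \<in> Fr" "W = cl F' G'" by (elim carrier_RE)
    show "U \<oplus>\<^bsub>R\<^esub> W \<in> carrier R" using r by (simp add: ops)
    show "U \<oplus>\<^bsub>R\<^esub> W = W \<oplus>\<^bsub>R\<^esub> U" using r by (simp add: ops algebra_simps)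
  next
    fix U W Z assume "U \<in> carrier R" "W \<in> carrier R" "Z \<in> carrier R"
    then obtain F G F' G' F'' G'' where r: "(F, G) \<in> Fr" "U = cl F G" "(F', G') \<in> Fr" "W = cl F' G'"
      "(F'', G'') \<in> Fr" "Z = cl F'' G''" by (elim carrier_RE)
    show "U \<oplus>\<^bsub>R\<^esub> W \<oplus>\<^bsub>R\<^esub> Z = U \<oplus>\<^bsub>R\<^esub> (W \<oplus>\<^bsub>R\<^esub> Z)" using r by (simp add: ops algebra_simps)
  next
    fix U assume "U \<in> carrier R"
    then obtain F G where r: "(F, G) \<in> Fr" "U = cl F G" by (elim carrier_RE)
    show "\<zero>\<^bsub>R\<^esub> \<oplus>\<^bsub>R\<^esub> U = U" using r by (simp add: ops)
    show "\<exists>W\<in>carrier R. W \<oplus>\<^bsub>R\<^esub> U = \<zero>\<^bsub>R\<^esub>" unfolding r(2)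
      using R_uminus_add[OF r(1)] carrier_RI[OF Fr_uminus[OF r(1)]] by (rule bexI)
  qed (simp add: ops)
  show "Group.comm_monoid R"
  proof (rule comm_monoidI)
    fix U W assume "U \<in> carrier R" "W \<in> carrier R"
    then obtain F G F' G' where r: "(F, G) \<in> Fr" "U = cl F G" "(F', G') \<in> Fr" "W = cl F' G'" by (elim carrier_RE)
    show "U \<otimes>\<^bsub>R\<^esub> W \<in> carrier R" using r by (simp add: ops)
    show "U \<otimes>\<^bsub>R\<^esub> W = W \<otimes>\<^bsub>R\<^esub> U" using r by (simp add: ops algebra_simps)
  next
    fix U W Z assume "U \<in> carrier R" "W \<in> carrier R" "Z \<in> carrier R"
    then obtain F G F' G' F'' G'' where r: "(F, G) \<in> Fr" "U = cl F G" "(F', G') \<in> Fr" "W = cl F' G'"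
      "(F'', G'') \<in> Fr" "Z = cl F'' G''" by (elim carrier_RE)
    show "U \<otimes>\<^bsub>R\<^esub> W \<otimes>\<^bsub>R\<^esub> Z = U \<otimes>\<^bsub>R\<^esub> (W \<otimes>\<^bsub>R\<^esub> Z)" using r by (simp add: ops algebra_simps)
  next
    fix U assume "U \<in> carrier R"
    then obtain F G where r: "(F, G) \<in> Fr" "U = cl F G" by (elim carrier_RE)
    show "\<one>\<^bsub>R\<^esub> \<otimes>\<^bsub>R\<^esub> U = U" using r by (simp add: ops)
  qed (simp add: ops)
next
  fix U W Z assume "U \<in> carrier R" "W \<in> carrier R" "Z \<in> carrier R"
  then obtain F G F' G' F'' G'' where r: "(F, G) \<in> Fr" "U = cl F G" "(F', G') \<in> Fr" "W = cl F' G'"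
    "(F'', G'') \<in> Fr" "Z = cl F'' G''" by (elim carrier_RE)
  show "(U \<oplus>\<^bsub>R\<^esub> W) \<otimes>\<^bsub>R\<^esub> Z = U \<otimes>\<^bsub>R\<^esub> Z \<oplus>\<^bsub>R\<^esub> W \<otimes>\<^bsub>R\<^esub> Z"
    unfolding r(2,4,6) R_add[OF r(1,3)] R_mult[OF Fr_add[OF r(1,3)] r(5)] R_mult[OF r(1,5)] R_mult[OF r(3,5)]
      R_add[OF Fr_mult[OF r(1,5)] Fr_mult[OF r(3,5)]]
      cl_eq_iff[OF Fr_mult[OF Fr_add[OF r(1,3)] r(5)] Fr_add[OF Fr_mult[OF r(1,5)] Fr_mult[OF r(3,5)]]]
    by (simp add: algebra_simps)
qed

lemma R_minus: assumes "(F, G) \<in> Fr" "(F', G') \<in> Fr" shows "cl F G \<ominus>\<^bsub>R\<^esub> cl F' G' = cl (F * G' - F' * G) (G * G')"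
proof -
  interpret R: cring R by (rule R_cring)
  have "cl (- F') G' \<oplus>\<^bsub>R\<^esub> cl F' G' = \<zero>\<^bsub>R\<^esub>" by (rule R_uminus_add[OF assms(2)])
  then have "\<ominus>\<^bsub>R\<^esub> cl F' G' = cl (- F') G'"
    using assms by (intro R.minus_equality) (auto simp: carrier_RI Fr_uminus)
  then show ?thesis using assms by (simp add: R.minus_eq R_add Fr_uminus)
qed

text \<open>The order of vanishing of a fraction at a point of the fibre. Denominators do not vanish there,
  so the order of the numerator of any representative can be taken (\<open>val_cl\<close>).\<close>

definition val :: "'k \<Rightarrow> ('k mpoly \<times> 'k mpoly) set \<Rightarrow> enat" where
  "val t U = (let F = fst (SOME x. x \<in> U) in if pe F = 0 then \<infinity> else enat (order t (pe F)))"

lemma val_cl: assumes "(F, G) \<in> Fr" "t \<in> T" shows "val t (cl F G) = (if pe F = 0 then \<infinity> else enat (order t (pe F)))"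
proof -
  define x where "x = (SOME x. x \<in> cl F G)"
  have "x \<in> cl F G" unfolding x_def by (rule someI) (rule cl_self[OF assms(1)])
  then obtain F' G' where x: "x = (F', G')" "(F', G') \<in> Fr" "pe F * pe G' = pe F' * pe G" unfolding mem_cl by (cases x) (auto simp: mem_cl)
  have G: "pe G \<noteq> 0" "pe G' \<noteq> 0" "order t (pe G) = 0" "order t (pe G') = 0"
    using Fr_pe[OF assms(1)] Fr_pe[OF x(2)] Fr_T[OF assms] Fr_T[OF x(2) assms(2)] by (auto intro: order_0I)
  have z: "pe F = 0 \<longleftrightarrow> pe F' = 0" using x(3) G by (metis mult_eq_0_iff)
  have "order t (pe F) = order t (pe F')" if "pe F \<noteq> 0"
  proof -
    have "order t (pe F * pe G') = order t (pe F' * pe G)" using x(3) by simp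
    then show ?thesis using that z G by (simp add: order_mult)
  qed
  then show ?thesis unfolding val_def x_def[symmetric] using z x(1) by (auto simp: Let_def)
qed

lemma val_ge_iff: "(F, G) \<in> Fr \<Longrightarrow> t \<in> T \<Longrightarrow> enat N \<le> val t (cl F G) \<longleftrightarrow> [:- t, 1:] ^ N dvd pe F"
  by (simp add: val_cl order_divides)

lemma val_mult:
  assumes "t \<in> T" "U \<in> carrier R" "W \<in> carrier R" shows "val t (U \<otimes>\<^bsub>R\<^esub> W) = val t U + val t W"
proof -
  obtain F G F' G' where r: "(F, G) \<in> Fr" "U = cl F G" "(F', G') \<in> Fr" "W = cl F' G'" using assms by (elim carrier_RE)
  show ?thesis using r assms(1) by (auto simp: R_mult val_cl Fr_mult order_mult)
qed

lemma val_add: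
  assumes "t \<in> T" "U \<in> carrier R" "W \<in> carrier R" shows "min (val t U) (val t W) \<le> val t (U \<oplus>\<^bsub>R\<^esub> W)"
proof -
  obtain F G F' G' where r: "(F, G) \<in> Fr" "U = cl F G" "(F', G') \<in> Fr" "W = cl F' G'" using assms by (elim carrier_RE)
  have v: "val t (U \<oplus>\<^bsub>R\<^esub> W) = (if pe F * pe G' + pe F' * pe G = 0 then \<infinity> else enat (order t (pe F * pe G' + pe F' * pe G)))"
    using r assms(1) by (simp add: R_add val_cl Fr_add)
  have ge: "enat N \<le> val t (U \<oplus>\<^bsub>R\<^esub> W)" if "enat N \<le> val t U" "enat N \<le> val t W" for N
  proof -
    have "[:- t, 1:] ^ N dvd pe F" "[:- t, 1:] ^ N dvd pe F'" using that r assms(1) by (simp_all add: val_ge_iff)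
    then have "[:- t, 1:] ^ N dvd pe (F * G' + F' * G)" by (simp add: dvd_add)
    then show ?thesis using r assms(1) by (simp only: R_add val_ge_iff[OF Fr_add])
  qed
  show ?thesis
  proof (cases "min (val t U) (val t W)")
    case (enat N) then show ?thesis using ge[of N] by (metis min.cobounded1 min.cobounded2)
  next
    case infinity
    then have "val t U = \<infinity>" "val t W = \<infinity>" by (auto simp: min_def split: if_splits)
    then have "pe F = 0" "pe F' = 0" using r assms(1) by (auto simp: val_cl split: if_splits)
    then show ?thesis using v by simp
  qed
qed

lemma val_inf: assumes "t \<in> T" "U \<in> carrier R" shows "val t U = \<infinity> \<longleftrightarrow> U = \<zero>\<^bsub>R\<^esub>"
proof -
  obtain F G where r: "(F, G) \<in> Fr" "U = cl F G" using assms by (elim carrier_RE)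
  show ?thesis using r assms(1) by (simp add: val_cl R_zero cl_eq_iff Fr_zero)
qed

lemma cl_unit:
  assumes r: "(F, G) \<in> Fr" and nz: "meval F v \<noteq> 0" shows "cl F G \<in> Units R"
proof -
  have r': "(G, F) \<in> Fr" using r nz unfolding Fr_iff by blast
  have "cl G F \<otimes>\<^bsub>R\<^esub> cl F G = \<one>\<^bsub>R\<^esub>" "cl F G \<otimes>\<^bsub>R\<^esub> cl G F = \<one>\<^bsub>R\<^esub>"
    unfolding R_mult[OF r' r] R_mult[OF r r'] R_one cl_eq_iff[OF Fr_mult[OF r' r] Fr_one] cl_eq_iff[OF Fr_mult[OF r r'] Fr_one]
    by simp_all
  then show ?thesis unfolding Units_def using carrier_RI r r' by blast
qed

lemma val_unit: assumes "t \<in> T" "U \<in> carrier R" "val t U = 0" shows "U \<in> Units R"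
proof -
  obtain F G where r: "(F, G) \<in> Fr" "U = cl F G" using assms by (elim carrier_RE)
  obtain e where e: "mform n e F" using r(1) unfolding Fr_iff by blast
  have "pe F \<noteq> 0" "order t (pe F) = 0" using assms r by (auto simp: val_cl zero_enat_def split: if_splits)
  then have "poly (pe F) t \<noteq> 0" by (simp add: order_root)
  then have "meval F v \<noteq> 0" using pe_T[OF e assms(1)] by simp
  then show ?thesis using cl_unit r by simp
qed

text \<open>The multiplier can be taken to be a constant of \<open>k\<close>, namely the quotient of the leading
  coefficients at \<open>t\<close>.\<close>

lemma val_residue:
  assumes t: "t \<in> T" and U: "U \<in> carrier R" and W: "W \<in> carrier R" and "val t U = enat N" "val t W = enat N"
  shows "\<exists>c\<in>carrier R. enat N < val t (U \<ominus>\<^bsub>R\<^esub> c \<otimes>\<^bsub>R\<^esub> W)"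
proof -
  obtain F G F' G' where r: "(F, G) \<in> Fr" "U = cl F G" "(F', G') \<in> Fr" "W = cl F' G'" using U W by (elim carrier_RE)
  have F0: "pe F \<noteq> 0" "order t (pe F) = N" "pe F' \<noteq> 0" "order t (pe F') = N"
    using assms r by (auto simp: val_cl split: if_splits)
  have "[:- t, 1:] ^ N dvd pe F" "[:- t, 1:] ^ N dvd pe F'" using F0 by (auto simp: order_divides)
  then obtain a b where a: "pe F = [:- t, 1:] ^ N * a" and b: "pe F' = [:- t, 1:] ^ N * b" by (elim dvdE)
  have bt: "poly b t \<noteq> 0"
  proof
    assume "poly b t = 0"
    then have "[:- t, 1:] dvd b" by (simp add: poly_eq_0_iff_dvd)
    then have "[:- t, 1:] ^ N * [:- t, 1:] dvd pe F'" unfolding b by (intro mult_dvd_mono) auto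
    then have "[:- t, 1:] ^ Suc N dvd pe F'" by (simp only: power_Suc2)
    then show False using F0 by (simp only: order_divides) simp
  qed
  define c where "c = poly a t * poly (pe G') t / (poly b t * poly (pe G) t)"
  have eq: "U \<ominus>\<^bsub>R\<^esub> cl (single 0 c) 1 \<otimes>\<^bsub>R\<^esub> W = cl (F * (1 * G') - (single 0 c * F') * G) (G * (1 * G'))"
    unfolding r(2,4) R_mult[OF Fr_const r(3)] R_minus[OF r(1) Fr_mult[OF Fr_const r(3)]] ..
  have fr: "(F * (1 * G') - (single 0 c * F') * G, G * (1 * G')) \<in> Fr"
    using Fr_add[OF r(1) Fr_uminus[OF Fr_mult[OF Fr_const[of c] r(3)]]] by simp
  have "poly (a * pe G' - [:c:] * b * pe G) t = 0" using bt Fr_T[OF r(1) t] by (simp add: c_def)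
  then have "[:- t, 1:] dvd a * pe G' - [:c:] * b * pe G" by (simp only: poly_eq_0_iff_dvd)
  then have "[:- t, 1:] ^ N * [:- t, 1:] dvd [:- t, 1:] ^ N * (a * pe G' - [:c:] * b * pe G)" by (intro mult_dvd_mono) auto
  moreover have "pe (F * (1 * G') - (single 0 c * F') * G) = [:- t, 1:] ^ N * (a * pe G' - [:c:] * b * pe G)"
    by (simp only: pe_simps a b) (simp add: algebra_simps)
  ultimately have "[:- t, 1:] ^ Suc N dvd pe (F * (1 * G') - (single 0 c * F') * G)" by (simp only: power_Suc2)
  then have "enat (Suc N) \<le> val t (U \<ominus>\<^bsub>R\<^esub> cl (single 0 c) 1 \<otimes>\<^bsub>R\<^esub> W)"
    unfolding eq using val_ge_iff[OF fr t] by blast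
  then show ?thesis using carrier_RI[OF Fr_const] by (auto simp: Suc_ile_eq intro!: bexI[of _ "cl (single 0 c) 1"])
qed

end

section \<open>Birationality and the conductor\<close>

lemma proportional_iff:
  fixes x v :: "'k::field vec"
  assumes x: "x \<in> carrier_vec n" "x \<noteq> 0\<^sub>v n" and v: "v \<in> carrier_vec n" "v \<noteq> 0\<^sub>v n"
  shows "proj_point x = proj_point v \<longleftrightarrow> (\<forall>i<n. \<forall>j<n. v $ i * x $ j = v $ j * x $ i)"
proof
  assume "proj_point x = proj_point v"
  then have "x \<in> proj_point v" using proj_point_self by metis
  then obtain c where "x = c \<cdot>\<^sub>v v" by (rule proj_pointE)
  then show "\<forall>i<n. \<forall>j<n. v $ i * x $ j = v $ j * x $ i" using v(1) by (auto simp: mult_ac)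
next
  assume eq: "\<forall>i<n. \<forall>j<n. v $ i * x $ j = v $ j * x $ i"
  obtain i where i: "i < n" "v $ i \<noteq> 0" by (rule nonzero_index[OF v])
  have xc: "x = (x $ i / v $ i) \<cdot>\<^sub>v v"
  proof (rule eq_vecI)
    fix j assume "j < dim_vec ((x $ i / v $ i) \<cdot>\<^sub>v v)"
    then have j: "j < n" using v(1) by simp
    have "v $ i * x $ j = v $ j * x $ i" using eq i(1) j by blast
    then show "x $ j = ((x $ i / v $ i) \<cdot>\<^sub>v v) $ j" using j i v(1) by (simp add: field_simps)
  qed (use x(1) v(1) in simp)
  have "x $ i / v $ i \<noteq> 0"
  proof
    assume z: "x $ i / v $ i = 0"
    have "x = 0 \<cdot>\<^sub>v v" using xc unfolding z .
    then have "x = 0\<^sub>v n" using v(1) by auto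
    then show False using x(2) by simp
  qed
  then have "proj_point ((x $ i / v $ i) \<cdot>\<^sub>v v) = proj_point v" by (rule proj_point_smult)
  then show "proj_point x = proj_point v" unfolding xc[symmetric] .
qed

text \<open>The coefficients \<open>a i = s^i\<close> work for general \<open>s\<close>: each \<open>z\<close> excludes only the roots of one nonzero
  polynomial in \<open>s\<close>.\<close>

lemma generic_combination:
  fixes \<phi> :: "'z \<Rightarrow> nat \<Rightarrow> 'k::alg_closed_field"
  assumes "finite Z" "\<And>z. z \<in> Z \<Longrightarrow> \<exists>i<n. \<phi> z i \<noteq> 0"
  shows "\<exists>a. \<forall>z\<in>Z. (\<Sum>i<n. a i * \<phi> z i) \<noteq> 0"
proof -
  define q where "q z = (\<Sum>i<n. monom (\<phi> z i) i)" for z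
  have "q z \<noteq> 0" if z: "z \<in> Z" for z
  proof -
    obtain i where i: "i < n" "\<phi> z i \<noteq> 0" using assms(2)[OF z] by blast
    have "poly.coeff (q z) i = \<phi> z i" using i(1) by (simp add: q_def coeff_sum)
    then show ?thesis using i(2) by auto
  qed
  then have "(\<Prod>z\<in>Z. q z) \<noteq> 0" using assms(1) by (simp add: prod_zero_iff)
  then obtain s where s: "poly (\<Prod>z\<in>Z. q z) s \<noteq> 0" using poly_eqI_pointwise[of "\<Prod>z\<in>Z. q z" 0] by auto
  have "(\<Sum>i<n. s ^ i * \<phi> z i) \<noteq> 0" if z: "z \<in> Z" for z
  proof -
    have "poly (q z) s \<noteq> 0" using s z assms(1) by (auto simp: poly_prod)
    then show ?thesis by (simp add: q_def poly_sum poly_monom mult.commute)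
  qed
  then show ?thesis by blast
qed

text \<open>Modulo a linear factor \<open>t - z\<close> of \<open>u\<close> the polynomial \<open>w\<close> is the nonzero constant \<open>w(z)\<close>, so
  \<open>t - z\<close> and \<open>w\<close> generate the unit ideal; the relations for the factors are multiplied.\<close>

lemma bezout_no_common_root:
  fixes u w :: "'k::alg_closed_field poly"
  assumes "u \<noteq> 0" "\<And>z. poly u z = 0 \<Longrightarrow> poly w z \<noteq> 0"
  shows "\<exists>\<alpha> \<beta>. \<alpha> * u + \<beta> * w = 1"
  using assms
proof (induction "degree u" arbitrary: u)
  case 0
  then obtain c where c: "u = [:c:]" "c \<noteq> 0" by (metis degree_eq_zeroE pCons_0_0)
  then have "[:1 / c:] * u + 0 * w = 1" by (simp add: one_pCons)
  then show ?case by blast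
next
  case (Suc k)
  obtain z where z: "poly u z = 0" using alg_closed_imp_poly_has_root[of u] Suc(2) by auto
  then have "[:- z, 1:] dvd u" by (simp add: poly_eq_0_iff_dvd)
  then obtain u' where u': "u = [:- z, 1:] * u'" by (elim dvdE)
  have u'0: "u' \<noteq> 0" using u' Suc(3) by auto
  have "degree u = Suc (degree u')" unfolding u' using u'0 by (subst degree_mult_eq) auto
  then have "k = degree u'" using Suc(2) by simp
  moreover have "\<And>z. poly u' z = 0 \<Longrightarrow> poly w z \<noteq> 0" using Suc(4) u' by simp
  ultimately obtain \<alpha> \<beta> where ab: "\<alpha> * u' + \<beta> * w = 1" using Suc(1) u'0 by blast
  have wz: "poly w z \<noteq> 0" using Suc(4) z by blast
  have "poly (w - [:poly w z:]) z = 0" by simp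
  then have "[:- z, 1:] dvd w - [:poly w z:]" by (simp only: poly_eq_0_iff_dvd)
  then obtain w1 where "w - [:poly w z:] = [:- z, 1:] * w1" by (elim dvdE)
  then have w1: "w - [:- z, 1:] * w1 = [:poly w z:]" by (simp add: algebra_simps)
  define l where "l = [:- z, 1:]"
  define r where "r = [:1 / poly w z:]"
  have r: "r * (w - [:- z, 1:] * w1) = 1" unfolding w1 r_def using wz by (simp add: one_pCons)
  have "1 = \<alpha> * u' * (r * (w - [:- z, 1:] * w1)) + \<beta> * w" using ab unfolding r by simp
  also have "\<dots> = (- (\<alpha> * r * w1)) * u + (\<alpha> * u' * r + \<beta>) * w"
    unfolding u' l_def[symmetric] by (simp add: algebra_simps)
  finally show ?case by metis
qed

lemma factor_orders:
  fixes p :: "'k::field poly"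
  assumes "finite T" "p \<noteq> 0" "\<And>t. t \<in> T \<Longrightarrow> k t \<le> order t p"
  shows "\<exists>q. p = (\<Prod>t\<in>T. [:- t, 1:] ^ k t) * q"
  using assms
proof (induction T arbitrary: p rule: finite_induct)
  case (insert s T)
  have "[:- s, 1:] ^ k s dvd p" using insert by (simp add: order_divides)
  then obtain p' where p': "p = [:- s, 1:] ^ k s * p'" by (elim dvdE)
  have p0: "p' \<noteq> 0" using p' insert by auto
  have ord0: "order t ([:- s, 1:] ^ m) = 0" if "t \<noteq> s" for t m
    using that by (intro order_0I) simp
  have nz: "[:- s, 1:] ^ k s * p' \<noteq> 0" using p' insert(4) by argo
  have "\<exists>q. p' = (\<Prod>t\<in>T. [:- t, 1:] ^ k t) * q"
  proof (rule insert.IH[OF p0])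
    fix t assume t: "t \<in> T"
    then have "t \<noteq> s" using insert(2) by blast
    then have "order t p = order t p'" by (simp only: p' order_mult[OF nz] ord0[OF \<open>t \<noteq> s\<close>] add_0)
    then show "k t \<le> order t p'" using insert(5)[of t] t by simp
  qed
  then obtain q where "p' = (\<Prod>t\<in>T. [:- t, 1:] ^ k t) * q" by blast
  then have "p = (\<Prod>t\<in>insert s T. [:- t, 1:] ^ k t) * q"
    using p' by (simp only: prod.insert[OF insert(1,2)] mult.assoc)
  then show ?case by blast
qed simp

lemma order_prod_linear:
  fixes T :: "'k::field set"
  assumes "finite T" "s \<in> T" shows "order s (\<Prod>t\<in>T. [:- t, 1:] ^ k t) = k s"
proof -
  have nz: "(\<Prod>t\<in>T - {s}. [:- t, 1:] ^ k t) \<noteq> (0 :: 'k poly)" using assms(1) by (simp add: prod_zero_iff)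
  have "poly (\<Prod>t\<in>T - {s}. [:- t, 1:] ^ k t) s \<noteq> 0" using assms(1) by (auto simp: poly_prod prod_zero_iff)
  then have "order s (\<Prod>t\<in>T - {s}. [:- t, 1:] ^ k t) = 0" by (rule order_0I)
  then show ?thesis using assms nz order_power_n_n[of s "k s"]
    by (simp add: prod.remove[of T s] order_mult del: mult_pCons_left)
qed

locale birational_point = curve_point +
  assumes birational: "birational_onto_curve g"
begin

lemma pe_sum: "pe (\<Sum>a\<in>A. F a) = (\<Sum>a\<in>A. pe (F a))"
  by (induction A rule: infinite_finite_induct) auto

lemma mform_const_mult: "mform n e F \<Longrightarrow> mform n e (single 0 c * F)" for F :: "'a mpoly"
  using mform_mult[OF mform_single, of n e F c] by simp

text \<open>The forms \<open>A1\<close> and \<open>A2\<close> are the components of the inverse map \<open>[F0 : F1]\<close> in the basis \<open>\<gamma>, \<eta>\<close>.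
  As \<open>[F0 : F1]\<close> is the point \<open>\<gamma> + t \<eta>\<close>, the coordinate \<open>t\<close> is the fraction \<open>A2/A1\<close> on the curve.\<close>

lemma inverse_forms:
  obtains e A1 A2 where "mform n e A1" "mform n e A2" "pe A1 \<noteq> 0" "pe A2 = [:0, 1:] * pe A1"
proof -
  have dg: "dim_vec g = n" using g by simp
  obtain e F0 F1 where F: "mform n e F0" "mform n e F1" and nv: "\<not> (vanishes_on F0 (curve g) \<and> vanishes_on F1 (curve g))"
    and inv: "\<forall>q\<in>proj_space 2. \<forall>u\<in>Psi g q. (meval F0 u, meval F1 u) \<noteq> (0, 0) \<longrightarrow>
        proj_point (vec_of_list [meval F0 u, meval F1 u]) = q"
    using birational unfolding birational_onto_curve_def dg by (elim exE conjE)
  define A1 where "A1 = single 0 (\<eta> $ 1) * F0 - single 0 (\<eta> $ 0) * F1"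
  define A2 where "A2 = single 0 (\<gamma> $ 0) * F1 - single 0 (\<gamma> $ 1) * F0"
  have m: "mform n e A1" "mform n e A2" unfolding A1_def A2_def by (intro mform_diff mform_const_mult F)+
  have rel: "poly (pe F0) t * cpt t $ 1 = poly (pe F1) t * cpt t $ 0" for t
  proof (cases "(meval F0 (gvec g (cpt t)), meval F1 (gvec g (cpt t))) = (0, 0)")
    case False
    let ?u = "vec_of_list [meval F0 (gvec g (cpt t)), meval F1 (gvec g (cpt t))]"
    have q: "proj_point (cpt t) \<in> proj_space 2" unfolding proj_space_def using cpt_carrier cpt_nonzero by blast
    have u: "gvec g (cpt t) \<in> Psi g (proj_point (cpt t))"
      unfolding Psi_proj_point[OF forms g cpt_carrier] by (rule proj_point_self)
    have "proj_point ?u = proj_point (cpt t)" by (rule inv[rule_format, OF q u False])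
    then have "?u \<in> proj_point (cpt t)" using proj_point_self by metis
    then obtain c where "?u = c \<cdot>\<^sub>v cpt t" by (rule proj_pointE)
    then have "?u $ 0 = c * cpt t $ 0" "?u $ 1 = c * cpt t $ 1" using cpt_carrier[of t] by auto
    then show ?thesis unfolding poly_pe[OF F(1)] poly_pe[OF F(2)] vec_of_list_2 by simp
  qed (simp add: poly_pe[OF F(1)] poly_pe[OF F(2)])
  have eq: "pe A2 = [:0, 1:] * pe A1"
  proof (rule poly_eqI_pointwise)
    fix t show "poly (pe A2) t = poly ([:0, 1:] * pe A1) t"
      using rel[of t] unfolding cpt_index A1_def A2_def by (simp add: algebra_simps)
  qed
  have "pe A1 \<noteq> 0"
  proof
    assume A1: "pe A1 = 0"
    have z: "\<eta> $ 1 * poly (pe F0) t = \<eta> $ 0 * poly (pe F1) t" "\<gamma> $ 0 * poly (pe F1) t = \<gamma> $ 1 * poly (pe F0) t" for t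
    proof -
      have "poly (pe A1) t = 0" "poly (pe A2) t = 0" using A1 eq by simp_all
      then show "\<eta> $ 1 * poly (pe F0) t = \<eta> $ 0 * poly (pe F1) t" "\<gamma> $ 0 * poly (pe F1) t = \<gamma> $ 1 * poly (pe F0) t"
        by (simp_all add: A1_def A2_def)
    qed
    have "pe F0 = 0"
    proof (rule poly_eqI_pointwise)
      fix t
      have "poly (pe F0) t = (\<gamma> $ 0 * \<eta> $ 1 - \<gamma> $ 1 * \<eta> $ 0) * poly (pe F0) t" unfolding det by simp
      also have "\<dots> = \<gamma> $ 0 * (\<eta> $ 1 * poly (pe F0) t) - \<eta> $ 0 * (\<gamma> $ 1 * poly (pe F0) t)" by (simp add: algebra_simps)
      also have "\<dots> = 0" unfolding z(1) z(2)[symmetric] by (simp add: algebra_simps)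
      finally show "poly (pe F0) t = poly 0 t" by simp
    qed
    moreover have "pe F1 = 0"
    proof (rule poly_eqI_pointwise)
      fix t
      have "poly (pe F1) t = (\<gamma> $ 0 * \<eta> $ 1 - \<gamma> $ 1 * \<eta> $ 0) * poly (pe F1) t" unfolding det by simp
      also have "\<dots> = \<eta> $ 1 * (\<gamma> $ 0 * poly (pe F1) t) - \<gamma> $ 1 * (\<eta> $ 0 * poly (pe F1) t)" by (simp add: algebra_simps)
      also have "\<dots> = 0" unfolding z(2) z(1)[symmetric] by (simp add: algebra_simps)
      finally show "poly (pe F1) t = poly 0 t" by simp
    qed
    ultimately show False using nv vanishes_iff F by blast
  qed
  then show thesis using that m eq by blast
qed

lemma d_pos: "d > 0"
proof (rule ccontr)
  assume "\<not> d > 0"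
  obtain e A1 A2 where A: "mform n e A1" "mform n e A2" "pe A1 \<noteq> 0" "pe A2 = [:0, 1:] * pe A1" by (rule inverse_forms)
  have "degree (pe A2) = 0" using degree_pe[OF A(2)] \<open>\<not> d > 0\<close> by simp
  moreover have "degree (pe A2) = Suc (degree (pe A1))" unfolding A(4) using A(3) by (subst degree_mult_eq) auto
  ultimately show False by simp
qed

definition xvar :: "nat \<Rightarrow> 'a mpoly" where "xvar i = single (single i 1) 1"

lemma mform_xvar: "i < n \<Longrightarrow> mform n 1 (xvar i)" by (auto simp: xvar_def mform_def)
lemma pe_xvar: "pe (xvar i) = dehom (g $ i)"
  by (simp add: xvar_def pe_def comm_ring_hom.mev_single[OF lift_hom] mon_single one_pCons[symmetric])
lemma meval_xvar: "meval (xvar i) u = u $ i"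
  by (simp add: xvar_def meval_mev comm_ring_hom.mev_single[OF id_hom] mon_single)

text \<open>Two linear combinations of the \<open>g\<^sub>i\<close> without a common zero. The first is some \<open>g\<^sub>i\<close> that is nonzero
  at infinity, the second a general combination, nonzero at the roots of the first.\<close>

lemma two_generators:
  obtains U W where "mform n 1 U" "mform n 1 W" "degree (pe U) = d" "pe U \<noteq> 0" "\<And>z. poly (pe U) z = 0 \<Longrightarrow> poly (pe W) z \<noteq> 0"
proof -
  obtain i where i: "i < n" "beval (g $ i) \<eta> \<noteq> 0" using nocz[OF \<eta> \<eta>_nonzero] by blast
  have deg: "degree (pe (xvar i)) = d" unfolding pe_xvar using degree_dehom_eq i forms by blast
  then have nz: "pe (xvar i) \<noteq> 0" using d_pos by auto
  have "\<exists>a. \<forall>z\<in>{z. poly (pe (xvar i)) z = 0}. (\<Sum>j<n. a j * poly (dehom (g $ j)) z) \<noteq> 0"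
  proof (rule generic_combination)
    show "finite {z. poly (pe (xvar i)) z = 0}" using nz by (rule poly_roots_finite)
    fix z
    show "\<exists>j<n. poly (dehom (g $ j)) z \<noteq> 0" unfolding poly_dehom using nocz[OF cpt_carrier cpt_nonzero] .
  qed
  then obtain a where a: "\<And>z. poly (pe (xvar i)) z = 0 \<Longrightarrow> (\<Sum>j<n. a j * poly (dehom (g $ j)) z) \<noteq> 0" by blast
  define W where "W = (\<Sum>j<n. single 0 (a j) * xvar j)"
  have "mform n 1 W" unfolding W_def by (intro mform_sum mform_const_mult mform_xvar) simp
  moreover have "poly (pe W) z = (\<Sum>j<n. a j * poly (dehom (g $ j)) z)" for z
    unfolding W_def pe_sum by (simp add: poly_sum pe_xvar)
  ultimately show thesis using that[OF mform_xvar[OF i(1)], of W] deg nz a by simp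
qed

text \<open>Reducing the coefficient of \<open>w\<close> modulo \<open>u\<close> bounds its degree, and then the degree of the
  coefficient of \<open>u\<close> is bounded by comparison.\<close>

lemma decompose_degree:
  fixes u w P :: "'a poly"
  assumes uw: "degree u = d" "u \<noteq> 0" "degree w \<le> d" "\<And>z. poly u z = 0 \<Longrightarrow> poly w z \<noteq> 0"
    and P: "degree P \<le> m + d" "d \<le> m + 1"
  shows "\<exists>s r. P = s * u + r * w \<and> degree s \<le> m \<and> degree r \<le> m"
proof -
  obtain \<alpha> \<beta> where ab: "\<alpha> * u + \<beta> * w = 1" using bezout_no_common_root[OF uw(2,4)] by blast
  define q where "q = (P * \<beta>) div u"
  define r where "r = (P * \<beta>) mod u"
  define s where "s = P * \<alpha> + q * w"
  have dm: "P * \<beta> = q * u + r" unfolding q_def r_def by (simp only: div_mult_mod_eq)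
  have "P = P * (\<alpha> * u + \<beta> * w)" unfolding ab by simp
  also have "\<dots> = P * \<alpha> * u + (P * \<beta>) * w" by (simp add: algebra_simps)
  also have "\<dots> = s * u + r * w" unfolding dm by (simp add: s_def algebra_simps)
  finally have eq: "P = s * u + r * w" .
  have r: "degree r < d" using degree_mod_less[OF uw(2), of "P * \<beta>"] d_pos uw(1) by (auto simp: r_def)
  have "degree (r * w) \<le> degree r + degree w" by (rule degree_mult_le)
  then have "degree (r * w) \<le> m + d" using r uw(3) P(2) by linarith
  then have su: "degree (s * u) \<le> m + d" using eq P(1) degree_diff_le[of P "m + d" "r * w"] by (simp add: eq_diff_eq)
  have "degree s \<le> m"
  proof (cases "s = 0")
    case False
    then show ?thesis using su uw(1,2) by (simp add: degree_mult_eq)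
  qed simp
  then show ?thesis using eq r P(2) by (intro exI[of _ s] exI[of _ r]) simp
qed

text \<open>If \<open>P = \<Sum> a\<^sub>i t^i\<close> has degree at most \<open>d\<close>, then \<open>A1^d P\<close> is the pullback of
  \<open>\<Sum> a\<^sub>i A2^i A1^(d-i)\<close>. Higher degrees are reached by writing \<open>P = s u + r w\<close> with two pulled
  back linear forms \<open>u, w\<close>; this raises the degree of the form by one and keeps the factor \<open>A1^d\<close>.\<close>

lemma conductor_form:
  obtains e c where "c \<noteq> 0" "\<And>P j. degree P \<le> (j + 1) * d \<Longrightarrow> \<exists>F. mform n (e + j) F \<and> pe F = c * P"
proof -
  obtain e A1 A2 where A: "mform n e A1" "mform n e A2" "pe A1 \<noteq> 0" "pe A2 = [:0, 1:] * pe A1" by (rule inverse_forms)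
  obtain U W where UW: "mform n 1 U" "mform n 1 W" "degree (pe U) = d" "pe U \<noteq> 0" "\<And>z. poly (pe U) z = 0 \<Longrightarrow> poly (pe W) z \<noteq> 0"
    by (rule two_generators) blast
  define c where "c = pe A1 ^ d"
  have "\<exists>F. mform n (d * e + j) F \<and> pe F = c * P" if "degree P \<le> (j + 1) * d" for P j
    using that
  proof (induction j arbitrary: P)
    case 0
    define F where "F = (\<Sum>i\<le>d. single 0 (poly.coeff P i) * (A2 ^ i * A1 ^ (d - i)))"
    have "mform n (d * e) (A2 ^ i * A1 ^ (d - i))" if "i \<le> d" for i
      using mform_mult[OF mform_power[OF A(2), of i] mform_power[OF A(1), of "d - i"]] that
      by (simp add: add_mult_distrib[symmetric])
    then have "mform n (d * e) F" unfolding F_def by (intro mform_sum mform_const_mult) simp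
    moreover have "pe F = c * P"
    proof -
      have "pe F = (\<Sum>i\<le>d. [:poly.coeff P i:] * ([:0, 1:] ^ i * c))"
        unfolding F_def pe_sum
      proof (rule sum.cong)
        fix i assume "i \<in> {..d}"
        then have "pe A1 ^ i * pe A1 ^ (d - i) = c" by (simp add: c_def power_add[symmetric])
        then show "pe (single 0 (poly.coeff P i) * (A2 ^ i * A1 ^ (d - i))) = [:poly.coeff P i:] * ([:0, 1:] ^ i * c)"
          unfolding pe_simps A(4) by (simp only: power_mult_distrib mult.assoc)
      qed simp
      also have "\<dots> = c * (\<Sum>i\<le>d. monom (poly.coeff P i) i)"
        by (simp add: sum_distrib_left monom_altdef algebra_simps)
      also have "(\<Sum>i\<le>d. monom (poly.coeff P i) i) = P" using 0 by (intro poly_as_sum_of_monoms') simp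
      finally show ?thesis .
    qed
    ultimately show ?case by auto
  next
    case (Suc j)
    have dW: "degree (pe W) \<le> d" using degree_pe[OF UW(2)] by simp
    have "\<exists>s r. P = s * pe U + r * pe W \<and> degree s \<le> (j + 1) * d \<and> degree r \<le> (j + 1) * d"
      by (rule decompose_degree[OF UW(3,4) dW UW(5)]) (use Suc(2) in \<open>auto simp: algebra_simps\<close>)
    then obtain s r where sr: "P = s * pe U + r * pe W" "degree s \<le> (j + 1) * d" "degree r \<le> (j + 1) * d" by blast
    obtain F where F: "mform n (d * e + j) F" "pe F = c * s" using Suc.IH[OF sr(2)] by blast
    obtain F' where F': "mform n (d * e + j) F'" "pe F' = c * r" using Suc.IH[OF sr(3)] by blast
    have "mform n (d * e + Suc j) (F * U + F' * W)"
      using mform_mult[OF F(1) UW(1)] mform_mult[OF F'(1) UW(2)] by (simp add: mform_add)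
    moreover have "pe (F * U + F' * W) = c * P" using F F' by (simp add: sr(1) algebra_simps)
    ultimately show ?case by blast
  qed
  then show thesis using that[of c "d * e"] A(3) by (simp add: c_def)
qed

text \<open>Some minor of \<open>v\<close> and \<open>g(w)\<close> is nonzero; it is the value at \<open>v\<close> of a linear form that vanishes at
  \<open>g(w)\<close>.\<close>

lemma separating_form:
  assumes w: "w \<in> carrier_vec 2" "w \<noteq> 0\<^sub>v 2" and ne: "proj_point (gvec g w) \<noteq> p"
  obtains L where "mform n 1 L" "meval L v \<noteq> 0" "meval L (gvec g w) = 0"
proof -
  let ?x = "gvec g w"
  obtain i j where ij: "i < n" "j < n" "v $ i * ?x $ j \<noteq> v $ j * ?x $ i"
    using proportional_iff[OF gvec_carrier gvec_nonzero[OF w] v_carrier v_nonzero] ne by blast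
  define L where "L = single 0 (?x $ j) * xvar i - single 0 (?x $ i) * xvar j"
  have "mform n 1 L" unfolding L_def by (intro mform_diff mform_const_mult mform_xvar ij)
  moreover have "meval L u = ?x $ j * u $ i - ?x $ i * u $ j" for u
    unfolding L_def meval_mev comm_ring_hom.mev_diff[OF id_hom] comm_ring_hom.mev_mult[OF id_hom] comm_ring_hom.mev_single[OF id_hom] mon_0
    using meval_xvar[of i u] meval_xvar[of j u] unfolding meval_mev by simp
  ultimately show thesis using that[of L] ij(3) by (simp add: mult.commute)
qed

text \<open>For each root \<open>z\<close> of \<open>b\<close> a linear form that vanishes at the image of \<open>z\<close>, but not at \<open>p\<close>, pulls
  back to a multiple of the linear factor.\<close>

lemma clear_denominator:
  assumes "b \<noteq> 0" "\<And>t. t \<in> T \<Longrightarrow> poly b t \<noteq> 0"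
  shows "\<exists>k G. mform n k G \<and> meval G v \<noteq> 0 \<and> b dvd pe G"
  using assms
proof (induction "degree b" arbitrary: b)
  case 0
  then obtain c where c: "b = [:c:]" "c \<noteq> 0" by (metis degree_eq_zeroE pCons_0_0)
  then have "1 = b * [:1 / c:]" by (simp add: one_pCons)
  then have "b dvd pe 1" unfolding pe_simps by (rule dvdI)
  moreover have "meval 1 v \<noteq> 0" unfolding meval_mev comm_ring_hom.mev_1[OF id_hom] by simp
  ultimately show ?case using mform_1 by blast
next
  case (Suc m)
  obtain z where z: "poly b z = 0" using alg_closed_imp_poly_has_root[of b] Suc(2) by auto
  then have "[:- z, 1:] dvd b" by (simp add: poly_eq_0_iff_dvd)
  then obtain b' where b': "b = [:- z, 1:] * b'" by (elim dvdE)
  have b'0: "b' \<noteq> 0" using b' Suc(3) by auto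
  have "degree b = Suc (degree b')" unfolding b' using b'0 by (subst degree_mult_eq) auto
  then have "m = degree b'" using Suc(2) by simp
  moreover have "\<And>t. t \<in> T \<Longrightarrow> poly b' t \<noteq> 0" using Suc(4) b' by simp
  ultimately obtain k G where G: "mform n k G" "meval G v \<noteq> 0" "b' dvd pe G" using Suc(1) b'0 by blast
  have "z \<notin> T" using Suc(4) z by blast
  then have "proj_point (gvec g (cpt z)) \<noteq> p" by (simp add: T_def)
  then obtain L where L: "mform n 1 L" "meval L v \<noteq> 0" "meval L (gvec g (cpt z)) = 0"
    using separating_form[OF cpt_carrier cpt_nonzero] by blast
  have "poly (pe L) z = 0" using L(3) poly_pe[OF L(1)] by simp
  then have "[:- z, 1:] dvd pe L" by (simp add: poly_eq_0_iff_dvd)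
  then have "b dvd pe (L * G)" unfolding b' pe_simps using G(3) by (intro mult_dvd_mono)
  moreover have "meval (L * G) v \<noteq> 0" using L(2) G(2) unfolding meval_mev comm_ring_hom.mev_mult[OF id_hom] by simp
  ultimately show ?case using mform_mult[OF L(1) G(1)] by blast
qed

text \<open>The powers of \<open>L\<close> serve as denominators whose pullback has smaller degree than a form of the same
  degree can have.\<close>

lemma form_vanishing_at_infinity:
  obtains L where "mform n 1 L" "meval L v \<noteq> 0" "degree (pe L) \<le> d - 1"
proof -
  obtain L where L: "mform n 1 L" "meval L v \<noteq> 0" "meval L (gvec g \<eta>) = 0"
    using separating_form[OF \<eta> \<eta>_nonzero off] by blast
  have b: "bform d (be L)" using bform_be[OF L(1)] by simp
  have "poly.coeff (pe L) d = 0" using coeff_dehom[OF b] beval_be[OF L(1)] L(3) by (simp add: dehom_be)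
  moreover have "degree (pe L) \<le> d" using degree_dehom[OF b] by (simp add: dehom_be)
  ultimately have "degree (pe L) \<noteq> d" using d_pos by (metis degree_0 leading_coeff_0_iff less_irrefl)
  then have "degree (pe L) \<le> d - 1" using \<open>degree (pe L) \<le> d\<close> by simp
  then show thesis using that L by blast
qed

lemma finite_T: "finite T"
proof -
  obtain i j where ij: "i < n" "j < n" "v $ i * gvec g \<eta> $ j \<noteq> v $ j * gvec g \<eta> $ i"
    using proportional_iff[OF gvec_carrier gvec_nonzero[OF \<eta> \<eta>_nonzero] v_carrier v_nonzero] off by blast
  define f where "f = [:[:v $ i:]:] * g $ j - [:[:v $ j:]:] * g $ i"
  have f: "bform d f" unfolding f_def using forms ij by (intro bform_diff bform_const_mult) auto
  have "beval f \<eta> \<noteq> 0" using ij g by (simp add: f_def gvec_def del: mult_pCons_left)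
  then have "dehom f \<noteq> 0" using coeff_dehom[OF f] by auto
  then have "finite {t. poly (dehom f) t = 0}" by (rule poly_roots_finite)
  moreover have "T \<subseteq> {t. poly (dehom f) t = 0}"
  proof
    fix t assume "t \<in> T"
    then have "proj_point (gvec g (cpt t)) = p" by (simp add: T_def)
    then have "v $ i * gvec g (cpt t) $ j = v $ j * gvec g (cpt t) $ i"
      using proportional_iff[OF gvec_carrier gvec_nonzero[OF cpt_carrier cpt_nonzero] v_carrier v_nonzero] ij(1,2) by blast
    then show "t \<in> {t. poly (dehom f) t = 0}" using ij g by (simp add: f_def poly_dehom gvec_def del: mult_pCons_left dehom_simps)
  qed
  ultimately show ?thesis by (rule finite_subset[rotated])
qed

definition represents :: "'a poly \<Rightarrow> 'a poly \<Rightarrow> bool" where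
  "represents P Q \<longleftrightarrow> (\<exists>F G. (F, G) \<in> Fr \<and> pe F * Q = P * pe G)"

text \<open>With the factor \<open>c\<close> of \<open>conductor_form\<close>, the constant \<open>degree c\<close> works. Split \<open>Q c = \<pi> b\<close> into the
  part \<open>\<pi>\<close> supported on \<open>T\<close> and a part \<open>b\<close> without zeros in \<open>T\<close>. The hypothesis gives \<open>P = \<pi> P'\<close>, so
  \<open>P/Q = c P'/b\<close>; here \<open>b\<close> can be completed to the pullback of a form nonzero at \<open>p\<close>, and after
  multiplication by a power of \<open>L\<close> the numerator is a pullback as well.\<close>

lemma conductor_exists:
  "\<exists>C. \<forall>P Q. Q \<noteq> 0 \<longrightarrow> (\<forall>t\<in>T. P = 0 \<or> order t Q + C \<le> order t P) \<longrightarrow> represents P Q"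
proof -
  obtain e c where c: "c \<noteq> 0" "\<And>P j. degree P \<le> (j + 1) * d \<Longrightarrow> \<exists>F. mform n (e + j) F \<and> pe F = c * P"
    by (rule conductor_form) blast
  obtain L where L: "mform n 1 L" "meval L v \<noteq> 0" "degree (pe L) \<le> d - 1" by (rule form_vanishing_at_infinity)
  have "represents P Q" if Q: "Q \<noteq> 0" and ord: "\<forall>t\<in>T. P = 0 \<or> order t Q + degree c \<le> order t P" for P Q
  proof (cases "P = 0")
    case True then show ?thesis unfolding represents_def using Fr_zero by (intro exI[of _ 0] exI[of _ 1]) simp
  next
    case P: False
    define \<pi> where "\<pi> = (\<Prod>t\<in>T. [:- t, 1:] ^ order t (Q * c))"
    have Qc: "Q * c \<noteq> 0" using Q c by simp
    have oQc: "order t (Q * c) = order t Q + order t c" for t using Qc by (rule order_mult)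
    have leP: "order t (Q * c) \<le> order t P" if "t \<in> T" for t
      using that ord P order_degree[OF c(1), of t] unfolding oQc by fastforce
    from factor_orders[where k = "\<lambda>t. order t (Q * c)", OF finite_T P leP] obtain P' where P': "P = \<pi> * P'"
      unfolding \<pi>_def by blast
    from factor_orders[where k = "\<lambda>t. order t (Q * c)", OF finite_T Qc order_refl] obtain b where b: "Q * c = \<pi> * b"
      unfolding \<pi>_def by blast
    have b0: "b \<noteq> 0" "\<pi> \<noteq> 0" using b Qc by auto
    have "poly b t \<noteq> 0" if t: "t \<in> T" for t
    proof -
      have "order t (Q * c) = order t \<pi> + order t b" using b Qc order_mult[of \<pi> b t] by simp
      moreover have "order t \<pi> = order t (Q * c)" unfolding \<pi>_def by (rule order_prod_linear[OF finite_T t])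
      ultimately have "order t b = 0" by simp
      then show ?thesis using b0 by (simp add: order_root)
    qed
    then obtain k G0 where G0: "mform n k G0" "meval G0 v \<noteq> 0" "b dvd pe G0" using clear_denominator b0 by blast
    obtain b' where b': "pe G0 = b * b'" using G0(3) by (elim dvdE)
    \<comment> \<open>Each of \<open>r\<close> factors \<open>L\<close> adds at most \<open>d - 1\<close> to the degree of the pullback, but \<open>d\<close> to the bound
      in \<open>conductor_form\<close>. The gain \<open>r\<close> pays for the degree of \<open>P' b'\<close> and for \<open>e\<close> more factors \<open>L\<close>,
      which match the amount \<open>e\<close> by which \<open>conductor_form\<close> raises the degree.\<close>
    define r where "r = degree (P' * b') + e * (d - 1)"
    define s where "s = e + r"
    have "degree (P' * b' * pe L ^ s) \<le> degree (P' * b') + degree (pe L ^ s)" by (rule degree_mult_le)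
    also have "degree (pe L ^ s) \<le> degree (pe L) * s" by (rule degree_power_le)
    also have "degree (pe L) * s \<le> (d - 1) * s" using L(3) by simp
    also have "degree (P' * b') + (d - 1) * s \<le> (k + r + 1) * d"
    proof -
      obtain d' where d': "d = Suc d'" using d_pos by (cases d) auto
      show ?thesis unfolding s_def r_def d' by (simp add: algebra_simps)
    qed
    finally obtain F where F: "mform n (e + (k + r)) F" "pe F = c * (P' * b' * pe L ^ s)" using c(2) by fastforce
    define G where "G = G0 * L ^ s"
    have "mform n (k + s) G" unfolding G_def using mform_mult[OF G0(1) mform_power[OF L(1), of s]] by simp
    moreover have "k + s = e + (k + r)" by (simp add: s_def)
    moreover have "meval G v \<noteq> 0" unfolding G_def using G0(2) L(2)
      unfolding meval_mev comm_ring_hom.mev_mult[OF id_hom] comm_ring_hom.mev_power[OF id_hom] by simp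
    ultimately have "(F, G) \<in> Fr" unfolding Fr_iff using F(1) by auto
    moreover have "pe F * Q = P * pe G"
    proof -
      have "pe F * Q = (Q * c) * (P' * b' * pe L ^ s)" by (simp add: F(2) mult_ac)
      also have "\<dots> = P * pe G" unfolding b P' by (simp add: G_def b' mult_ac)
      finally show ?thesis .
    qed
    ultimately show ?thesis unfolding represents_def by blast
  qed
  then show ?thesis by blast
qed

end

section \<open>The greatest common divisor attached to a point\<close>

text \<open>The Pluecker relation by which the minors \<open>v\<^sub>l g\<^sub>j - v\<^sub>j g\<^sub>l\<close> for one fixed \<open>l\<close> with \<open>v\<^sub>l \<noteq> 0\<close>
  generate all minors.\<close>

lemma minor_relation:
  fixes a b c x y z :: "'r::comm_ring_1"
  shows "a * (b * y - c * x) = b * (a * y - c * z) - c * (a * x - b * z)"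
  by (simp add: algebra_simps)

lemma minors_vanish_iff:
  fixes g :: "'k::field poly poly vec"
  assumes g: "g \<in> carrier_vec n" and v: "v \<in> carrier_vec n" "v \<noteq> 0\<^sub>v n" and x: "gvec g w \<noteq> 0\<^sub>v n"
  shows "(\<forall>f\<in>minors v g. beval f w = 0) \<longleftrightarrow> proj_point (gvec g w) = proj_point v"
proof -
  have xc: "gvec g w \<in> carrier_vec n" using g by (simp add: gvec_def)
  have "(\<forall>f\<in>minors v g. beval f w = 0) \<longleftrightarrow>
      (\<forall>i<n. \<forall>j<n. beval ([:[:v $ i:]:] * g $ j - [:[:v $ j:]:] * g $ i) w = 0)"
    unfolding minors_def carrier_vecD[OF g] by blast
  also have "\<dots> \<longleftrightarrow> (\<forall>i<n. \<forall>j<n. v $ i * gvec g w $ j = v $ j * gvec g w $ i)"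
    using g by (simp add: gvec_def del: mult_pCons_left)
  also have "\<dots> \<longleftrightarrow> proj_point (gvec g w) = proj_point v"
    using proportional_iff[OF xc x v] by simp
  finally show ?thesis .
qed

text \<open>The zeros of \<open>h\<close> are the common zeros of the minors because the quotients by \<open>h\<close> have none, and
  the minors of \<open>v\<close> and \<open>g(w)\<close> vanish if and only if the two vectors are proportional.\<close>

lemma gcd_minors:
  fixes g :: "'k::alg_closed_field poly poly vec"
  assumes g: "g \<in> carrier_vec n" and forms: "\<forall>i<n. bform d (g $ i)"
    and nz: "\<And>w. w \<in> carrier_vec 2 \<Longrightarrow> w \<noteq> 0\<^sub>v 2 \<Longrightarrow> gvec g w \<noteq> 0\<^sub>v n"
    and v: "v \<in> carrier_vec n" "v \<noteq> 0\<^sub>v n" and h: "is_gcd_of h (minors v g)"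
    and w0: "w0 \<in> carrier_vec 2" "w0 \<noteq> 0\<^sub>v 2" "proj_point (gvec g w0) \<noteq> proj_point v"
  shows "h \<noteq> 0" "\<exists>i. bform i h"
    "\<And>w. w \<in> carrier_vec 2 \<Longrightarrow> w \<noteq> 0\<^sub>v 2 \<Longrightarrow> beval h w = 0 \<longleftrightarrow> proj_point (gvec g w) = proj_point v"
proof -
  have dg: "dim_vec g = n" using g by simp
  have bf: "\<And>f. f \<in> minors v g \<Longrightarrow> bform d f" by (rule bform_minors[OF forms dg])
  obtain f0 where f0: "f0 \<in> minors v g" "beval f0 w0 \<noteq> 0" using minors_vanish_iff[OF g v nz[OF w0(1,2)]] w0(3) by blast
  have f0': "f0 \<noteq> 0" using f0(2) by auto
  have hd: "\<And>f. f \<in> minors v g \<Longrightarrow> h dvd f" using h by (simp add: is_gcd_of_def)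
  show "h \<noteq> 0" using hd[OF f0(1)] f0' by auto
  show "\<exists>i. bform i h" using bform_dvd[OF bf[OF f0(1)] f0' hd[OF f0(1)]] by blast
  fix w :: "'k vec" assume w: "w \<in> carrier_vec 2" "w \<noteq> 0\<^sub>v 2"
  show "beval h w = 0 \<longleftrightarrow> proj_point (gvec g w) = proj_point v"
    unfolding minors_vanish_iff[OF g v nz[OF w], symmetric]
  proof
    assume z: "beval h w = 0"
    show "\<forall>f\<in>minors v g. beval f w = 0"
    proof
      fix f assume "f \<in> minors v g"
      from hd[OF this] obtain q where "f = h * q" by (elim dvdE)
      then show "beval f w = 0" using z by simp
    qed
  next
    assume z: "\<forall>f\<in>minors v g. beval f w = 0"
    obtain f' where "h * f' \<in> minors v g" "beval f' w \<noteq> 0"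
      using bform_gcd_quotient_nonzero[OF bf f0(1) f0' h w] by blast
    then have "beval (h * f') w = 0" using z by blast
    then show "beval h w = 0" using \<open>beval f' w \<noteq> 0\<close> by simp
  qed
qed

locale gcd_point = birational_point +
  fixes h :: "'a poly poly"
  assumes h: "is_gcd_of h (minors v g)"
begin

lemma h_props: "h \<noteq> 0" "\<exists>i. bform i h"
  "\<lbrakk>w \<in> carrier_vec 2; w \<noteq> 0\<^sub>v 2\<rbrakk> \<Longrightarrow> beval h w = 0 \<longleftrightarrow> proj_point (gvec g w) = p"
  using gcd_minors[OF g forms _ v_carrier v_nonzero h \<eta> \<eta>_nonzero off] gvec_nonzero by simp_all

lemma h_\<eta>: "beval h \<eta> \<noteq> 0" using h_props(3)[OF \<eta> \<eta>_nonzero] off by simp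

lemma T_eq: "T = {t. poly (dehom h) t = 0}"
  unfolding T_def poly_dehom using h_props(3)[OF cpt_carrier cpt_nonzero] by blast

lemma dehom_h_nonzero: "dehom h \<noteq> 0"
  using h_props(1,2) dehom_eq_0 by blast

definition mult_at :: "'a \<Rightarrow> nat" where "mult_at t = order t (dehom h)"

lemma total_degree_h: "total_degree h = (\<Sum>t\<in>T. mult_at t)"
proof -
  obtain i where i: "bform i h" using h_props(2) by blast
  have "total_degree h = i" by (rule total_degree_bform[OF i h_props(1)])
  also have "\<dots> = degree (dehom h)" using degree_dehom_eq[OF i h_\<eta>] by simp
  also have "\<dots> = (\<Sum>t\<in>T. order t (dehom h))"
    by (rule sum_order_eq_degree[symmetric, OF dehom_h_nonzero finite_T]) (simp add: T_eq)
  finally show ?thesis by (simp add: mult_at_def)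
qed

lemma card_linear_factors_h: "card (linear_factors h // associated_rel) = card T"
proof -
  obtain i where i: "bform i h" using h_props(2) by blast
  show ?thesis unfolding T_eq by (rule card_linear_factors[OF i h_props(1) h_\<eta>])
qed

lemma h_dvd_minor:
  assumes "i < n" "j < n" shows "h dvd [:[:v $ i:]:] * g $ j - [:[:v $ j:]:] * g $ i"
proof -
  have "[:[:v $ i:]:] * g $ j - [:[:v $ j:]:] * g $ i \<in> minors v g"
    unfolding minors_def carrier_vecD[OF g] using assms by blast
  moreover have "\<forall>s\<in>minors v g. h dvd s" using h unfolding is_gcd_of_def by (rule conjunct1)
  ultimately show ?thesis by (rule bspec[rotated])
qed

text \<open>Modulo \<open>h\<close> the vectors \<open>v\<^sub>l g\<close> and \<open>g\<^sub>l v\<close> agree. Applying \<open>F\<close> to both gives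
  \<open>v\<^sub>l^e F(g) \<equiv> g\<^sub>l^e F(v) = 0\<close>.\<close>

lemma dehom_h_dvd:
  assumes F: "mform n e F" and z: "meval F v = 0" shows "dehom h dvd pe F"
proof -
  obtain l where l: "l < n" "v $ l \<noteq> 0" by (rule nonzero_index[OF v_carrier v_nonzero])
  have "dehom h dvd mev (\<lambda>c. [:c:]) (\<lambda>i. [:v $ l:] * dehom (g $ i)) F - mev (\<lambda>c. [:c:]) (\<lambda>i. dehom (g $ l) * [:v $ i:]) F"
  proof (rule dvd_mev_cong[OF F])
    fix i assume i: "i < n"
    obtain q where "[:[:v $ l:]:] * g $ i - [:[:v $ i:]:] * g $ l = h * q" using h_dvd_minor[OF l(1) i] by (elim dvdE)
    then have "dehom ([:[:v $ l:]:] * g $ i - [:[:v $ i:]:] * g $ l) = dehom (h * q)" by (rule arg_cong)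
    then have "[:v $ l:] * dehom (g $ i) - dehom (g $ l) * [:v $ i:] = dehom h * dehom q"
      by (simp only: dehom_simps mult.commute[of "dehom (g $ l)"])
    then show "dehom h dvd [:v $ l:] * dehom (g $ i) - dehom (g $ l) * [:v $ i:]" by (rule dvdI)
  qed
  moreover have "mev (\<lambda>c. [:c:]) (\<lambda>i. dehom (g $ l) * [:v $ i:]) F = 0"
  proof -
    have "mev (\<lambda>c. [:c:]) (\<lambda>i. [:v $ i:]) F = [:meval F v:]"
      unfolding meval_mev mev_hom[OF lift_hom] ..
    then show ?thesis unfolding mev_scale[OF F] using z by simp
  qed
  ultimately have "dehom h dvd [:v $ l:] ^ e * pe F" unfolding mev_scale[OF F] pe_def by simp
  moreover have "[:v $ l:] ^ e = [:(v $ l) ^ e:]" by (simp add: poly_const_pow)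
  ultimately have "dehom h dvd Polynomial.smult ((v $ l) ^ e) (pe F)" by simp
  then show ?thesis using l(2) by (simp add: dvd_smult_iff)
qed

text \<open>Write \<open>v\<^sub>l g\<^sub>j - v\<^sub>j g\<^sub>l = h q\<^sub>j\<close>. The \<open>q\<^sub>j\<close> generate all quotients of minors by \<open>h\<close> and thus have no
  common zero, so that a general combination of them is nonzero on \<open>T\<close>. The corresponding
  combination of the linear forms \<open>v\<^sub>l X\<^sub>j - v\<^sub>j X\<^sub>l\<close> has the orders of \<open>h\<close>.\<close>

lemma reduction_form:
  obtains L where "mform n 1 L" "pe L \<noteq> 0" "\<And>t. t \<in> T \<Longrightarrow> order t (pe L) = mult_at t"
proof -
  obtain l where l: "l < n" "v $ l \<noteq> 0" by (rule nonzero_index[OF v_carrier v_nonzero])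
  have "\<exists>q. [:[:v $ l:]:] * g $ j - [:[:v $ j:]:] * g $ l = h * q" if "j < n" for j
    using h_dvd_minor[OF l(1) that] by (elim dvdE) blast
  then obtain q where q: "\<And>j. j < n \<Longrightarrow> [:[:v $ l:]:] * g $ j - [:[:v $ j:]:] * g $ l = h * q j" by metis
  have qz: "\<exists>j<n. poly (dehom (q j)) t \<noteq> 0" for t
  proof (rule ccontr)
    assume "\<not> ?thesis"
    then have z: "\<And>j. j < n \<Longrightarrow> beval (q j) (cpt t) = 0" by (simp add: poly_dehom)
    have bf: "\<And>f. f \<in> minors v g \<Longrightarrow> bform d f" by (rule bform_minors[OF forms]) (use g in auto)
    obtain f0 where f0: "f0 \<in> minors v g" "beval f0 \<eta> \<noteq> 0"
      using minors_vanish_iff[OF g v_carrier v_nonzero gvec_nonzero[OF \<eta> \<eta>_nonzero]] off by blast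
    have "f0 \<noteq> 0" using f0(2) by auto
    then obtain f' where f': "h * f' \<in> minors v g" "beval f' (cpt t) \<noteq> 0"
      using bform_gcd_quotient_nonzero[OF bf f0(1) _ h cpt_carrier cpt_nonzero] by blast
    then obtain i j where ij: "i < n" "j < n" "h * f' = [:[:v $ i:]:] * g $ j - [:[:v $ j:]:] * g $ i"
      unfolding minors_def carrier_vecD[OF g] by blast
    have "h * ([:[:v $ l:]:] * f') = [:[:v $ l:]:] * (h * f')" by (rule mult.left_commute)
    also have "\<dots> = [:[:v $ i:]:] * ([:[:v $ l:]:] * g $ j - [:[:v $ j:]:] * g $ l) - [:[:v $ j:]:] * ([:[:v $ l:]:] * g $ i - [:[:v $ i:]:] * g $ l)"
      unfolding ij(3) by (rule minor_relation)
    also have "\<dots> = h * ([:[:v $ i:]:] * q j - [:[:v $ j:]:] * q i)"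
      unfolding q[OF ij(1)] q[OF ij(2)] right_diff_distrib by (simp only: mult.left_commute)
    finally have "[:[:v $ l:]:] * f' = [:[:v $ i:]:] * q j - [:[:v $ j:]:] * q i" unfolding mult_left_cancel[OF h_props(1)] .
    then have "beval ([:[:v $ l:]:] * f') (cpt t) = beval ([:[:v $ i:]:] * q j - [:[:v $ j:]:] * q i) (cpt t)" by (rule arg_cong)
    then show False using z[OF ij(1)] z[OF ij(2)] f'(2) l(2) by (simp del: mult_pCons_left)
  qed
  have "\<exists>a. \<forall>t\<in>T. (\<Sum>j<n. a j * poly (dehom (q j)) t) \<noteq> 0"
    by (rule generic_combination[OF finite_T]) (rule qz)
  then obtain a where a: "\<And>t. t \<in> T \<Longrightarrow> (\<Sum>j<n. a j * poly (dehom (q j)) t) \<noteq> 0" by blast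
  define L where "L = (\<Sum>j<n. single 0 (a j) * (single 0 (v $ l) * xvar j - single 0 (v $ j) * xvar l))"
  define Q where "Q = (\<Sum>j<n. [:a j:] * dehom (q j))"
  have m: "mform n 1 L" unfolding L_def
    by (intro mform_sum mform_const_mult mform_diff mform_xvar l(1)) simp
  have peL: "pe L = dehom h * Q"
    unfolding L_def Q_def pe_sum sum_distrib_left
  proof (rule sum.cong)
    fix j assume "j \<in> {..<n}"
    then have "dehom ([:[:v $ l:]:] * g $ j - [:[:v $ j:]:] * g $ l) = dehom (h * q j)" using q by simp
    then have "[:v $ l:] * dehom (g $ j) - [:v $ j:] * dehom (g $ l) = dehom h * dehom (q j)" by (simp only: dehom_simps)
    then show "pe (single 0 (a j) * (single 0 (v $ l) * xvar j - single 0 (v $ j) * xvar l)) = dehom h * ([:a j:] * dehom (q j))"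
      unfolding pe_simps pe_xvar by (simp only: mult.left_commute)
  qed simp
  have Qt: "poly Q t \<noteq> 0" if "t \<in> T" for t
    using a[OF that] by (simp add: Q_def poly_sum)
  obtain t0 where "t0 \<in> T" by (rule fibre_point)
  then have Q0: "Q \<noteq> 0" using Qt by auto
  then have L0: "pe L \<noteq> 0" using peL dehom_h_nonzero by simp
  have "order t (pe L) = mult_at t" if t: "t \<in> T" for t
    using order_mult[of "dehom h" Q t] L0 peL order_0I[OF Qt[OF t]] by (simp add: mult_at_def)
  then show thesis by (rule that[OF m L0])
qed

lemma representsE:
  assumes "represents P Q" obtains F G where "(F, G) \<in> Fr" "pe F * Q = P * pe G"
  using assms unfolding represents_def by blast

lemma valued_local_ring_R:
  obtains C x where "valued_local_ring R T val mult_at C x"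
proof -
  from conductor_exists obtain C where C0:
    "\<forall>P Q. Q \<noteq> 0 \<longrightarrow> (\<forall>t\<in>T. P = 0 \<or> order t Q + C \<le> order t P) \<longrightarrow> represents P Q" by (elim exE)
  have C: "represents P Q" if "Q \<noteq> 0" "\<And>t. t \<in> T \<Longrightarrow> P = 0 \<or> order t Q + C \<le> order t P" for P Q
    by (rule C0[rule_format, OF that(1)]) (rule that(2))
  obtain L where L: "mform n 1 L" "pe L \<noteq> 0" "\<And>t. t \<in> T \<Longrightarrow> order t (pe L) = mult_at t" by (rule reduction_form) blast
  obtain l where l: "l < n" "v $ l \<noteq> 0" by (rule nonzero_index[OF v_carrier v_nonzero])
  have frL: "(L, xvar l) \<in> Fr" unfolding Fr_iff using L(1) mform_xvar[OF l(1)] l(2) by (auto simp: meval_xvar)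
  interpret R: cring R by (rule R_cring)
  have Fr_order: "order t (pe G) = 0" if "(F, G) \<in> Fr" "t \<in> T" for F G t
    using Fr_T[OF that] by (rule order_0I)
  have "valued_local_ring R T val mult_at C (cl L (xvar l))"
  proof (unfold_locales)
    show "finite T" by (rule finite_T)
    show "T \<noteq> {}" by (rule T_nonempty)
  next
    fix t assume "t \<in> T"
    then show "0 < mult_at t" using dehom_h_nonzero by (simp add: mult_at_def order_gt_0_iff T_eq)
  next
    fix t r s assume "t \<in> T" "r \<in> carrier R" "s \<in> carrier R"
    then show "val t (r \<otimes>\<^bsub>R\<^esub> s) = val t r + val t s" "min (val t r) (val t s) \<le> val t (r \<oplus>\<^bsub>R\<^esub> s)"
      by (rule val_mult, rule val_add)
  next
    fix t r assume t: "t \<in> T" and r: "r \<in> carrier R"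
    show "val t r = \<infinity> \<longleftrightarrow> r = \<zero>\<^bsub>R\<^esub>" by (rule val_inf[OF t r])
    show "val t r = 0 \<Longrightarrow> r \<in> Units R" by (rule val_unit[OF t r])
    show "enat (mult_at t) \<le> val t r" if nu: "r \<notin> Units R"
    proof -
      obtain F G where FG: "(F, G) \<in> Fr" "r = cl F G" using r by (rule carrier_RE)
      obtain e where e: "mform n e F" using FG(1) unfolding Fr_iff by blast
      have "meval F v = 0" using cl_unit[OF FG(1)] nu FG(2) by blast
      then have "dehom h dvd pe F" by (rule dehom_h_dvd[OF e])
      moreover have "[:- t, 1:] ^ mult_at t dvd dehom h" unfolding mult_at_def by (rule order_1)
      ultimately have "[:- t, 1:] ^ mult_at t dvd pe F" by (rule dvd_trans[rotated])
      then show ?thesis unfolding FG(2) val_ge_iff[OF FG(1) t] .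
    qed
  next
    show "cl L (xvar l) \<in> carrier R" by (rule carrier_RI[OF frL])
    fix t assume "t \<in> T"
    then show "val t (cl L (xvar l)) = enat (mult_at t)" using val_cl[OF frL] L by simp
  next
    fix t r s N assume "t \<in> T" "r \<in> carrier R" "s \<in> carrier R" "val t r = enat N" "val t s = enat N"
    then show "\<exists>c\<in>carrier R. enat N < val t (r \<ominus>\<^bsub>R\<^esub> c \<otimes>\<^bsub>R\<^esub> s)" by (rule val_residue)
  next
    fix r s assume r: "r \<in> carrier R" and s: "s \<in> carrier R" and s0: "s \<noteq> \<zero>\<^bsub>R\<^esub>"
      and le: "\<And>t. t \<in> T \<Longrightarrow> val t s + enat C \<le> val t r"
    obtain F G where FG: "(F, G) \<in> Fr" "r = cl F G" using r by (rule carrier_RE)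
    obtain F' G' where FG': "(F', G') \<in> Fr" "s = cl F' G'" using s by (rule carrier_RE)
    have nz: "pe F' \<noteq> 0" "pe G \<noteq> 0" "pe G' \<noteq> 0"
      using s0 FG' Fr_pe[OF FG(1)] Fr_pe[OF FG'(1)] cl_eq_iff[OF FG'(1) Fr_zero] by (auto simp: R_zero)
    have "represents (pe F * pe G') (pe F' * pe G)"
    proof (rule C)
      show "pe F' * pe G \<noteq> 0" using nz by simp
      fix t assume t: "t \<in> T"
      show "pe F * pe G' = 0 \<or> order t (pe F' * pe G) + C \<le> order t (pe F * pe G')"
      proof (cases "pe F = 0")
        case False
        have "order t (pe F') + C \<le> order t (pe F)"
          using le[OF t] False nz by (simp add: FG FG' val_cl[OF FG(1) t] val_cl[OF FG'(1) t])
        then show ?thesis using False nz Fr_order[OF FG(1) t] Fr_order[OF FG'(1) t] by (simp add: order_mult)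
      qed simp
    qed
    then obtain A B where AB: "(A, B) \<in> Fr" "pe A * (pe F' * pe G) = pe F * pe G' * pe B" by (rule representsE)
    have "r = cl A B \<otimes>\<^bsub>R\<^esub> s"
      unfolding FG(2) FG'(2) R_mult[OF AB(1) FG'(1)] cl_eq_iff[OF FG(1) Fr_mult[OF AB(1) FG'(1)]]
      using AB(2) by (simp add: mult_ac)
    then show "\<exists>u\<in>carrier R. r = u \<otimes>\<^bsub>R\<^esub> s" using carrier_RI[OF AB(1)] by blast
  next
    fix \<alpha> :: "'a \<Rightarrow> nat" assume \<alpha>: "\<And>t. t \<in> T \<Longrightarrow> C \<le> \<alpha> t"
    define P where "P = (\<Prod>t\<in>T. [:- t, 1:] ^ \<alpha> t)"
    have P0: "P \<noteq> 0" unfolding P_def using finite_T by (simp add: prod_zero_iff)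
    have oP: "order t P = \<alpha> t" if "t \<in> T" for t unfolding P_def by (rule order_prod_linear[OF finite_T that])
    have "represents P 1" by (rule C) (use oP \<alpha> in auto)
    then obtain F G where FG: "(F, G) \<in> Fr" "pe F * 1 = P * pe G" by (rule representsE)
    have "val t (cl F G) = enat (\<alpha> t)" if t: "t \<in> T" for t
      using FG(2) P0 Fr_pe[OF FG(1)] Fr_order[OF FG(1) t] oP[OF t] by (simp add: val_cl[OF FG(1) t] order_mult)
    then show "\<exists>r\<in>carrier R. \<forall>t\<in>T. val t r = enat (\<alpha> t)" using carrier_RI[OF FG(1)] by blast
  next
    fix t assume t: "t \<in> T"
    \<comment> \<open>The element \<open>y\<close> has the pullback \<open>P\<close>, up to units. Multiplying \<open>P\<close> by a polynomial \<open>E\<close> that is \<open>1\<close>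
      modulo a high power of \<open>X - t\<close> and \<open>0\<close> modulo those at the other points stays in \<open>R\<close>, because
      \<open>P\<close> already has order \<open>C\<close> everywhere.\<close>
    define P where "P = (\<Prod>s\<in>T. [:- s, 1:] ^ C)"
    have P0: "P \<noteq> 0" unfolding P_def using finite_T by (simp add: prod_zero_iff)
    have oP: "order s P = C" if "s \<in> T" for s unfolding P_def by (rule order_prod_linear[OF finite_T that])
    have "represents P 1" by (rule C) (use oP in auto)
    then obtain F G where FG: "(F, G) \<in> Fr" "pe F * 1 = P * pe G" by (rule representsE)
    have y0: "cl F G \<noteq> \<zero>\<^bsub>R\<^esub>" unfolding R_zero cl_eq_iff[OF FG(1) Fr_zero] using FG P0 Fr_pe[OF FG(1)] by simp
    have approx: "\<exists>r\<in>carrier R. enat N \<le> val t (r \<ominus>\<^bsub>R\<^esub> cl F G) \<and> (\<forall>s\<in>T - {t}. enat N \<le> val s r)" for N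
    proof -
      define u where "u = [:- t, 1:] ^ N"
      define w where "w = (\<Prod>s\<in>T - {t}. [:- s, 1:] ^ N)"
      have "\<exists>\<alpha> \<beta>. \<alpha> * u + \<beta> * w = 1"
      proof (rule bezout_no_common_root)
        show "u \<noteq> 0" by (simp add: u_def)
        fix z assume "poly u z = 0"
        then have "z = t" by (cases N) (auto simp: u_def)
        then show "poly w z \<noteq> 0" using finite_T by (auto simp: w_def poly_prod prod_zero_iff)
      qed
      then obtain \<alpha> \<beta> where ab: "\<alpha> * u + \<beta> * w = 1" by blast
      define E where "E = \<beta> * w"
      have E1: "E - 1 = - (\<alpha> * u)" using ab by (simp add: E_def algebra_simps)
      have "represents (P * E) 1"
      proof (rule C)
        fix s assume s: "s \<in> T"
        show "P * E = 0 \<or> order s 1 + C \<le> order s (P * E)"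
          using oP[OF s] by (cases "E = 0") (auto simp: order_mult P0)
      qed simp
      then obtain F' G' where FG': "(F', G') \<in> Fr" "pe F' * 1 = P * E * pe G'" by (rule representsE)
      have fr: "(F' * G - F * G', G' * G) \<in> Fr" using Fr_add[OF FG'(1) Fr_uminus[OF FG(1)]] by simp
      have "pe (F' * G - F * G') = P * pe G * pe G' * (E - 1)"
        using FG(2) FG'(2) by (simp add: algebra_simps)
      also have "\<dots> = u * (- (P * pe G * pe G' * \<alpha>))" unfolding E1 by (simp add: algebra_simps)
      finally have "u dvd pe (F' * G - F * G')" by (rule dvdI)
      then have "enat N \<le> val t (cl F' G' \<ominus>\<^bsub>R\<^esub> cl F G)"
        unfolding R_minus[OF FG'(1) FG(1)] val_ge_iff[OF fr t] u_def .
      moreover have "enat N \<le> val s (cl F' G')" if s: "s \<in> T - {t}" for s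
      proof -
        have "[:- s, 1:] ^ N dvd w" unfolding w_def by (rule dvd_prodI) (use finite_T s in auto)
        then have "[:- s, 1:] ^ N dvd P * E * pe G'" unfolding E_def by (intro dvd_mult2 dvd_mult)
        then have "[:- s, 1:] ^ N dvd pe F'" using FG'(2) by simp
        then show ?thesis using val_ge_iff[OF FG'(1)] s by blast
      qed
      ultimately show ?thesis using carrier_RI[OF FG'(1)] by blast
    qed
    show "\<exists>y\<in>carrier R. y \<noteq> \<zero>\<^bsub>R\<^esub> \<and> (\<forall>N. \<exists>r\<in>carrier R. enat N \<le> val t (r \<ominus>\<^bsub>R\<^esub> y) \<and> (\<forall>s\<in>T - {t}. enat N \<le> val s r))"
      by (rule bexI[of _ "cl F G"]) (use y0 approx carrier_RI[OF FG(1)] in auto)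
  qed
  then show thesis using that by blast
qed

theorem multiplicity_and_branches:
  "real (total_degree h) = curve_multiplicity n (curve g) p"
  "finite (branches n (curve g) p)"
  "card (linear_factors h // associated_rel) = card (branches n (curve g) p)"
proof -
  obtain C x where vlr: "valued_local_ring R T val mult_at C x" by (rule valued_local_ring_R)
  show "real (total_degree h) = curve_multiplicity n (curve g) p"
    unfolding curve_multiplicity_def valued_local_ring.multiplicity_eq[OF vlr] total_degree_h ..
  show "finite (branches n (curve g) p)"
    unfolding branches_def by (rule valued_local_ring.branches_count(1)[OF vlr])
  show "card (linear_factors h // associated_rel) = card (branches n (curve g) p)"
    unfolding branches_def valued_local_ring.branches_count(2)[OF vlr] by (rule card_linear_factors_h)
qed

end

lemma chart_exists:
  fixes \<eta> :: "'k::alg_closed_field vec"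
  assumes \<eta>: "\<eta> \<in> carrier_vec 2" "\<eta> \<noteq> 0\<^sub>v 2" shows "\<exists>\<gamma>. chart \<gamma> \<eta>"
proof (cases "\<eta> $ 1 = 0")
  case True
  then have n0: "\<eta> $ 0 \<noteq> 0" using vec2_nonzero[OF \<eta>(1)] \<eta>(2) by blast
  define \<gamma> where "\<gamma> = vec_of_list [0, - (1 / \<eta> $ 0)]"
  have "chart \<gamma> \<eta>"
  proof
    show "\<gamma> \<in> carrier_vec 2" unfolding \<gamma>_def by (rule vec_of_list_2)
    show "\<eta> \<in> carrier_vec 2" by (rule \<eta>)
    show "\<gamma> $ 0 * \<eta> $ 1 - \<gamma> $ 1 * \<eta> $ 0 = 1" unfolding \<gamma>_def vec_of_list_2 using n0 by simp
  qed
  then show ?thesis by blast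
next
  case False
  define \<gamma> where "\<gamma> = vec_of_list [1 / \<eta> $ 1, 0]"
  have "chart \<gamma> \<eta>"
  proof
    show "\<gamma> \<in> carrier_vec 2" unfolding \<gamma>_def by (rule vec_of_list_2)
    show "\<eta> \<in> carrier_vec 2" by (rule \<eta>)
    show "\<gamma> $ 0 * \<eta> $ 1 - \<gamma> $ 1 * \<eta> $ 0 = 1" unfolding \<gamma>_def vec_of_list_2 using False by simp
  qed
  then show ?thesis by blast
qed

text \<open>If every point were mapped to \<open>P\<close>, the inverse map would send \<open>P\<close> to every point of the line.\<close>

lemma birational_not_constant:
  fixes g :: "'k::alg_closed_field poly poly vec"
  assumes g: "g \<in> carrier_vec n" and forms: "\<forall>i<n. bform d (g $ i)" and bir: "birational_onto_curve g"
  shows "\<exists>w. w \<in> carrier_vec 2 \<and> w \<noteq> 0\<^sub>v 2 \<and> proj_point (gvec g w) \<noteq> P"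
proof (rule ccontr)
  assume "\<not> ?thesis"
  then have const: "\<And>w. w \<in> carrier_vec 2 \<Longrightarrow> w \<noteq> 0\<^sub>v 2 \<Longrightarrow> proj_point (gvec g w) = P" by blast
  obtain e F0 F1 where nv: "\<not> (vanishes_on F0 (curve g) \<and> vanishes_on F1 (curve g))"
    and inv: "\<forall>q\<in>proj_space 2. \<forall>u\<in>Psi g q. (meval F0 u, meval F1 u) \<noteq> (0, 0) \<longrightarrow>
        proj_point (vec_of_list [meval F0 u, meval F1 u]) = q"
    using bir unfolding birational_onto_curve_def by (elim exE conjE)
  obtain q u where q: "q \<in> curve g" "u \<in> q" "(meval F0 u, meval F1 u) \<noteq> (0, 0)"
    using nv unfolding vanishes_on_def by auto
  have "q = P" using q(1) const unfolding curve_eq[OF forms g] by blast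
  then have uP: "u \<in> P" using q(2) by simp
  have eq: "proj_point (vec_of_list [meval F0 u, meval F1 u]) = proj_point w" if w: "w \<in> carrier_vec 2" "w \<noteq> 0\<^sub>v 2" for w
  proof -
    have 1: "proj_point w \<in> proj_space 2" unfolding proj_space_def using w by blast
    have 2: "u \<in> Psi g (proj_point w)" unfolding Psi_proj_point[OF forms g w(1)] const[OF w] by (rule uP)
    show ?thesis by (rule inv[rule_format, OF 1 2 q(3)])
  qed
  let ?a = "vec_of_list [1, 0 :: 'k]" and ?b = "vec_of_list [0, 1 :: 'k]"
  have a: "?a \<in> carrier_vec 2" "?a \<noteq> 0\<^sub>v 2" "?b \<in> carrier_vec 2" "?b \<noteq> 0\<^sub>v 2"
    using vec_of_list_2[of 1 "0 :: 'k"] vec_of_list_2[of 0 "1 :: 'k"] by (simp_all add: vec2_nonzero del: vec_of_list_Cons)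
  have "proj_point ?a = proj_point ?b" using eq[OF a(1,2)] eq[OF a(3,4)] by simp
  then have "?a \<in> proj_point ?b" using proj_point_self by metis
  then obtain c where c: "?a = c \<cdot>\<^sub>v ?b" by (rule proj_pointE)
  have "?a $ 0 = c * ?b $ 0" by (subst c) (simp del: vec_of_list_Cons add: carrier_vecD[OF a(3)])
  then show False unfolding vec_of_list_2 by simp
qed

text \<open>As \<open>gcd_I1\<close> is the result of a choice, the existence of a greatest common divisor is needed as
  well; it holds for the minors by \<open>bform_gcd_exists\<close>, and both sets have the same divisors.\<close>

lemma gcd_I1_minors:
  fixes g :: "'k::alg_closed_field poly poly vec"
  assumes g: "g \<in> carrier_vec n" and forms: "\<forall>i<n. bform d (g $ i)"
    and nocz: "\<And>w. w \<in> carrier_vec 2 \<Longrightarrow> w \<noteq> 0\<^sub>v 2 \<Longrightarrow> \<exists>i<n. beval (g $ i) w \<noteq> 0"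
    and hb: "hilbert_burch g \<delta> \<phi>" and v: "v \<in> carrier_vec n"
    and f0: "f0 \<in> minors v g" "f0 \<noteq> 0"
  shows "is_gcd_of (gcd_I1 v \<phi>) (minors v g)"
proof -
  have cd: "\<And>E. (\<forall>s\<in>row_entries v \<phi>. E dvd s) \<longleftrightarrow> (\<forall>s\<in>minors v g. E dvd s)"
    by (rule common_divisors_minors[OF g forms nocz hb v f0])
  then have iff: "is_gcd_of h (row_entries v \<phi>) \<longleftrightarrow> is_gcd_of h (minors v g)" for h
    unfolding is_gcd_of_def by simp
  have "\<exists>h. is_gcd_of h (minors v g)"
    by (rule bform_gcd_exists[of _ d, OF _ f0]) (rule bform_minors[OF forms], use g in auto)
  then have "\<exists>h. is_gcd_of h (row_entries v \<phi>)" unfolding iff .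
  then have "is_gcd_of (gcd_I1 v \<phi>) (row_entries v \<phi>)" unfolding gcd_I1_def gcd_of_def by (rule someI_ex)
  then show ?thesis unfolding iff .
qed

theorem theorem1p8:
  fixes g :: "'k::alg_closed_field poly poly vec"
    and \<phi> :: "'k poly poly mat"
    and \<delta> :: "nat \<Rightarrow> nat"
    and n d :: nat
  assumes g: "g \<in> carrier_vec n"
    and forms: "\<forall>i<n. bform d (g $ i)"
    and minimal: "minimally_generates g"
    and height: "height ring_of_type_algebra (gen_ideal g {..<n}) = 2"
    and birational: "birational_onto_curve g"
    and resolution: "hilbert_burch g \<delta> \<phi>"
  shows
    "(\<forall>p \<in> singularities n (curve g). \<forall>v \<in> p.
        real (total_degree (gcd_I1 v \<phi>)) = curve_multiplicity n (curve g) p \<and>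
        finite (branches n (curve g) p) \<and>
        card (linear_factors (gcd_I1 v \<phi>) // associated_rel) = card (branches n (curve g) p)) \<and>
     (\<forall>p \<in> singularities n (curve g). \<forall>q \<in> singularities n (curve g). p \<noteq> q \<longrightarrow>
        (\<forall>v \<in> p. \<forall>w \<in> q. coprime (gcd_I1 v \<phi>) (gcd_I1 w \<phi>)))"
proof -
  have nocz: "\<And>w. w \<in> carrier_vec 2 \<Longrightarrow> w \<noteq> 0\<^sub>v 2 \<Longrightarrow> \<exists>i<n. beval (g $ i) w \<noteq> 0"
    by (rule height_2_no_common_zero[OF forms height])
  have nz: "gvec g w \<noteq> 0\<^sub>v n" if w: "w \<in> carrier_vec 2" "w \<noteq> 0\<^sub>v 2" for w
    using gvec_nonzeroI[OF g nocz[OF w]] .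
  have gc: "gvec g w \<in> carrier_vec n" for w using g by (simp add: gvec_def)
  have point: "p = proj_point v \<and> v \<in> carrier_vec n \<and> v \<noteq> 0\<^sub>v n" if p: "p \<in> curve g" and v: "v \<in> p" for p v
  proof -
    obtain w where w: "p = proj_point (gvec g w)" "w \<in> carrier_vec 2" "w \<noteq> 0\<^sub>v 2"
      using p unfolding curve_eq[OF forms g] by blast
    obtain c where c: "c \<noteq> 0" "v = c \<cdot>\<^sub>v gvec g w" using v unfolding w(1) by (rule proj_pointE)
    have "v \<noteq> 0\<^sub>v n" unfolding c(2) by (rule smult_vec_nonzero[OF c(1) gc nz[OF w(2,3)]])
    then show ?thesis using proj_point_smult[OF c(1), of "gvec g w"] gc[of w] unfolding w(1) c(2) by simp
  qed
  have gcd: "is_gcd_of (gcd_I1 v \<phi>) (minors v g)" if v: "v \<in> carrier_vec n" "v \<noteq> 0\<^sub>v n" for v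
  proof -
    obtain w where w: "w \<in> carrier_vec 2" "w \<noteq> 0\<^sub>v 2" "proj_point (gvec g w) \<noteq> proj_point v"
      using birational_not_constant[OF g forms birational, of "proj_point v"] by blast
    obtain f0 where f0: "f0 \<in> minors v g" "beval f0 w \<noteq> 0" using minors_vanish_iff[OF g v nz[OF w(1,2)]] w(3) by blast
    have f0': "f0 \<noteq> 0" using f0(2) by auto
    show ?thesis by (rule gcd_I1_minors[OF g forms _ resolution v(1) f0(1) f0']) (rule nocz)
  qed
  have sing: "p \<in> curve g" if "p \<in> singularities n (curve g)" for p using that by (simp add: singularities_def)
  show ?thesis
  proof (intro conjI ballI impI)
    fix p v assume p: "p \<in> singularities n (curve g)" and v: "v \<in> p"
    note pt = point[OF sing[OF p] v]
    note pv = pt[THEN conjunct1] and vc = pt[THEN conjunct2, THEN conjunct1] pt[THEN conjunct2, THEN conjunct2]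
    obtain \<eta> where \<eta>: "\<eta> \<in> carrier_vec 2" "\<eta> \<noteq> 0\<^sub>v 2" "proj_point (gvec g \<eta>) \<noteq> proj_point v"
      using birational_not_constant[OF g forms birational, of "proj_point v"] by blast
    \<comment> \<open>Such a point \<open>\<eta>\<close> can serve as the point at infinity, away from the fibre over \<open>p\<close>.\<close>
    obtain \<gamma> where ch: "chart \<gamma> \<eta>" using chart_exists[OF \<eta>(1,2)] by blast
    have on: "proj_point v \<in> curve g" using sing[OF p] unfolding pv[symmetric] .
    have "gcd_point \<gamma> \<eta> n d g v (gcd_I1 v \<phi>)"
      by (intro gcd_point.intro birational_point.intro curve_point.intro curve_point_axioms.intro
          birational_point_axioms.intro gcd_point_axioms.intro ch g forms nocz on \<eta>(3) birational gcd[OF vc])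
    from gcd_point.multiplicity_and_branches[OF this, folded pv]
    show "real (total_degree (gcd_I1 v \<phi>)) = curve_multiplicity n (curve g) p"
      "finite (branches n (curve g) p)"
      "card (linear_factors (gcd_I1 v \<phi>) // associated_rel) = card (branches n (curve g) p)" .
  next
    fix p q v w assume p: "p \<in> singularities n (curve g)" and q: "q \<in> singularities n (curve g)" and pq: "p \<noteq> q"
      and v: "v \<in> p" and w: "w \<in> q"
    note pt = point[OF sing[OF p] v] and qt = point[OF sing[OF q] w]
    note pv = pt[THEN conjunct1] pt[THEN conjunct2, THEN conjunct1] pt[THEN conjunct2, THEN conjunct2]
    note qw = qt[THEN conjunct1] qt[THEN conjunct2, THEN conjunct1] qt[THEN conjunct2, THEN conjunct2]
    obtain w1 where w1: "w1 \<in> carrier_vec 2" "w1 \<noteq> 0\<^sub>v 2" "proj_point (gvec g w1) \<noteq> proj_point v"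
      using birational_not_constant[OF g forms birational, of "proj_point v"] by blast
    obtain w2 where w2: "w2 \<in> carrier_vec 2" "w2 \<noteq> 0\<^sub>v 2" "proj_point (gvec g w2) \<noteq> proj_point w"
      using birational_not_constant[OF g forms birational, of "proj_point w"] by blast
    have hv: "gcd_I1 v \<phi> \<noteq> 0" "\<exists>i. bform i (gcd_I1 v \<phi>)"
      "\<And>u. u \<in> carrier_vec 2 \<Longrightarrow> u \<noteq> 0\<^sub>v 2 \<Longrightarrow>
        beval (gcd_I1 v \<phi>) u = 0 \<longleftrightarrow> proj_point (gvec g u) = proj_point v"
      using gcd_minors[OF g forms _ pv(2,3) gcd[OF pv(2,3)] w1] nz by simp_all
    have hw: "gcd_I1 w \<phi> \<noteq> 0" "\<exists>i. bform i (gcd_I1 w \<phi>)"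
      "\<And>u. u \<in> carrier_vec 2 \<Longrightarrow> u \<noteq> 0\<^sub>v 2 \<Longrightarrow>
        beval (gcd_I1 w \<phi>) u = 0 \<longleftrightarrow> proj_point (gvec g u) = proj_point w"
      using gcd_minors[OF g forms _ qw(2,3) gcd[OF qw(2,3)] w2] nz by simp_all
    show "coprime (gcd_I1 v \<phi>) (gcd_I1 w \<phi>)"
    proof (rule coprimeI)
      fix D assume Dv: "D dvd gcd_I1 v \<phi>" and Dw: "D dvd gcd_I1 w \<phi>"
      obtain i where "bform i (gcd_I1 v \<phi>)" using hv(2) by blast
      then obtain j where j: "bform j D" using bform_dvd[OF _ hv(1) Dv] by blast
      have D0: "D \<noteq> 0" using Dv hv(1) by auto
      have "j = 0"
      proof (rule ccontr)
        assume "j \<noteq> 0"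
        then obtain u where u: "u \<in> carrier_vec 2" "u \<noteq> 0\<^sub>v 2" "beval D u = 0" using bform_root[OF j] by blast
        obtain q1 where "gcd_I1 v \<phi> = D * q1" using Dv by (elim dvdE)
        then have "beval (gcd_I1 v \<phi>) u = 0" using u(3) by simp
        then have 1: "proj_point (gvec g u) = proj_point v" using hv(3)[OF u(1,2)] by simp
        obtain q2 where "gcd_I1 w \<phi> = D * q2" using Dw by (elim dvdE)
        then have "beval (gcd_I1 w \<phi>) u = 0" using u(3) by simp
        then have "proj_point (gvec g u) = proj_point w" using hw(3)[OF u(1,2)] by simp
        then show False using 1 pq pv(1) qw(1) by simp
      qed
      then have "bform 0 D" using j by simp
      then have "D = [:[:bcoeff D 0 0:]:]" by (rule bform_0_const)
      then obtain c where Dc: "D = [:[:c:]:]" by blast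
      then have "c \<noteq> 0" using D0 by auto
      then have "[:[:c:]:] * [:[:1 / c:]:] = 1" by (rule const_inverse)
      then have "1 = D * [:[:1 / c:]:]" using Dc by simp
      then show "is_unit D" by (rule dvdI)
    qed
  qed
qed

end
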